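(* Let $G\subset \mathrm{Sp}(V)$, $V=\mathbb{C}^4$, be the group isomorphic to $\mathbb{Z}_2\wr S_2$ generated by $T_0=\mathrm{diag}(1,-1,1,-1)$ and $T_2=\begin{pmatrix}0&1&0&0\\1&0&0&0\\0&0&0&1\\0&0&1&0\end{pmatrix}$. Let $\varphi\colon X\to V/G$ be one of the resolutions obtained as the GIT quotient of $\mathrm{Spec}\,\mathcal{R}$ by $\mathbb{T}=(\mathbb{C}^* )^2$ for the linearization $\chi^{(2,1)}$ or $\chi^{(1,2)}$, with $\mathcal{R}$ as defined in the context, and let $S=\varphi^{-1}([0])$ be its central fiber. Then $S$ decomposes as $S=F\cup P$, where $F$ is isomorphic to the Hirzebruch surface $\mathbb{F}_4$ and $P\cong\mathbb{P}^2$. The intersection $F\cap P$ is a smooth quadric on $P$.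
   Context: Here $[0]\in V/G$ is the image of $0\in V$. Coordinates on $V$ are $x_1,x_2,x_3,x_4$, the symplectic form is $dx_1\wedge dx_3+dx_2\wedge dx_4$. Let $\phi_{13}=-x_1^2-x_2^2+x_3^2+x_4^2$, $\phi_{14}=\sqrt{-1}(x_1^2+x_2^2+x_3^2+x_4^2)$, $\phi_{34}=2(x_1x_3+x_2x_4)$, $\phi_{01}=-2(x_1x_4+x_2x_3)$, $\phi_{03}=2\sqrt{-1}(x_1x_2+x_3x_4)$, $\phi_{04}=2(-x_1x_2+x_3x_4)$, $\phi_{12}=2(x_1x_3-x_2x_4)$, $\phi_{23}=\sqrt{-1}(-x_1^2+x_2^2-x_3^2+x_4^2)$, $\phi_{24}=x_1^2-x_2^2-x_3^2+x_4^2$, $\phi_{02}=2\sqrt{-1}(x_1x_4-x_2x_3)$. $\mathcal{R}$ is the $\mathbb{C}$-subalgebra of $\mathbb{C}[V]^{[G,G]}[t_0^{\pm1},t_2^{\pm1}]$ (with $[G,G]=\{\pm\mathrm{id}\}$) generated by $t_0^{-2}$, $t_2^{-2}$, $\phi_{02}t_0t_2$, $\phi_{01}t_0$, $\phi_{03}t_0$, $\phi_{04}t_0$, $\phi_{12}t_2$, $\phi_{23}t_2$, $\phi_{24}t_2$, $\phi_{13}$, $\phi_{14}$, $\phi_{34}$. The torus $\mathbb{T}=(\mathbb{C}^* )^2$ acts on $\mathrm{Spec}\,\mathcal{R}$ through the $\mathbb{Z}^2$-grading by exponents of $(t_0,t_2)$, and $\chi^{(a,b)}(t_0,t_2)=t_0^at_2^b$.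 The GIT quotient for $\chi^{(a,b)}$ is the quotient by $\mathbb{T}$ of the locus of points at which some element of $\mathcal{R}$ of degree $k(a,b)$, $k\ge1$, does not vanish, i.e. $\mathrm{Proj}\bigoplus_{k\ge0}\mathcal{R}_{k(a,b)}$. For $(a,b)\in\{(2,1),(1,2)\}$ it is a crepant resolution of $V/G$ via the natural map to $\mathrm{Spec}\,\mathcal{R}^{\mathbb{T}}\cong V/G$, where $\mathcal{R}^{\mathbb{T}}\cong\mathbb{C}[V]^G$ is induced by $t_0,t_2\mapsto1$. *)

theory Defs
  imports "HOL-Analysis.Analysis" "HOL-Library.Poly_Mapping" "HOL-Library.Function_Algebras"
begin

section \<open>Complex varieties as spaces with functions\<close>

text \<open>
  Varieties are treated in the classical way (as in Serre's FAC): a set of closed points with the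
  Zariski topology and, for every open set, the complex-valued functions that are regular on it.
  Only the values of \<open>f\<close> on \<open>U\<close> matter in \<open>regular M U f\<close>, and only open \<open>U\<close> are relevant.
\<close>

record 'a fspace =
  topo :: "'a topology"
  regular :: "'a set \<Rightarrow> ('a \<Rightarrow> complex) \<Rightarrow> bool"

definition points :: "'a fspace \<Rightarrow> 'a set" where
  "points M = topspace (topo M)"

definition fs_morphism :: "'a fspace \<Rightarrow> 'b fspace \<Rightarrow> ('a \<Rightarrow> 'b) \<Rightarrow> bool" where
  "fs_morphism M N h \<longleftrightarrow>
     continuous_map (topo M) (topo N) h \<and>
     (\<forall>U f. openin (topo N) U \<and> regular N U f \<longrightarrow> regular M {x \<in> points M. h x \<in> U} (f \<circ> h))"

definition fs_iso :: "'a fspace \<Rightarrow> 'b fspace \<Rightarrow> ('a \<Rightarrow> 'b) \<Rightarrow> bool" where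
  "fs_iso M N h \<longleftrightarrow>
     fs_morphism M N h \<and>
     (\<exists>g. fs_morphism N M g \<and> (\<forall>x\<in>points M. g (h x) = x) \<and> (\<forall>y\<in>points N. h (g y) = y))"

definition fs_isomorphic :: "'a fspace \<Rightarrow> 'b fspace \<Rightarrow> bool" where
  "fs_isomorphic M N \<longleftrightarrow> (\<exists>h. fs_iso M N h)"

text \<open>The variety with point set \<open>X\<close> and algebra of global functions \<open>A\<close>: the sets
  \<open>D(f)\<close> for \<open>f \<in> A\<close> form a basis, and regular functions are locally fractions \<open>g/h\<close>.\<close>

definition zariski :: "'a set \<Rightarrow> ('a \<Rightarrow> complex) set \<Rightarrow> 'a fspace" where
  "zariski X A =
     \<lparr> topo = topology_generated_by {{p \<in> X. f p \<noteq> 0} | f. f \<in> A},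
       regular = (\<lambda>U f. \<forall>p\<in>U. \<exists>g\<in>A. \<exists>h\<in>A. h p \<noteq> 0 \<and> (\<forall>q\<in>U. h q \<noteq> 0 \<longrightarrow> f q = g q / h q)) \<rparr>"

text \<open>The induced (for closed \<open>Z\<close>: reduced) structure on a subset: regular functions are
  locally restrictions of regular functions of the ambient space.\<close>

definition sub_fspace :: "'a fspace \<Rightarrow> 'a set \<Rightarrow> 'a fspace" where
  "sub_fspace M Z =
     \<lparr> topo = subtopology (topo M) Z,
       regular = (\<lambda>W f. \<forall>z\<in>W. \<exists>U g. openin (topo M) U \<and> z \<in> U \<and> regular M U g \<and>
                                   (\<forall>w\<in>W \<inter> U. f w = g w)) \<rparr>"

text \<open>The quotient along \<open>\<pi>\<close>. When \<open>\<pi>\<close> sends a point to its orbit, a regular function on the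
  quotient is an invariant regular function upstairs.\<close>

definition quot_fspace :: "'a fspace \<Rightarrow> ('a \<Rightarrow> 'b) \<Rightarrow> 'b fspace" where
  "quot_fspace M \<pi> =
     \<lparr> topo = topology (\<lambda>W. W \<subseteq> \<pi> ` points M \<and> openin (topo M) {x \<in> points M. \<pi> x \<in> W}),
       regular = (\<lambda>W f. regular M {x \<in> points M. \<pi> x \<in> W} (f \<circ> \<pi>)) \<rparr>"

lemma openin_quot_fspace:
  "openin (topo (quot_fspace M \<pi>)) W \<longleftrightarrow>
     W \<subseteq> \<pi> ` points M \<and> openin (topo M) {x \<in> points M. \<pi> x \<in> W}"
proof -
  have "istopology (\<lambda>W. W \<subseteq> \<pi> ` points M \<and> openin (topo M) {x \<in> points M. \<pi> x \<in> W})"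
    unfolding istopology_def
  proof (intro conjI allI impI)
    fix S T
    assume S: "S \<subseteq> \<pi> ` points M \<and> openin (topo M) {x \<in> points M. \<pi> x \<in> S}"
      and T: "T \<subseteq> \<pi> ` points M \<and> openin (topo M) {x \<in> points M. \<pi> x \<in> T}"
    show "S \<inter> T \<subseteq> \<pi> ` points M" using S by blast
    have "{x \<in> points M. \<pi> x \<in> S \<inter> T} = {x \<in> points M. \<pi> x \<in> S} \<inter> {x \<in> points M. \<pi> x \<in> T}"
      by blast
    then show "openin (topo M) {x \<in> points M. \<pi> x \<in> S \<inter> T}"
      using S T by (simp add: openin_Int)
  next
    fix K
    assume K: "\<forall>W\<in>K. W \<subseteq> \<pi> ` points M \<and> openin (topo M) {x \<in> points M. \<pi> x \<in> W}"
    show "\<Union>K \<subseteq> \<pi> ` points M" using K by blast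
    have "{x \<in> points M. \<pi> x \<in> \<Union>K} = (\<Union>W\<in>K. {x \<in> points M. \<pi> x \<in> W})" by blast
    then show "openin (topo M) {x \<in> points M. \<pi> x \<in> \<Union>K}"
      using K by (metis (no_types, lifting) openin_Union imageE)
  qed
  then show ?thesis by (simp add: quot_fspace_def)
qed


section \<open>Algebras generated by a set, and affine varieties\<close>

text \<open>Here \<open>\<kappa>\<close> is the structure map from the complex numbers to the ambient ring.\<close>

inductive_set subalg_gen :: "(complex \<Rightarrow> 'r::comm_ring_1) \<Rightarrow> 'r set \<Rightarrow> 'r set"
  for \<kappa> :: "complex \<Rightarrow> 'r" and B :: "'r set" where
  scalar: "\<kappa> c \<in> subalg_gen \<kappa> B"
| gen: "b \<in> B \<Longrightarrow> b \<in> subalg_gen \<kappa> B"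
| add: "x \<in> subalg_gen \<kappa> B \<Longrightarrow> y \<in> subalg_gen \<kappa> B \<Longrightarrow> x + y \<in> subalg_gen \<kappa> B"
| mult: "x \<in> subalg_gen \<kappa> B \<Longrightarrow> y \<in> subalg_gen \<kappa> B \<Longrightarrow> x * y \<in> subalg_gen \<kappa> B"

text \<open>Closed points of \<open>Spec A\<close> for a finitely generated subalgebra \<open>A\<close>, as algebra homomorphisms
  \<open>A \<rightarrow> \<complex>\<close> (made extensional so that they are determined by their values on \<open>A\<close>).\<close>

definition spec_points :: "(complex \<Rightarrow> 'r::comm_ring_1) \<Rightarrow> 'r set \<Rightarrow> ('r \<Rightarrow> complex) set" where
  "spec_points \<kappa> A =
     {p \<in> extensional A. (\<forall>c. p (\<kappa> c) = c) \<and>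
        (\<forall>x\<in>A. \<forall>y\<in>A. p (x + y) = p x + p y \<and> p (x * y) = p x * p y)}"

definition spec :: "(complex \<Rightarrow> 'r::comm_ring_1) \<Rightarrow> 'r set \<Rightarrow> ('r \<Rightarrow> complex) fspace" where
  "spec \<kappa> A = zariski (spec_points \<kappa> A) ((\<lambda>f p. p f) ` A)"

definition const_fun :: "complex \<Rightarrow> 'a \<Rightarrow> complex" where
  "const_fun c = (\<lambda>_. c)"

definition poly_functions :: "(complex ^ 'n \<Rightarrow> complex) set" where
  "poly_functions = subalg_gen const_fun (range (\<lambda>i v. v $ i))"

definition affine_space :: "(complex ^ 'n) fspace" where
  "affine_space = zariski UNIV poly_functions"


section \<open>Projective space, Hirzebruch surfaces, smooth conics\<close>

definition proj_class :: "complex ^ 'n \<Rightarrow> (complex ^ 'n) set" where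
  "proj_class z = {c *s z | c. c \<noteq> 0}"

definition proj_space :: "(complex ^ 'n) set fspace" where
  "proj_space = quot_fspace (sub_fspace affine_space (UNIV - {0})) proj_class"

text \<open>\<open>\<bbbF>\<^sub>n\<close> as the quotient of \<open>(\<complex>\<^sup>2 - 0) \<times> (\<complex>\<^sup>2 - 0)\<close> by
  \<open>(\<lambda>,\<mu>)\<cdot>(x\<^sub>0,x\<^sub>1,y\<^sub>0,y\<^sub>1) = (\<lambda>x\<^sub>0, \<lambda>x\<^sub>1, \<mu>y\<^sub>0, \<lambda>\<^sup>-\<^sup>n\<mu>y\<^sub>1)\<close>, i.e. the total space of the
  \<open>\<bbbP>\<^sup>1\<close>-bundle \<open>\<bbbP>(\<O> \<oplus> \<O>(n))\<close> over \<open>\<bbbP>\<^sup>1\<close>, with projection \<open>[x\<^sub>0 : x\<^sub>1]\<close>.\<close>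

definition hirzebruch_class :: "nat \<Rightarrow> complex ^ 4 \<Rightarrow> (complex ^ 4) set" where
  "hirzebruch_class n v =
     {vector [l * v $ 1, l * v $ 2, m * v $ 3, inverse l ^ n * m * v $ 4] | l m. l \<noteq> 0 \<and> m \<noteq> 0}"

definition hirzebruch :: "nat \<Rightarrow> (complex ^ 4) set fspace" where
  "hirzebruch n =
     quot_fspace
       (sub_fspace affine_space {v. (v $ 1 \<noteq> 0 \<or> v $ 2 \<noteq> 0) \<and> (v $ 3 \<noteq> 0 \<or> v $ 4 \<noteq> 0)})
       (hirzebruch_class n)"

definition quad_form :: "complex ^ 'n ^ 'n \<Rightarrow> complex ^ 'n \<Rightarrow> complex" where
  "quad_form A z = (\<Sum>i\<in>UNIV. \<Sum>j\<in>UNIV. A $ i $ j * z $ i * z $ j)"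

text \<open>Smoothness is the Jacobian criterion; \<open>(A + A\<^sup>T) z\<close> is the gradient of \<open>quad_form A\<close> at \<open>z\<close>.
  In particular \<open>quad_form A\<close> is not identically zero.\<close>

definition smooth_quadric :: "(complex ^ 'n) set set \<Rightarrow> bool" where
  "smooth_quadric C \<longleftrightarrow>
     (\<exists>A. (\<forall>z. z \<noteq> 0 \<and> quad_form A z = 0 \<longrightarrow> (A + transpose A) *v z \<noteq> 0) \<and>
          C = {proj_class z | z. z \<noteq> 0 \<and> quad_form A z = 0})"


section \<open>The group and its invariants\<close>

definition T0 :: "complex ^ 4 ^ 4" where
  "T0 = vector [vector [1, 0, 0, 0], vector [0, -1, 0, 0], vector [0, 0, 1, 0], vector [0, 0, 0, -1]]"

definition T2 :: "complex ^ 4 ^ 4" where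
  "T2 = vector [vector [0, 1, 0, 0], vector [1, 0, 0, 0], vector [0, 0, 0, 1], vector [0, 0, 1, 0]]"

text \<open>\<open>T0\<close> and \<open>T2\<close> are involutions, so closing under products gives the generated group.\<close>

inductive_set G :: "(complex ^ 4 ^ 4) set" where
  one: "mat 1 \<in> G"
| T0: "T0 \<in> G"
| T2: "T2 \<in> G"
| mult: "g \<in> G \<Longrightarrow> h \<in> G \<Longrightarrow> g ** h \<in> G"

definition invariants :: "(complex ^ 4 \<Rightarrow> complex) set" where
  "invariants = {f \<in> poly_functions. \<forall>g\<in>G. \<forall>v. f (g *v v) = f v}"

text \<open>Closed points of \<open>V/G = Spec \<complex>[V]\<^sup>G\<close> and the image of \<open>0 \<in> V\<close>.\<close>

definition VG :: "((complex ^ 4 \<Rightarrow> complex) \<Rightarrow> complex) set" where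
  "VG = spec_points const_fun invariants"

definition VG_origin :: "(complex ^ 4 \<Rightarrow> complex) \<Rightarrow> complex" where
  "VG_origin = restrict (\<lambda>f. f 0) invariants"


section \<open>The ring and the GIT quotients of its spectrum\<close>

definition phi13 :: "complex ^ 4 \<Rightarrow> complex" where
  "phi13 x = - ((x$1)^2) - (x$2)^2 + (x$3)^2 + (x$4)^2"
definition phi14 :: "complex ^ 4 \<Rightarrow> complex" where
  "phi14 x = \<i> * ((x$1)^2 + (x$2)^2 + (x$3)^2 + (x$4)^2)"
definition phi34 :: "complex ^ 4 \<Rightarrow> complex" where
  "phi34 x = 2 * (x$1 * x$3 + x$2 * x$4)"
definition phi01 :: "complex ^ 4 \<Rightarrow> complex" where
  "phi01 x = - 2 * (x$1 * x$4 + x$2 * x$3)"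
definition phi03 :: "complex ^ 4 \<Rightarrow> complex" where
  "phi03 x = 2 * \<i> * (x$1 * x$2 + x$3 * x$4)"
definition phi04 :: "complex ^ 4 \<Rightarrow> complex" where
  "phi04 x = 2 * (- (x$1 * x$2) + x$3 * x$4)"
definition phi12 :: "complex ^ 4 \<Rightarrow> complex" where
  "phi12 x = 2 * (x$1 * x$3 - x$2 * x$4)"
definition phi23 :: "complex ^ 4 \<Rightarrow> complex" where
  "phi23 x = \<i> * (- ((x$1)^2) + (x$2)^2 - (x$3)^2 + (x$4)^2)"
definition phi24 :: "complex ^ 4 \<Rightarrow> complex" where
  "phi24 x = (x$1)^2 - (x$2)^2 - (x$3)^2 + (x$4)^2"
definition phi02 :: "complex ^ 4 \<Rightarrow> complex" where
  "phi02 x = 2 * \<i> * (x$1 * x$4 - x$2 * x$3)"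

text \<open>Laurent polynomials in \<open>t\<^sub>0, t\<^sub>2\<close> whose coefficients are functions on \<open>V\<close>;
  \<open>lterm a b f\<close> is \<open>f t\<^sub>0\<^sup>a t\<^sub>2\<^sup>b\<close>. As all coefficients of the generators of \<open>\<R>\<close> are even
  polynomials, \<open>\<R>\<close> lies in \<open>\<complex>[V]\<^bsup>[G,G]\<^esup>[t\<^sub>0\<^sup>\<plusminus>, t\<^sub>2\<^sup>\<plusminus>]\<close>.\<close>

type_synonym laurent = "(int \<times> int) \<Rightarrow>\<^sub>0 (complex ^ 4 \<Rightarrow> complex)"

definition lterm :: "int \<Rightarrow> int \<Rightarrow> (complex ^ 4 \<Rightarrow> complex) \<Rightarrow> laurent" where
  "lterm a b f = Poly_Mapping.single (a, b) f"

definition const_laurent :: "complex \<Rightarrow> laurent" where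
  "const_laurent c = lterm 0 0 (const_fun c)"

definition R :: "laurent set" where
  "R = subalg_gen const_laurent
     {lterm (-2) 0 1, lterm 0 (-2) 1, lterm 1 1 phi02,
      lterm 1 0 phi01, lterm 1 0 phi03, lterm 1 0 phi04,
      lterm 0 1 phi12, lterm 0 1 phi23, lterm 0 1 phi24,
      lterm 0 0 phi13, lterm 0 0 phi14, lterm 0 0 phi34}"

definition R_deg :: "int \<Rightarrow> int \<Rightarrow> laurent set" where
  "R_deg a b = {f \<in> R. Poly_Mapping.keys f \<subseteq> {(a, b)}}"

definition torus :: "(complex \<times> complex) set" where
  "torus = (UNIV - {0}) \<times> (UNIV - {0})"

text \<open>The coaction multiplies the component of degree \<open>(a,b)\<close> by \<open>\<chi>\<^bsup>(a,b)\<^esup>(s) = s\<^sub>0\<^sup>a s\<^sub>2\<^sup>b\<close>.\<close>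

definition torus_scale :: "complex \<times> complex \<Rightarrow> laurent \<Rightarrow> laurent" where
  "torus_scale s = Poly_Mapping.mapp (\<lambda>d f v. fst s powi fst d * snd s powi snd d * f v)"

definition torus_act :: "complex \<times> complex \<Rightarrow> (laurent \<Rightarrow> complex) \<Rightarrow> (laurent \<Rightarrow> complex)" where
  "torus_act s p = restrict (\<lambda>f. p (torus_scale s f)) R"

definition torus_orbit :: "(laurent \<Rightarrow> complex) \<Rightarrow> (laurent \<Rightarrow> complex) set" where
  "torus_orbit p = (\<lambda>s. torus_act s p) ` torus"

definition semistable :: "int \<Rightarrow> int \<Rightarrow> (laurent \<Rightarrow> complex) set" where
  "semistable a b =
     {p \<in> spec_points const_laurent R. \<exists>k\<ge>1. \<exists>f\<in>R_deg (k * a) (k * b). p f \<noteq> 0}"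

definition git_quotient :: "int \<Rightarrow> int \<Rightarrow> (laurent \<Rightarrow> complex) set fspace" where
  "git_quotient a b =
     quot_fspace (sub_fspace (spec const_laurent R) (semistable a b)) torus_orbit"

text \<open>The inclusion of the degree-zero part \<open>\<R>\<^sup>\<T> \<cong> \<complex>[V]\<^sup>G\<close> into \<open>\<R>\<close> identifies \<open>h \<in> \<complex>[V]\<^sup>G\<close> with
  \<open>h t\<^sub>0\<^sup>0 t\<^sub>2\<^sup>0\<close>. The induced map of spectra is constant on torus orbits, so it descends.\<close>

definition to_VG :: "(laurent \<Rightarrow> complex) \<Rightarrow> ((complex ^ 4 \<Rightarrow> complex) \<Rightarrow> complex)" where
  "to_VG p = restrict (\<lambda>h. p (lterm 0 0 h)) invariants"

definition resolution_map :: "(laurent \<Rightarrow> complex) set \<Rightarrow> ((complex ^ 4 \<Rightarrow> complex) \<Rightarrow> complex)" where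
  "resolution_map x = the_elem (to_VG ` x)"

definition central_fiber :: "int \<Rightarrow> int \<Rightarrow> (laurent \<Rightarrow> complex) set set" where
  "central_fiber a b = {x \<in> points (git_quotient a b). resolution_map x = VG_origin}"

end

theory Submission
  imports Defs
begin

text \<open>
  Write \<open>a = (\<phi>\<^sub>0\<^sub>1, \<phi>\<^sub>0\<^sub>3, \<phi>\<^sub>0\<^sub>4) t\<^sub>0\<close>, \<open>b = (\<phi>\<^sub>1\<^sub>2, \<phi>\<^sub>2\<^sub>3, \<phi>\<^sub>2\<^sub>4) t\<^sub>2\<close>, \<open>w = \<phi>\<^sub>0\<^sub>2 t\<^sub>0 t\<^sub>2\<close>,
  \<open>s = t\<^sub>0\<^sup>-\<^sup>2\<close>, \<open>u = t\<^sub>2\<^sup>-\<^sup>2\<close> and take the linearization \<open>(2,1)\<close>. By one-parameter subgroups, a point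
  is semistable iff \<open>a \<noteq> 0\<close> and \<open>(w, b) \<noteq> 0\<close>. Over the origin \<open>\<phi>\<^sub>1\<^sub>3 = \<phi>\<^sub>1\<^sub>4 = \<phi>\<^sub>3\<^sub>4 = 0\<close>, so
  \<open>a \<cdot> a = - w\<^sup>2 u\<close>, \<open>b\<close> is a multiple \<open>\<beta> a\<close>, and the invariants \<open>a\<^sub>j\<^sup>2 s\<close>, \<open>b\<^sub>j\<^sup>2 u\<close> vanish. Hence \<open>s = 0\<close>, and
  either \<open>b = 0\<close>, where \<open>w\<close> can be scaled to \<open>1\<close> and \<open>[a]\<close> is a coordinate on \<open>P = \<bbbP>\<^sup>2\<close>, or \<open>u = 0\<close>, where
  \<open>a\<close> runs through the cone over a conic, parametrized by quadratic forms in \<open>(m, n)\<close>. In terms of the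
  scaling of \<open>(m, n)\<close> the coordinates \<open>w\<close> and \<open>\<beta>\<close> have weights differing by \<open>4\<close>, so this component is \<open>\<bbbF>\<^sub>4\<close>. The
  components meet in \<open>a \<cdot> a = 0\<close>. That all these points of \<open>Spec \<R>\<close> exist follows from
  explicit curves of points of \<open>V \<times> \<T>\<close> degenerating to them. The inverse isomorphisms are given
  locally by quotients of homogeneous elements of \<open>\<R>\<close>. The linearization \<open>(1,2)\<close> is reduced to \<open>(2,1)\<close>
  by a symplectic symmetry of \<open>V\<close> exchanging the indices \<open>0\<close> and \<open>2\<close>.
\<close>

section \<open>Spaces with a sheaf of functions\<close>

text \<open>No presentation of \<open>R\<close> is used: relations between the generators are
  checked one by one, and it is never shown that they generate all relations. A tuple of values
  satisfying them need not come from a point, which is why points are constructed as limits of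
  evaluations on V x T. A limit known on generators extends to all of \<open>R\<close>, whose
  elements are polynomials in them. The second obstacle is that V/G is defined by all invariants at
  once. Being over the origin is a condition on each of them, so every invariant must be shown to
  occur in degree zero of \<open>R\<close>. The double indices come from the isomorphism of Sym^2 of
  a symplectic 4-space with Lambda^2 of an orthogonal 5-space. The relations used are Plucker
  relations and isotropy of rows of the skew matrix of the forms. Put y = (x1,x3) and z = (x2,x4).
  Then \<open>phi01\<close>, \<open>phi03\<close>, \<open>phi04\<close> are symmetric bilinear in y
  and z, \<open>phi02\<close> is a multiple of det(y,z), and up to sign the other six are
  differences (\<open>phi12\<close>, \<open>phi23\<close>, \<open>phi24\<close>) and sums
  (\<open>phi34\<close>, \<open>phi14\<close>, \<open>phi13\<close>) of the same quadratic forms at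
  y and z. The degenerating curves are chosen in these terms.\<close>

locale function_sheaf =
  fixes M :: "'a fspace"
  assumes regular_const: "openin (topo M) U \<Longrightarrow> regular M U (\<lambda>_. c)"
    and regular_add: "openin (topo M) U \<Longrightarrow> regular M U f \<Longrightarrow> regular M U g \<Longrightarrow>
      regular M U (\<lambda>x. f x + g x)"
    and regular_mult: "openin (topo M) U \<Longrightarrow> regular M U f \<Longrightarrow> regular M U g \<Longrightarrow>
      regular M U (\<lambda>x. f x * g x)"
    and regular_divide: "openin (topo M) U \<Longrightarrow> regular M U f \<Longrightarrow> regular M U g \<Longrightarrow>
      (\<And>x. x \<in> U \<Longrightarrow> g x \<noteq> 0) \<Longrightarrow> regular M U (\<lambda>x. f x / g x)"
    and open_nonzero: "openin (topo M) U \<Longrightarrow> regular M U f \<Longrightarrow> openin (topo M) {x \<in> U. f x \<noteq> 0}"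
    and regular_restrict: "openin (topo M) U \<Longrightarrow> regular M U f \<Longrightarrow> openin (topo M) W \<Longrightarrow> W \<subseteq> U \<Longrightarrow>
      (\<And>x. x \<in> W \<Longrightarrow> g x = f x) \<Longrightarrow> regular M W g"
    and regular_local: "openin (topo M) U \<Longrightarrow>
      (\<And>x. x \<in> U \<Longrightarrow> \<exists>W. openin (topo M) W \<and> x \<in> W \<and> W \<subseteq> U \<and> regular M W f) \<Longrightarrow> regular M U f"

section \<open>Subspaces and quotients of spaces with functions\<close>

lemma points_sub_fspace: "points (sub_fspace M Z) = points M \<inter> Z"
  by (simp add: points_def sub_fspace_def)

lemma openin_sub_fspace:
  "openin (topo (sub_fspace M Z)) W \<longleftrightarrow> (\<exists>V. openin (topo M) V \<and> W = V \<inter> Z)"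
  by (simp add: sub_fspace_def openin_subtopology)

lemma regular_sub_fspace:
  "regular (sub_fspace M Z) W f \<longleftrightarrow>
    (\<forall>z\<in>W. \<exists>U g. openin (topo M) U \<and> z \<in> U \<and> regular M U g \<and> (\<forall>w\<in>W \<inter> U. f w = g w))"
  by (simp add: sub_fspace_def)

lemma points_quot_fspace: "points (quot_fspace M \<pi>) = \<pi> ` points M"
proof
  show "points (quot_fspace M \<pi>) \<subseteq> \<pi> ` points M"
    using openin_topspace[of "topo (quot_fspace M \<pi>)"]
    unfolding points_def[of "quot_fspace M \<pi>"] openin_quot_fspace by blast
  have "{x \<in> points M. \<pi> x \<in> \<pi> ` points M} = topspace (topo M)"
    by (auto simp: points_def)
  then have "openin (topo (quot_fspace M \<pi>)) (\<pi> ` points M)" by (simp add: openin_quot_fspace)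
  then show "\<pi> ` points M \<subseteq> points (quot_fspace M \<pi>)"
    unfolding points_def[of "quot_fspace M \<pi>"] by (rule openin_subset)
qed

lemma regular_quot_fspace:
  "regular (quot_fspace M \<pi>) W f \<longleftrightarrow> regular M {x \<in> points M. \<pi> x \<in> W} (f \<circ> \<pi>)"
  by (simp add: quot_fspace_def)

text \<open>Two regular functions on a subspace extend locally, but to different ambient open sets.
  Shrinking to a common neighbourhood first reduces sums, products and quotients to those of the
  ambient space.\<close>

lemma function_sheaf_sub:
  assumes "function_sheaf M"
  shows "function_sheaf (sub_fspace M Z)"
proof -
  interpret function_sheaf M by fact
  let ?N = "sub_fspace M Z"
  show ?thesis
  proof
    fix U c assume U: "openin (topo ?N) U"
    then obtain V where V: "openin (topo M) V" "U = V \<inter> Z" by (auto simp: openin_sub_fspace)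
    then show "regular ?N U (\<lambda>_. c)"
      unfolding regular_sub_fspace using regular_const by blast
  next
    fix U f g assume U: "openin (topo ?N) U" and f: "regular ?N U f" and g: "regular ?N U g"
    have *: "\<exists>W f' g'. openin (topo M) W \<and> z \<in> W \<and> regular M W f' \<and> regular M W g' \<and>
        (\<forall>w\<in>U \<inter> W. f w = f' w \<and> g w = g' w)" if z: "z \<in> U" for z
    proof -
      from f z obtain U1 f1 where 1: "openin (topo M) U1" "z \<in> U1" "regular M U1 f1"
        "\<forall>w\<in>U \<inter> U1. f w = f1 w" unfolding regular_sub_fspace by blast
      from g z obtain U2 g2 where 2: "openin (topo M) U2" "z \<in> U2" "regular M U2 g2"
        "\<forall>w\<in>U \<inter> U2. g w = g2 w" unfolding regular_sub_fspace by blast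
      have O: "openin (topo M) (U1 \<inter> U2)" using 1 2 by blast
      have "regular M (U1 \<inter> U2) f1" using regular_restrict[OF 1(1,3) O] by blast
      moreover have "regular M (U1 \<inter> U2) g2" using regular_restrict[OF 2(1,3) O] by blast
      ultimately show ?thesis using O 1 2
        by (intro exI[of _ "U1 \<inter> U2"] exI[of _ f1] exI[of _ g2]) auto
    qed
    show "regular ?N U (\<lambda>x. f x + g x)"
      unfolding regular_sub_fspace
    proof
      fix z assume "z \<in> U"
      from *[OF this] obtain W f' g' where W: "openin (topo M) W" "z \<in> W" "regular M W f'"
        "regular M W g'" "\<forall>w\<in>U \<inter> W. f w = f' w \<and> g w = g' w" by blast
      show "\<exists>U' g0. openin (topo M) U' \<and> z \<in> U' \<and> regular M U' g0 \<and> (\<forall>w\<in>U \<inter> U'. f w + g w = g0 w)"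
        using W regular_add[OF W(1,3,4)] by (intro exI[of _ W] exI[of _ "\<lambda>x. f' x + g' x"]) auto
    qed
    show "regular ?N U (\<lambda>x. f x * g x)"
      unfolding regular_sub_fspace
    proof
      fix z assume "z \<in> U"
      from *[OF this] obtain W f' g' where W: "openin (topo M) W" "z \<in> W" "regular M W f'"
        "regular M W g'" "\<forall>w\<in>U \<inter> W. f w = f' w \<and> g w = g' w" by blast
      show "\<exists>U' g0. openin (topo M) U' \<and> z \<in> U' \<and> regular M U' g0 \<and> (\<forall>w\<in>U \<inter> U'. f w * g w = g0 w)"
        using W regular_mult[OF W(1,3,4)] by (intro exI[of _ W] exI[of _ "\<lambda>x. f' x * g' x"]) auto
    qed
    assume nz: "\<And>x. x \<in> U \<Longrightarrow> g x \<noteq> 0"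
    show "regular ?N U (\<lambda>x. f x / g x)"
      unfolding regular_sub_fspace
    proof
      fix z assume z: "z \<in> U"
      from *[OF this] obtain W f' g' where W: "openin (topo M) W" "z \<in> W" "regular M W f'"
        "regular M W g'" "\<forall>w\<in>U \<inter> W. f w = f' w \<and> g w = g' w" by blast
      let ?W = "{x \<in> W. g' x \<noteq> 0}"
      have O: "openin (topo M) ?W" using open_nonzero W by blast
      have "regular M ?W f'" by (rule regular_restrict[OF W(1,3) O]) auto
      moreover have "regular M ?W g'" by (rule regular_restrict[OF W(1,4) O]) auto
      ultimately have "regular M ?W (\<lambda>x. f' x / g' x)" using regular_divide[OF O] by blast
      moreover have "z \<in> ?W" using W z nz[OF z] by auto
      ultimately show "\<exists>U' g0. openin (topo M) U' \<and> z \<in> U' \<and> regular M U' g0 \<and>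
          (\<forall>w\<in>U \<inter> U'. f w / g w = g0 w)"
        using O W by (intro exI[of _ ?W] exI[of _ "\<lambda>x. f' x / g' x"]) auto
    qed
  next
    fix U f assume U: "openin (topo ?N) U" and f: "regular ?N U f"
    have "\<exists>T. openin (topo ?N) T \<and> z \<in> T \<and> T \<subseteq> {x \<in> U. f x \<noteq> 0}" if z: "z \<in> U" "f z \<noteq> 0" for z
    proof -
      from f z obtain V g where V: "openin (topo M) V" "z \<in> V" "regular M V g"
        "\<forall>w\<in>U \<inter> V. f w = g w" unfolding regular_sub_fspace by blast
      obtain U' where U': "openin (topo M) U'" "U = U' \<inter> Z" using U by (auto simp: openin_sub_fspace)
      have "openin (topo M) (U' \<inter> {x \<in> V. g x \<noteq> 0})" using open_nonzero[OF V(1,3)] U' by blast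
      then have "openin (topo ?N) (U' \<inter> {x \<in> V. g x \<noteq> 0} \<inter> Z)" by (auto simp: openin_sub_fspace)
      then show ?thesis using V z U'
        by (intro exI[of _ "U' \<inter> {x \<in> V. g x \<noteq> 0} \<inter> Z"]) auto
    qed
    then show "openin (topo ?N) {x \<in> U. f x \<noteq> 0}"
      by (subst openin_subopen) blast
  next
    fix U f W g assume "openin (topo ?N) U" and f: "regular ?N U f" and "openin (topo ?N) W"
      and sub: "W \<subseteq> U" and eq: "\<And>x. x \<in> W \<Longrightarrow> g x = f x"
    show "regular ?N W g"
      unfolding regular_sub_fspace
    proof
      fix z assume z: "z \<in> W"
      then obtain V h where V: "openin (topo M) V" "z \<in> V" "regular M V h" "\<forall>w\<in>U \<inter> V. f w = h w"
        using f sub unfolding regular_sub_fspace by blast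
      then have "\<forall>w\<in>W \<inter> V. g w = h w" using sub eq by auto
      then show "\<exists>U h. openin (topo M) U \<and> z \<in> U \<and> regular M U h \<and> (\<forall>w\<in>W \<inter> U. g w = h w)"
        using V by blast
    qed
  next
    fix U f assume U: "openin (topo ?N) U"
      and loc: "\<And>x. x \<in> U \<Longrightarrow> \<exists>W. openin (topo ?N) W \<and> x \<in> W \<and> W \<subseteq> U \<and> regular ?N W f"
    show "regular ?N U f"
      unfolding regular_sub_fspace
    proof
      fix z assume z: "z \<in> U"
      from loc[OF z] obtain W where W: "openin (topo ?N) W" "z \<in> W" "W \<subseteq> U" "regular ?N W f" by blast
      obtain V where V: "openin (topo M) V" "W = V \<inter> Z" using W(1) by (auto simp: openin_sub_fspace)
      obtain T g where T: "openin (topo M) T" "z \<in> T" "regular M T g" "\<forall>w\<in>W \<inter> T. f w = g w"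
        using W(2,4) unfolding regular_sub_fspace by blast
      have O: "openin (topo M) (V \<inter> T)" using V T by blast
      have "regular M (V \<inter> T) g" by (rule regular_restrict[OF T(1,3) O]) auto
      moreover have "U \<inter> (V \<inter> T) \<subseteq> W \<inter> T"
        using V U by (auto simp: openin_sub_fspace)
      ultimately show "\<exists>U' g. openin (topo M) U' \<and> z \<in> U' \<and> regular M U' g \<and> (\<forall>w\<in>U \<inter> U'. f w = g w)"
        using O T V W by (intro exI[of _ "V \<inter> T"] exI[of _ g]) auto
    qed
  qed
qed

lemma function_sheaf_quot:
  assumes "function_sheaf M"
  shows "function_sheaf (quot_fspace M \<pi>)"
proof -
  interpret function_sheaf M by fact
  let ?N = "quot_fspace M \<pi>" and ?pre = "\<lambda>W. {x \<in> points M. \<pi> x \<in> W}"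
  have op: "openin (topo M) (?pre W)" if "openin (topo ?N) W" for W
    using that by (simp add: openin_quot_fspace)
  show ?thesis
  proof
    fix U c assume "openin (topo ?N) U"
    then show "regular ?N U (\<lambda>_. c)" using regular_const[OF op] by (simp add: regular_quot_fspace o_def)
  next
    fix U f g assume "openin (topo ?N) U" "regular ?N U f" "regular ?N U g"
    then show "regular ?N U (\<lambda>x. f x + g x)" "regular ?N U (\<lambda>x. f x * g x)"
      using regular_add[OF op] regular_mult[OF op] by (simp_all add: regular_quot_fspace o_def)
  next
    fix U f g assume "openin (topo ?N) U" "regular ?N U f" "regular ?N U g"
      "\<And>x. x \<in> U \<Longrightarrow> g x \<noteq> 0"
    then show "regular ?N U (\<lambda>x. f x / g x)"
      using regular_divide[OF op] by (simp add: regular_quot_fspace o_def)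
  next
    fix U f assume U: "openin (topo ?N) U" and f: "regular ?N U f"
    have "{x \<in> ?pre U. (f \<circ> \<pi>) x \<noteq> 0} = ?pre {x \<in> U. f x \<noteq> 0}" by auto
    moreover have "openin (topo M) {x \<in> ?pre U. (f \<circ> \<pi>) x \<noteq> 0}"
      using open_nonzero[OF op[OF U] f[unfolded regular_quot_fspace]] .
    moreover have "{x \<in> U. f x \<noteq> 0} \<subseteq> \<pi> ` points M" using U by (auto simp: openin_quot_fspace)
    ultimately show "openin (topo ?N) {x \<in> U. f x \<noteq> 0}"
      by (simp add: openin_quot_fspace)
  next
    fix U f W g assume U: "openin (topo ?N) U" and f: "regular ?N U f" and W: "openin (topo ?N) W"
      and sub: "W \<subseteq> U" and eq: "\<And>x. x \<in> W \<Longrightarrow> g x = f x"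
    show "regular ?N W g"
      unfolding regular_quot_fspace
      by (rule regular_restrict[OF op[OF U] f[unfolded regular_quot_fspace] op[OF W]])
        (use sub eq in auto)
  next
    fix U f assume U: "openin (topo ?N) U"
      and loc: "\<And>x. x \<in> U \<Longrightarrow> \<exists>W. openin (topo ?N) W \<and> x \<in> W \<and> W \<subseteq> U \<and> regular ?N W f"
    show "regular ?N U f"
      unfolding regular_quot_fspace
    proof (rule regular_local[OF op[OF U]])
      fix x assume x: "x \<in> ?pre U"
      then obtain W where W: "openin (topo ?N) W" "\<pi> x \<in> W" "W \<subseteq> U" "regular ?N W f" using loc by blast
      show "\<exists>W. openin (topo M) W \<and> x \<in> W \<and> W \<subseteq> ?pre U \<and> regular M W (f \<circ> \<pi>)"
        using W x op[OF W(1)] by (intro exI[of _ "?pre W"]) (auto simp: regular_quot_fspace)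
    qed
  qed
qed

text \<open>Sums and products are only required up to equality on \<open>X\<close>: on the spectrum
  \<open>p \<mapsto> p f * p g\<close> agrees with \<open>p \<mapsto> p (f * g)\<close> only at homomorphisms \<open>p\<close>.\<close>

locale function_algebra_on =
  fixes X :: "'a set" and A :: "('a \<Rightarrow> complex) set"
  assumes const_closed: "\<exists>h\<in>A. \<forall>x\<in>X. h x = c"
    and add_closed: "f \<in> A \<Longrightarrow> g \<in> A \<Longrightarrow> \<exists>h\<in>A. \<forall>x\<in>X. h x = f x + g x"
    and mult_closed: "f \<in> A \<Longrightarrow> g \<in> A \<Longrightarrow> \<exists>h\<in>A. \<forall>x\<in>X. h x = f x * g x"
begin

section \<open>The Zariski topology and local fractions\<close>

lemma openin_zariski_basis:
  assumes "f \<in> A"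
  shows "openin (topo (zariski X A)) {p \<in> X. f p \<noteq> 0}"
  using assms by (auto simp: zariski_def intro: topology_generated_by_Basis)

text \<open>The intersection of two principal open sets is the principal open set of the product, so
  the generating family, a priori only a subbasis, is a basis.\<close>

lemma zariski_basis:
  assumes "openin (topo (zariski X A)) U" "p \<in> U"
  shows "\<exists>h\<in>A. h p \<noteq> 0 \<and> {q \<in> X. h q \<noteq> 0} \<subseteq> U"
proof -
  have "generate_topology_on {{p \<in> X. f p \<noteq> 0} | f. f \<in> A} U"
    using assms(1) by (simp add: zariski_def openin_topology_generated_by_iff)
  then show ?thesis using assms(2)
  proof (induction rule: generate_topology_on.induct)
    case (Int a b)
    then obtain h k where h: "h \<in> A" "h p \<noteq> 0" "{q \<in> X. h q \<noteq> 0} \<subseteq> a"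
      and k: "k \<in> A" "k p \<noteq> 0" "{q \<in> X. k q \<noteq> 0} \<subseteq> b" by blast
    \<comment> \<open>\<open>mult_closed\<close> compares values only on \<open>X\<close>, so
      membership in \<open>X\<close> is first extracted from the generating sets.\<close>
    have pX: "p \<in> X"
    proof -
      have "V \<subseteq> X" if "generate_topology_on {{p \<in> X. f p \<noteq> 0} | f. f \<in> A} V" for V
        using that by (induction rule: generate_topology_on.induct) auto
      then show ?thesis using Int.hyps Int.prems by blast
    qed
    obtain l where "l \<in> A" "\<forall>x\<in>X. l x = h x * k x" using mult_closed h k by blast
    then show ?case using h k pX by (intro bexI[of _ l]) auto
  next
    case (UN K)
    then obtain k where "k \<in> K" "p \<in> k" by blast
    then show ?case using UN.IH[of k] by blast
  qed auto
qed

lemma points_zariski: "points (zariski X A) = X"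
proof -
  obtain h where h: "h \<in> A" "\<forall>x\<in>X. h x = 1" using const_closed[of 1] by blast
  then have "{p \<in> X. h p \<noteq> 0} = X" by auto
  then show ?thesis using h openin_zariski_basis[OF h(1)]
    by (auto simp: points_def zariski_def)
qed

lemma openin_zariski_subset: "openin (topo (zariski X A)) U \<Longrightarrow> U \<subseteq> X"
  using points_zariski openin_subset unfolding points_def by blast

lemma regular_zariski:
  "regular (zariski X A) U f \<longleftrightarrow>
    (\<forall>p\<in>U. \<exists>g\<in>A. \<exists>h\<in>A. h p \<noteq> 0 \<and> (\<forall>q\<in>U. h q \<noteq> 0 \<longrightarrow> f q = g q / h q))"
  by (simp add: zariski_def)

lemma regular_zariski_global:
  assumes "f \<in> A" "U \<subseteq> X"
  shows "regular (zariski X A) U f"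
proof -
  obtain h where h: "h \<in> A" "\<forall>x\<in>X. h x = 1" using const_closed[of 1] by blast
  then show ?thesis unfolding regular_zariski using assms
    by (intro ballI bexI[of _ f] bexI[of _ h]) auto
qed

lemma function_sheaf_zariski: "function_sheaf (zariski X A)"
proof
  let ?M = "zariski X A"
  note sub = openin_zariski_subset
  fix U c assume U: "openin (topo ?M) U"
  obtain h where h: "h \<in> A" "\<forall>x\<in>X. h x = 1" using const_closed[of 1] by blast
  obtain k where k: "k \<in> A" "\<forall>x\<in>X. k x = c" using const_closed[of c] by blast
  show "regular ?M U (\<lambda>_. c)"
    unfolding regular_zariski using sub[OF U] h k
    by (intro ballI bexI[of _ k] bexI[of _ h]) auto
next
  let ?M = "zariski X A"
  note sub = openin_zariski_subset
  fix U f g assume U: "openin (topo ?M) U" and f: "regular ?M U f" and g: "regular ?M U g"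
  \<comment> \<open>Common denominator \<open>h1 * h2\<close>: where it is nonzero, both local
    fraction formulas are valid.\<close>
  have *: "\<exists>k1\<in>A. \<exists>k2\<in>A. \<exists>h\<in>A. h p \<noteq> 0 \<and> (\<forall>q\<in>U. h q \<noteq> 0 \<longrightarrow> f q = k1 q / h q \<and> g q = k2 q / h q)"
    if p: "p \<in> U" for p
  proof -
    obtain g1 h1 where 1: "g1 \<in> A" "h1 \<in> A" "h1 p \<noteq> 0" "\<forall>q\<in>U. h1 q \<noteq> 0 \<longrightarrow> f q = g1 q / h1 q"
      using f p unfolding regular_zariski by blast
    obtain g2 h2 where 2: "g2 \<in> A" "h2 \<in> A" "h2 p \<noteq> 0" "\<forall>q\<in>U. h2 q \<noteq> 0 \<longrightarrow> g q = g2 q / h2 q"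
      using g p unfolding regular_zariski by blast
    obtain k1 where k1: "k1 \<in> A" "\<forall>x\<in>X. k1 x = g1 x * h2 x" using mult_closed 1 2 by blast
    obtain k2 where k2: "k2 \<in> A" "\<forall>x\<in>X. k2 x = g2 x * h1 x" using mult_closed 1 2 by blast
    obtain h where h: "h \<in> A" "\<forall>x\<in>X. h x = h1 x * h2 x" using mult_closed 1 2 by blast
    have "f q = k1 q / h q \<and> g q = k2 q / h q" if "q \<in> U" "h q \<noteq> 0" for q
    proof -
      have q: "q \<in> X" using sub[OF U] that by blast
      then have "h1 q \<noteq> 0" "h2 q \<noteq> 0" using h that by auto
      then show ?thesis using 1(4) 2(4) k1(2) k2(2) h(2) q that(1) by simp
    qed
    moreover have "h p \<noteq> 0" using h 1 2 sub[OF U] p by auto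
    ultimately show ?thesis using k1(1) k2(1) h(1) by blast
  qed
  show "regular ?M U (\<lambda>x. f x + g x)"
    unfolding regular_zariski
  proof
    fix p assume "p \<in> U"
    from *[OF this] obtain k1 k2 h where k: "k1 \<in> A" "k2 \<in> A" "h \<in> A" "h p \<noteq> 0"
      "\<forall>q\<in>U. h q \<noteq> 0 \<longrightarrow> f q = k1 q / h q \<and> g q = k2 q / h q" by blast
    obtain k where kk: "k \<in> A" "\<forall>x\<in>X. k x = k1 x + k2 x" using add_closed k by blast
    show "\<exists>g0\<in>A. \<exists>h\<in>A. h p \<noteq> 0 \<and> (\<forall>q\<in>U. h q \<noteq> 0 \<longrightarrow> f q + g q = g0 q / h q)"
      using k kk sub[OF U] by (intro bexI[of _ k] bexI[of _ h]) (auto simp: add_divide_distrib)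
  qed
  show "regular ?M U (\<lambda>x. f x * g x)"
    unfolding regular_zariski
  proof
    fix p assume p: "p \<in> U"
    from *[OF this] obtain k1 k2 h where k: "k1 \<in> A" "k2 \<in> A" "h \<in> A" "h p \<noteq> 0"
      "\<forall>q\<in>U. h q \<noteq> 0 \<longrightarrow> f q = k1 q / h q \<and> g q = k2 q / h q" by blast
    obtain k where kk: "k \<in> A" "\<forall>x\<in>X. k x = k1 x * k2 x" using mult_closed k by blast
    obtain l where l: "l \<in> A" "\<forall>x\<in>X. l x = h x * h x" using mult_closed k by blast
    show "\<exists>g0\<in>A. \<exists>h\<in>A. h p \<noteq> 0 \<and> (\<forall>q\<in>U. h q \<noteq> 0 \<longrightarrow> f q * g q = g0 q / h q)"
      using k kk l p sub[OF U] by (intro bexI[of _ k] bexI[of _ l]) auto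
  qed
  assume nz: "\<And>x. x \<in> U \<Longrightarrow> g x \<noteq> 0"
  show "regular ?M U (\<lambda>x. f x / g x)"
    unfolding regular_zariski
  proof
    fix p assume p: "p \<in> U"
    from *[OF this] obtain k1 k2 h where k: "k1 \<in> A" "k2 \<in> A" "h \<in> A" "h p \<noteq> 0"
      "\<forall>q\<in>U. h q \<noteq> 0 \<longrightarrow> f q = k1 q / h q \<and> g q = k2 q / h q" by blast
    obtain k where kk: "k \<in> A" "\<forall>x\<in>X. k x = k1 x * h x" using mult_closed k by blast
    \<comment> \<open>The factor \<open>h\<close> is not cancelled from (k1 h) / (h k2): the
      formulas for \<open>f\<close> and \<open>g\<close> hold only where \<open>h\<close> is
      nonzero.\<close>
    obtain l where l: "l \<in> A" "\<forall>x\<in>X. l x = h x * k2 x" using mult_closed k by blast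
    have "k2 p \<noteq> 0" using nz[OF p] k p by auto
    then show "\<exists>g0\<in>A. \<exists>h\<in>A. h p \<noteq> 0 \<and> (\<forall>q\<in>U. h q \<noteq> 0 \<longrightarrow> f q / g q = g0 q / h q)"
      using k kk l p sub[OF U] by (intro bexI[of _ k] bexI[of _ l]) (auto simp: subset_iff)
  qed
next
  let ?M = "zariski X A"
  note sub = openin_zariski_subset
  fix U f assume U: "openin (topo ?M) U" and f: "regular ?M U f"
  have "\<exists>T. openin (topo ?M) T \<and> p \<in> T \<and> T \<subseteq> {x \<in> U. f x \<noteq> 0}" if p: "p \<in> U" "f p \<noteq> 0" for p
  proof -
    obtain g h where g: "g \<in> A" "h \<in> A" "h p \<noteq> 0" "\<forall>q\<in>U. h q \<noteq> 0 \<longrightarrow> f q = g q / h q"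
      using f p unfolding regular_zariski by blast
    obtain k where k: "k \<in> A" "\<forall>x\<in>X. k x = g x * h x" using mult_closed g by blast
    have "openin (topo ?M) (U \<inter> {q \<in> X. k q \<noteq> 0})"
      using U openin_zariski_basis[OF k(1)] by blast
    then show ?thesis using g k p sub[OF U]
      by (intro exI[of _ "U \<inter> {q \<in> X. k q \<noteq> 0}"]) auto
  qed
  then show "openin (topo ?M) {x \<in> U. f x \<noteq> 0}"
    by (subst openin_subopen) blast
next
  let ?M = "zariski X A"
  fix U f W g assume "openin (topo ?M) U" and f: "regular ?M U f" and "openin (topo ?M) W"
    and W: "W \<subseteq> U" and eq: "\<And>x. x \<in> W \<Longrightarrow> g x = f x"
  show "regular ?M W g"
    unfolding regular_zariski
  proof
    fix p assume p: "p \<in> W"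
    then obtain k h where "k \<in> A" "h \<in> A" "h p \<noteq> 0" "\<forall>q\<in>U. h q \<noteq> 0 \<longrightarrow> f q = k q / h q"
      using f W unfolding regular_zariski by blast
    then show "\<exists>k\<in>A. \<exists>h\<in>A. h p \<noteq> 0 \<and> (\<forall>q\<in>W. h q \<noteq> 0 \<longrightarrow> g q = k q / h q)"
      using W eq by (intro bexI[of _ k] bexI[of _ h]) auto
  qed
next
  let ?M = "zariski X A"
  note sub = openin_zariski_subset
  fix U f assume U: "openin (topo ?M) U"
    and loc: "\<And>x. x \<in> U \<Longrightarrow> \<exists>W. openin (topo ?M) W \<and> x \<in> W \<and> W \<subseteq> U \<and> regular ?M W f"
  show "regular ?M U f"
    unfolding regular_zariski
  proof
    fix p assume p: "p \<in> U"
    then obtain W where W: "openin (topo ?M) W" "p \<in> W" "W \<subseteq> U" "regular ?M W f" using loc by blast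
    then obtain g h where g: "g \<in> A" "h \<in> A" "h p \<noteq> 0" "\<forall>q\<in>W. h q \<noteq> 0 \<longrightarrow> f q = g q / h q"
      unfolding regular_zariski by blast
    obtain k where k: "k \<in> A" "k p \<noteq> 0" "{q \<in> X. k q \<noteq> 0} \<subseteq> W" using zariski_basis W by blast
    \<comment> \<open>Expanding the fraction by \<open>k\<close> confines the nonvanishing set of
      the new denominator to \<open>W\<close>, where the formula for \<open>f\<close> is
      known.\<close>
    obtain g' where g': "g' \<in> A" "\<forall>x\<in>X. g' x = g x * k x" using mult_closed g k by blast
    obtain h' where h': "h' \<in> A" "\<forall>x\<in>X. h' x = h x * k x" using mult_closed g k by blast
    show "\<exists>g\<in>A. \<exists>h\<in>A. h p \<noteq> 0 \<and> (\<forall>q\<in>U. h q \<noteq> 0 \<longrightarrow> f q = g q / h q)"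
      using g k g' h' p sub[OF U] by (intro bexI[of _ g'] bexI[of _ h']) (auto simp: subset_iff)
  qed
qed

end

section \<open>Morphisms\<close>

lemma function_algebra_on_poly_functions: "function_algebra_on UNIV poly_functions"
proof
  fix c :: complex
  have "const_fun c \<in> poly_functions"
    unfolding poly_functions_def by (rule subalg_gen.scalar)
  then show "\<exists>h\<in>poly_functions. \<forall>x\<in>UNIV. h x = c" by (auto simp: const_fun_def)
next
  fix f g :: "complex ^ 'n \<Rightarrow> complex" assume "f \<in> poly_functions" "g \<in> poly_functions"
  then have "f + g \<in> poly_functions" "f * g \<in> poly_functions"
    unfolding poly_functions_def by (auto intro: subalg_gen.add subalg_gen.mult)
  then show "\<exists>h\<in>poly_functions. \<forall>x\<in>UNIV. h x = f x + g x"
    "\<exists>h\<in>poly_functions. \<forall>x\<in>UNIV. h x = f x * g x"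
    by (auto intro: bexI[of _ "f + g"] bexI[of _ "f * g"])
qed

lemma function_sheaf_affine_space: "function_sheaf affine_space"
  unfolding affine_space_def
  by (rule function_algebra_on.function_sheaf_zariski[OF function_algebra_on_poly_functions])

lemma points_affine_space: "points affine_space = UNIV"
  unfolding affine_space_def
  by (rule function_algebra_on.points_zariski[OF function_algebra_on_poly_functions])

lemma openin_points: "openin (topo M) (points M)"
  by (simp add: points_def)

lemma fs_morphism_points: "fs_morphism M N h \<Longrightarrow> x \<in> points M \<Longrightarrow> h x \<in> points N"
  unfolding fs_morphism_def points_def continuous_map_def by blast

text \<open>Open sets of the target are unions of nonvanishing sets of members of \<open>A\<close>,
  and its regular functions are local quotients of such members. Pulling back the global algebra
  therefore controls everything.\<close>

lemma fs_morphism_into_zariski: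
  assumes "function_sheaf M" "function_algebra_on X A"
    and "\<And>x. x \<in> points M \<Longrightarrow> h x \<in> X"
    and "\<And>f. f \<in> A \<Longrightarrow> regular M (points M) (f \<circ> h)"
  shows "fs_morphism M (zariski X A) h"
proof -
  interpret function_sheaf M by fact
  interpret A: function_algebra_on X A by fact
  have op: "openin (topo M) {x \<in> points M. h x \<in> U}" if U: "openin (topo (zariski X A)) U" for U
  proof (subst openin_subopen, intro ballI)
    fix x assume x: "x \<in> {x \<in> points M. h x \<in> U}"
    then obtain k where k: "k \<in> A" "k (h x) \<noteq> 0" "{q \<in> X. k q \<noteq> 0} \<subseteq> U"
      using A.zariski_basis[OF U] by blast
    have "openin (topo M) {y \<in> points M. (k \<circ> h) y \<noteq> 0}"
      using open_nonzero[OF openin_points assms(4)[OF k(1)]] .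
    moreover have "{y \<in> points M. (k \<circ> h) y \<noteq> 0} \<subseteq> {x \<in> points M. h x \<in> U}"
      using k assms(3) by auto
    ultimately show "\<exists>T. openin (topo M) T \<and> x \<in> T \<and> T \<subseteq> {x \<in> points M. h x \<in> U}"
      using x k by (intro exI[of _ "{y \<in> points M. (k \<circ> h) y \<noteq> 0}"]) auto
  qed
  have "continuous_map (topo M) (topo (zariski X A)) h"
    using op assms(3) A.points_zariski unfolding continuous_map_def points_def by auto
  moreover have "regular M {x \<in> points M. h x \<in> U} (f \<circ> h)"
    if U: "openin (topo (zariski X A)) U" and f: "regular (zariski X A) U f" for U f
  proof (rule regular_local[OF op[OF U]])
    fix x assume x: "x \<in> {x \<in> points M. h x \<in> U}"
    then obtain g k where g: "g \<in> A" "k \<in> A" "k (h x) \<noteq> 0" "\<forall>q\<in>U. k q \<noteq> 0 \<longrightarrow> f q = g q / k q"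
      using f unfolding A.regular_zariski by blast
    let ?W = "{y \<in> {x \<in> points M. h x \<in> U}. (k \<circ> h) y \<noteq> 0}"
    have rk: "regular M {x \<in> points M. h x \<in> U} (k \<circ> h)"
      by (rule regular_restrict[OF openin_points assms(4)[OF g(2)] op[OF U]]) auto
    have O: "openin (topo M) ?W" by (rule open_nonzero[OF op[OF U] rk])
    have 1: "regular M ?W (k \<circ> h)"
      by (rule regular_restrict[OF openin_points assms(4)[OF g(2)] O]) auto
    have 2: "regular M ?W (g \<circ> h)"
      by (rule regular_restrict[OF openin_points assms(4)[OF g(1)] O]) auto
    have 3: "regular M ?W (\<lambda>x. (g \<circ> h) x / (k \<circ> h) x)"
      by (rule regular_divide[OF O 2 1]) auto
    have "regular M ?W (f \<circ> h)"
      by (rule regular_restrict[OF O 3 O]) (use g in auto)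
    then show "\<exists>W. openin (topo M) W \<and> x \<in> W \<and> W \<subseteq> {x \<in> points M. h x \<in> U} \<and> regular M W (f \<circ> h)"
      using O x g by (intro exI[of _ ?W]) auto
  qed
  ultimately show ?thesis unfolding fs_morphism_def by blast
qed

lemma fs_morphism_compose:
  assumes "fs_morphism L M g" "fs_morphism M N h"
  shows "fs_morphism L N (h \<circ> g)"
  unfolding fs_morphism_def
proof (intro conjI allI impI)
  show "continuous_map (topo L) (topo N) (h \<circ> g)"
    by (rule continuous_map_compose[of _ "topo M"]) (use assms in \<open>auto simp: fs_morphism_def\<close>)
  fix U f assume "openin (topo N) U \<and> regular N U f"
  then have "regular M {x \<in> points M. h x \<in> U} (f \<circ> h)"
    and "openin (topo M) {x \<in> points M. h x \<in> U}"
    using assms(2) unfolding fs_morphism_def points_def continuous_map_def by blast+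
  then have "regular L {x \<in> points L. g x \<in> {x \<in> points M. h x \<in> U}} (f \<circ> h \<circ> g)"
    using assms(1) unfolding fs_morphism_def by blast
  moreover have "{x \<in> points L. g x \<in> {x \<in> points M. h x \<in> U}} = {x \<in> points L. (h \<circ> g) x \<in> U}"
    using fs_morphism_points[OF assms(1)] by auto
  ultimately show "regular L {x \<in> points L. (h \<circ> g) x \<in> U} (f \<circ> (h \<circ> g))"
    by (simp add: o_assoc)
qed

lemma fs_morphism_cong:
  assumes "function_sheaf M" "fs_morphism M N h" "\<And>x. x \<in> points M \<Longrightarrow> h' x = h x"
  shows "fs_morphism M N h'"
proof -
  interpret function_sheaf M by fact
  have c: "continuous_map (topo M) (topo N) h" using assms unfolding fs_morphism_def by blast
  have c': "continuous_map (topo M) (topo N) h'"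
    using continuous_map_eq[OF c] assms(3) unfolding points_def by metis
  have eq: "{x \<in> points M. h' x \<in> U} = {x \<in> points M. h x \<in> U}" for U
    using assms(3) by auto
  have "regular M {x \<in> points M. h' x \<in> U} (f \<circ> h')" if "openin (topo N) U" "regular N U f" for U f
  proof -
    have O: "openin (topo M) {x \<in> points M. h x \<in> U}"
      using c that unfolding points_def continuous_map_def by blast
    have r: "regular M {x \<in> points M. h x \<in> U} (f \<circ> h)"
      using assms(2) that unfolding fs_morphism_def by blast
    show ?thesis unfolding eq by (rule regular_restrict[OF O r O]) (use assms(3) in auto)
  qed
  then show ?thesis using c' unfolding fs_morphism_def by blast
qed

lemma fs_morphism_into_sub:
  assumes "function_sheaf M" "fs_morphism M N h" "\<And>x. x \<in> points M \<Longrightarrow> h x \<in> Z"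
  shows "fs_morphism M (sub_fspace N Z) h"
proof -
  interpret function_sheaf M by fact
  have c: "continuous_map (topo M) (topo N) h" using assms unfolding fs_morphism_def by blast
  have op: "openin (topo M) {x \<in> points M. h x \<in> V}" if "openin (topo N) V" for V
    using c that unfolding points_def continuous_map_def by blast
  have c': "continuous_map (topo M) (topo (sub_fspace N Z)) h"
    using c assms(3) by (auto simp: sub_fspace_def continuous_map_in_subtopology points_def)
  have "regular M {x \<in> points M. h x \<in> U} (f \<circ> h)"
    if U: "openin (topo (sub_fspace N Z)) U" and f: "regular (sub_fspace N Z) U f" for U f
  proof -
    have O: "openin (topo M) {x \<in> points M. h x \<in> U}"
      using c' U unfolding points_def continuous_map_def by blast
    show ?thesis
    proof (rule regular_local[OF O])
      fix x assume x: "x \<in> {x \<in> points M. h x \<in> U}"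
      then obtain V g where V: "openin (topo N) V" "h x \<in> V" "regular N V g" "\<forall>w\<in>U \<inter> V. f w = g w"
        using f unfolding regular_sub_fspace by blast
      let ?W = "{x \<in> points M. h x \<in> U} \<inter> {x \<in> points M. h x \<in> V}"
      have O': "openin (topo M) ?W" using O op[OF V(1)] by blast
      have "regular M {x \<in> points M. h x \<in> V} (g \<circ> h)"
        using assms(2) V unfolding fs_morphism_def by blast
      from regular_restrict[OF op[OF V(1)] this O'] have "regular M ?W (f \<circ> h)"
        using V by auto
      then show "\<exists>W. openin (topo M) W \<and> x \<in> W \<and> W \<subseteq> {x \<in> points M. h x \<in> U} \<and> regular M W (f \<circ> h)"
        using O' x V by (intro exI[of _ ?W]) auto
    qed
  qed
  then show ?thesis using c' unfolding fs_morphism_def by blast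
qed

lemma fs_morphism_inclusion: "fs_morphism (sub_fspace M Z) M (\<lambda>x. x)"
  unfolding fs_morphism_def
proof (intro conjI allI impI)
  show "continuous_map (topo (sub_fspace M Z)) (topo M) (\<lambda>x. x)"
    by (simp add: sub_fspace_def continuous_map_from_subtopology)
  fix U f assume "openin (topo M) U \<and> regular M U f"
  then show "regular (sub_fspace M Z) {x \<in> points (sub_fspace M Z). x \<in> U} (f \<circ> (\<lambda>x. x))"
    unfolding regular_sub_fspace by auto
qed

lemma fs_morphism_proj: "fs_morphism M (quot_fspace M \<pi>) \<pi>"
  unfolding fs_morphism_def
proof (intro conjI allI impI)
  have "topspace (topo (quot_fspace M \<pi>)) = \<pi> ` topspace (topo M)"
    using points_quot_fspace[of M \<pi>] by (simp add: points_def)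
  then show "continuous_map (topo M) (topo (quot_fspace M \<pi>)) \<pi>"
    unfolding continuous_map_def by (auto simp: openin_quot_fspace points_def)
qed (simp add: regular_quot_fspace)

text \<open>The universal property of the quotient: openness and regularity downstairs are defined
  by pullback along \<open>\<pi>\<close>.\<close>

lemma fs_morphism_from_quot:
  assumes "fs_morphism M N (h \<circ> \<pi>)"
  shows "fs_morphism (quot_fspace M \<pi>) N h"
proof -
  have c: "continuous_map (topo M) (topo N) (h \<circ> \<pi>)" using assms unfolding fs_morphism_def by blast
  have p: "points (quot_fspace M \<pi>) = \<pi> ` points M" by (rule points_quot_fspace)
  have eq: "{x \<in> points M. \<pi> x \<in> {y \<in> points (quot_fspace M \<pi>). h y \<in> U}} =
      {x \<in> points M. (h \<circ> \<pi>) x \<in> U}" for U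
    unfolding p by auto
  have "continuous_map (topo (quot_fspace M \<pi>)) (topo N) h"
    unfolding continuous_map_def
  proof (intro conjI allI impI)
    show "h \<in> topspace (topo (quot_fspace M \<pi>)) \<rightarrow> topspace (topo N)"
      using fs_morphism_points[OF assms] p unfolding points_def by auto
    fix U assume "openin (topo N) U"
    then have "openin (topo M) {x \<in> points M. (h \<circ> \<pi>) x \<in> U}"
      using c unfolding continuous_map_def points_def by blast
    then have "openin (topo (quot_fspace M \<pi>)) {y \<in> points (quot_fspace M \<pi>). h y \<in> U}"
      unfolding openin_quot_fspace eq using p by auto
    then show "openin (topo (quot_fspace M \<pi>)) {x \<in> topspace (topo (quot_fspace M \<pi>)). h x \<in> U}"
      by (simp add: points_def)
  qed
  moreover have "regular (quot_fspace M \<pi>) {y \<in> points (quot_fspace M \<pi>). h y \<in> U} (f \<circ> h)"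
    if "openin (topo N) U" "regular N U f" for U f
  proof -
    have "regular M {x \<in> points M. (h \<circ> \<pi>) x \<in> U} (f \<circ> (h \<circ> \<pi>))"
      using assms that unfolding fs_morphism_def by blast
    then show ?thesis unfolding regular_quot_fspace eq by (simp add: o_assoc)
  qed
  ultimately show ?thesis unfolding fs_morphism_def by blast
qed

lemma points_sub_open: "openin (topo M) W \<Longrightarrow> points (sub_fspace M W) = W"
  using openin_subset[of "topo M" W] unfolding points_sub_fspace unfolding points_def by blast

lemma fs_morphism_local:
  assumes "function_sheaf M"
    and loc: "\<And>x. x \<in> points M \<Longrightarrow> \<exists>W. openin (topo M) W \<and> x \<in> W \<and> fs_morphism (sub_fspace M W) N h"
  shows "fs_morphism M N h"
proof -
  interpret function_sheaf M by fact
  have pre: "openin (topo M) {x \<in> W. h x \<in> U}"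
    if W: "openin (topo M) W" "fs_morphism (sub_fspace M W) N h" and U: "openin (topo N) U" for W U
  proof -
    have "openin (topo (sub_fspace M W)) {x \<in> points (sub_fspace M W). h x \<in> U}"
      using W(2) U unfolding fs_morphism_def continuous_map_def points_def by blast
    moreover have "{x \<in> points (sub_fspace M W). h x \<in> U} = {x \<in> W. h x \<in> U}"
      using points_sub_open[OF W(1)] by auto
    ultimately show ?thesis using W(1) by (auto simp: openin_sub_fspace)
  qed
  have op: "openin (topo M) {x \<in> points M. h x \<in> U}" if U: "openin (topo N) U" for U
  proof (subst openin_subopen, intro ballI)
    fix x assume x: "x \<in> {x \<in> points M. h x \<in> U}"
    then obtain W where W: "openin (topo M) W" "x \<in> W" "fs_morphism (sub_fspace M W) N h"
      using loc by blast
    then show "\<exists>T. openin (topo M) T \<and> x \<in> T \<and> T \<subseteq> {x \<in> points M. h x \<in> U}"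
      using pre[OF W(1,3) U] x openin_subset[OF W(1)] unfolding points_def
      by (intro exI[of _ "{x \<in> W. h x \<in> U}"]) auto
  qed
  have "h x \<in> points N" if x: "x \<in> points M" for x
  proof -
    obtain W where "x \<in> W" "fs_morphism (sub_fspace M W) N h" using loc x by blast
    then show ?thesis using fs_morphism_points[of "sub_fspace M W" N h x] x
      by (simp add: points_sub_fspace)
  qed
  then have "continuous_map (topo M) (topo N) h"
    using op unfolding continuous_map_def points_def by auto
  moreover have "regular M {x \<in> points M. h x \<in> U} (f \<circ> h)"
    if U: "openin (topo N) U" and f: "regular N U f" for U f
  proof (rule regular_local[OF op[OF U]])
    fix x assume x: "x \<in> {x \<in> points M. h x \<in> U}"
    then obtain W where W: "openin (topo M) W" "x \<in> W" "fs_morphism (sub_fspace M W) N h"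
      using loc by blast
    let ?T = "{x \<in> W. h x \<in> U}"
    have "{x \<in> points (sub_fspace M W). h x \<in> U} = ?T"
      using points_sub_open[OF W(1)] by auto
    then have "regular (sub_fspace M W) ?T (f \<circ> h)"
      using W(3) U f unfolding fs_morphism_def by metis
    then obtain V g where V: "openin (topo M) V" "x \<in> V" "regular M V g" "\<forall>w\<in>?T \<inter> V. (f \<circ> h) w = g w"
      using x W unfolding regular_sub_fspace by blast
    have O: "openin (topo M) (?T \<inter> V)" using pre[OF W(1,3) U] V by blast
    have "regular M (?T \<inter> V) (f \<circ> h)"
      by (rule regular_restrict[OF V(1,3) O]) (use V in auto)
    moreover have "?T \<inter> V \<subseteq> {x \<in> points M. h x \<in> U}"
      using openin_subset[OF W(1)] unfolding points_def by auto
    ultimately show "\<exists>W. openin (topo M) W \<and> x \<in> W \<and> W \<subseteq> {x \<in> points M. h x \<in> U} \<and> regular M W (f \<circ> h)"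
      using O x W V by (intro exI[of _ "?T \<inter> V"]) auto
  qed
  ultimately show ?thesis unfolding fs_morphism_def by blast
qed

lemma fs_morphism_into_affine:
  assumes "function_sheaf M" "\<And>k. regular M (points M) (\<lambda>x. h x $ k)"
  shows "fs_morphism M affine_space h"
  unfolding affine_space_def
proof (rule fs_morphism_into_zariski[OF assms(1) function_algebra_on_poly_functions])
  interpret function_sheaf M by fact
  fix f :: "complex ^ 'b \<Rightarrow> complex" assume "f \<in> poly_functions"
  then show "regular M (points M) (f \<circ> h)"
    unfolding poly_functions_def
  proof induction
    case (scalar c)
    then show ?case using regular_const[OF openin_points] by (simp add: const_fun_def o_def)
  next
    case (gen b)
    then show ?case using assms(2) by (auto simp: o_def)
  next
    case (add x y)
    then show ?case using regular_add[OF openin_points] by (fastforce simp: o_def)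
  next
    case (mult x y)
    then show ?case using regular_mult[OF openin_points] by (fastforce simp: o_def)
  qed
qed auto

text \<open>The chart maps \<open>\<psi>\<close> are local sections of \<open>cls\<close> after the identification by \<open>\<Phi>\<close>, so they
  show that the inverse of the bijection induced by \<open>\<Phi>\<close> is a morphism.\<close>

lemma fs_iso_of_charts:
  fixes Y :: "(complex ^ 'n) set"
  assumes X: "function_sheaf X"
    and \<Phi>: "fs_morphism (sub_fspace affine_space Y) X \<Phi>"
    and eq: "\<And>v v'. v \<in> Y \<Longrightarrow> v' \<in> Y \<Longrightarrow> cls v = cls v' \<Longrightarrow> \<Phi> v = \<Phi> v'"
    and charts: "\<And>v. v \<in> Y \<Longrightarrow> \<exists>W \<psi>. openin (topo X) W \<and> \<Phi> v \<in> W \<and>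
      (\<forall>k. regular X W (\<lambda>x. \<psi> x $ k)) \<and>
      (\<forall>v\<in>Y. \<Phi> v \<in> W \<longrightarrow> \<psi> (\<Phi> v) \<in> Y \<and> cls (\<psi> (\<Phi> v)) = cls v)"
  shows "\<exists>h. fs_iso (sub_fspace X (\<Phi> ` Y)) (quot_fspace (sub_fspace affine_space Y) cls) h \<and>
    (\<forall>v\<in>Y. h (\<Phi> v) = cls v)"
proof -
  let ?A = "sub_fspace affine_space Y" and ?S = "sub_fspace X (\<Phi> ` Y)"
  let ?Q = "quot_fspace ?A cls"
  have sA: "function_sheaf ?A" using function_sheaf_sub function_sheaf_affine_space by blast
  have sQ: "function_sheaf ?Q" using function_sheaf_quot sA by blast
  have sS: "function_sheaf ?S" using function_sheaf_sub X by blast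
  have pA: "points ?A = Y" by (simp add: points_sub_fspace points_affine_space)
  have pQ: "points ?Q = cls ` Y" by (simp add: points_quot_fspace pA)
  have pS: "points ?S = \<Phi> ` Y"
    using fs_morphism_points[OF \<Phi>] pA by (auto simp: points_sub_fspace)
  \<comment> \<open>Injectivity also comes from the charts: \<open>\<psi>\<close> recovers the class
    of \<open>v\<close> from \<open>\<Phi> v\<close>.\<close>
  have inj: "cls v = cls v'" if "v \<in> Y" "v' \<in> Y" "\<Phi> v = \<Phi> v'" for v v'
    using charts[OF that(1)] that by metis
  \<comment> \<open>Both maps are defined by choosing representatives; \<open>inj\<close> and the
    hypothesis \<open>eq\<close> make the results independent of the choice.\<close>
  define h where "h x = cls (SOME v. v \<in> Y \<and> \<Phi> v = x)" for x
  define g where "g c = \<Phi> (SOME v. v \<in> Y \<and> cls v = c)" for c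
  have h: "h (\<Phi> v) = cls v" if "v \<in> Y" for v
  proof -
    have "(SOME v'. v' \<in> Y \<and> \<Phi> v' = \<Phi> v) \<in> Y \<and> \<Phi> (SOME v'. v' \<in> Y \<and> \<Phi> v' = \<Phi> v) = \<Phi> v"
      by (rule someI[of _ v]) (use that in auto)
    then show ?thesis unfolding h_def using inj that by blast
  qed
  have g: "g (cls v) = \<Phi> v" if "v \<in> Y" for v
  proof -
    have "(SOME v'. v' \<in> Y \<and> cls v' = cls v) \<in> Y \<and> cls (SOME v'. v' \<in> Y \<and> cls v' = cls v) = cls v"
      by (rule someI[of _ v]) (use that in auto)
    then show ?thesis unfolding g_def using eq that by blast
  qed
  have mg: "fs_morphism ?Q ?S g"
  proof (rule fs_morphism_into_sub[OF sQ])
    have "fs_morphism ?A X (g \<circ> cls)"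
      by (rule fs_morphism_cong[OF sA \<Phi>]) (use g pA in auto)
    then show "fs_morphism ?Q X g" by (rule fs_morphism_from_quot)
    show "g x \<in> \<Phi> ` Y" if "x \<in> points ?Q" for x using that g pQ by auto
  qed
  have mh: "fs_morphism ?S ?Q h"
  proof (rule fs_morphism_local[OF sS])
    fix x assume "x \<in> points ?S"
    then obtain v where v: "v \<in> Y" "x = \<Phi> v" using pS by blast
    obtain W \<psi> where W: "openin (topo X) W" "\<Phi> v \<in> W" "\<And>k. regular X W (\<lambda>x. \<psi> x $ k)"
      and \<psi>: "\<And>v. v \<in> Y \<Longrightarrow> \<Phi> v \<in> W \<Longrightarrow> \<psi> (\<Phi> v) \<in> Y \<and> cls (\<psi> (\<Phi> v)) = cls v"
      using charts[OF v(1)] by blast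
    let ?W = "W \<inter> \<Phi> ` Y"
    let ?T = "sub_fspace ?S ?W"
    have sT: "function_sheaf ?T" using function_sheaf_sub sS by blast
    have pT: "points ?T = ?W" using pS by (auto simp: points_sub_fspace)
    have iT: "fs_morphism ?T X (\<lambda>x. x)"
      using fs_morphism_compose[OF fs_morphism_inclusion[of ?S ?W] fs_morphism_inclusion[of X]]
      by (simp add: o_def)
    have 1: "fs_morphism ?T affine_space \<psi>"
    proof (rule fs_morphism_into_affine[OF sT])
      fix k
      have "regular ?T {x \<in> points ?T. x \<in> W} ((\<lambda>x. \<psi> x $ k) \<circ> (\<lambda>x. x))"
        using iT W unfolding fs_morphism_def by blast
      moreover have "{x \<in> points ?T. x \<in> W} = points ?T" using pT by auto
      ultimately show "regular ?T (points ?T) (\<lambda>x. \<psi> x $ k)" by (simp add: o_def)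
    qed
    have 2: "fs_morphism ?T ?A \<psi>"
      by (rule fs_morphism_into_sub[OF sT 1]) (use pT \<psi> in auto)
    have 3: "fs_morphism ?T ?Q (cls \<circ> \<psi>)"
      by (rule fs_morphism_compose[OF 2 fs_morphism_proj])
    have "fs_morphism ?T ?Q h"
      by (rule fs_morphism_cong[OF sT 3]) (use pT \<psi> h in auto)
    moreover have "openin (topo ?S) ?W" using W by (auto simp: openin_sub_fspace)
    ultimately show "\<exists>W. openin (topo ?S) W \<and> x \<in> W \<and> fs_morphism (sub_fspace ?S W) ?Q h"
      using v W by blast
  qed
  have "fs_iso ?S ?Q h"
    unfolding fs_iso_def using mh mg h g pS pQ by (intro conjI exI[of _ g]) auto
  then show ?thesis using h by blast
qed

section \<open>Evaluation, scaling and points of the spectrum\<close>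

definition chi :: "complex \<times> complex \<Rightarrow> int \<times> int \<Rightarrow> complex" where
  "chi s d = fst s powi fst d * snd s powi snd d"

lemma chi_zero [simp]: "chi s 0 = 1"
  by (simp add: chi_def)

lemma chi_add: "s \<in> torus \<Longrightarrow> chi s (d + d') = chi s d * chi s d'"
  by (cases s) (simp add: chi_def torus_def power_int_add mult_ac)

lemma chi_mult: "chi (fst s * fst s', snd s * snd s') d = chi s d * chi s' d"
  by (simp add: chi_def power_int_mult_distrib)

lemma chi_nonzero: "s \<in> torus \<Longrightarrow> chi s d \<noteq> 0"
  by (auto simp: chi_def torus_def)

lemma poly_mapping_eq_sum_of_singles_induct [case_names zero add_single]:
  fixes f :: "'a \<Rightarrow>\<^sub>0 'b::comm_monoid_add"
  assumes "P 0" and "\<And>f k b. P f \<Longrightarrow> P (Poly_Mapping.single k b + f)"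
  shows "P f"
proof (induction f rule: update_induct)
  case (update f a b)
  have "Poly_Mapping.update a b f = Poly_Mapping.single a b + f"
    by (rule poly_mapping_eqI)
      (use update in \<open>auto simp: lookup_update lookup_add lookup_single in_keys_iff when_def\<close>)
  then show ?case using assms(2) update by simp
qed (rule assms(1))

lemma multiplicative_of_singles:
  fixes \<Phi> :: "('a::comm_monoid_add \<Rightarrow>\<^sub>0 'b::comm_ring_1) \<Rightarrow> 'c::comm_ring_1"
  assumes add: "\<And>f g. \<Phi> (f + g) = \<Phi> f + \<Phi> g"
    and single: "\<And>k l a b. \<Phi> (Poly_Mapping.single k a * Poly_Mapping.single l b) =
      \<Phi> (Poly_Mapping.single k a) * \<Phi> (Poly_Mapping.single l b)"
  shows "\<Phi> (f * g) = \<Phi> f * \<Phi> g"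
proof -
  have zero: "\<Phi> 0 = 0" using add[of 0 0] by simp
  have *: "\<Phi> (Poly_Mapping.single k a * g) = \<Phi> (Poly_Mapping.single k a) * \<Phi> g" for k a
    by (induction g rule: poly_mapping_eq_sum_of_singles_induct)
      (simp_all add: zero add distrib_left single)
  show ?thesis
    by (induction f rule: poly_mapping_eq_sum_of_singles_induct)
      (simp_all add: zero add distrib_right *)
qed

definition ev :: "complex ^ 4 \<Rightarrow> complex \<times> complex \<Rightarrow> laurent \<Rightarrow> complex" where
  "ev x t f = (\<Sum>d\<in>Poly_Mapping.keys f. chi t d * Poly_Mapping.lookup f d x)"

lemma ev_eq_sum:
  assumes "finite A" "Poly_Mapping.keys f \<subseteq> A"
  shows "ev x t f = (\<Sum>d\<in>A. chi t d * Poly_Mapping.lookup f d x)"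
  unfolding ev_def
  by (rule sum.mono_neutral_left[OF assms]) (auto simp: in_keys_iff)

lemma ev_add: "ev x t (f + g) = ev x t f + ev x t g"
proof -
  let ?A = "Poly_Mapping.keys f \<union> Poly_Mapping.keys g"
  have "Poly_Mapping.keys (f + g) \<subseteq> ?A" by (rule Poly_Mapping.keys_add)
  then show ?thesis
    by (simp add: ev_eq_sum[of ?A] lookup_add distrib_left sum.distrib)
qed

lemma ev_single: "ev x t (Poly_Mapping.single d f) = chi t d * f x"
  by (simp add: ev_eq_sum[of "{d}"])

lemma ev_lterm: "ev x t (lterm a b f) = chi t (a, b) * f x"
  by (simp add: lterm_def ev_single)

lemma ev_mult: "t \<in> torus \<Longrightarrow> ev x t (f * g) = ev x t f * ev x t g"
  by (rule multiplicative_of_singles) (simp_all add: ev_add mult_single ev_single chi_add)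

lemma ev_const: "ev x t (const_laurent c) = c"
  by (simp add: const_laurent_def ev_lterm const_fun_def chi_def)

lemma lookup_torus_scale:
  "Poly_Mapping.lookup (torus_scale s f) d = (\<lambda>v. chi s d * Poly_Mapping.lookup f d v)"
  by (auto simp: torus_scale_def lookup_mapp chi_def when_def in_keys_iff fun_eq_iff)

lemma torus_scale_add: "torus_scale s (f + g) = torus_scale s f + torus_scale s g"
  by (rule poly_mapping_eqI) (simp add: lookup_torus_scale lookup_add fun_eq_iff distrib_left)

lemma torus_scale_single:
  "torus_scale s (Poly_Mapping.single d f) = Poly_Mapping.single d (\<lambda>v. chi s d * f v)"
  by (rule poly_mapping_eqI) (auto simp: lookup_torus_scale lookup_single when_def)

lemma torus_scale_mult:
  assumes "s \<in> torus"
  shows "torus_scale s (f * g) = torus_scale s f * torus_scale s g"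
proof (rule multiplicative_of_singles)
  fix k l and a b :: "complex ^ 4 \<Rightarrow> complex"
  have "(\<lambda>v. chi s (k + l) * (a * b) v) = (\<lambda>v. chi s k * a v) * (\<lambda>v. chi s l * b v)"
    by (simp add: fun_eq_iff chi_add[OF assms])
  then show "torus_scale s (Poly_Mapping.single k a * Poly_Mapping.single l b) =
    torus_scale s (Poly_Mapping.single k a) * torus_scale s (Poly_Mapping.single l b)"
    by (simp add: mult_single torus_scale_single)
qed (rule torus_scale_add)

lemma lterm_mult: "lterm a b f * lterm c d g = lterm (a + c) (b + d) (f * g)"
  by (simp add: lterm_def mult_single)

lemma lterm_add: "lterm a b f + lterm a b g = lterm a b (f + g)"
  by (simp add: lterm_def single_add)

lemma const_laurent_mult_lterm: "const_laurent c * lterm a b f = lterm a b (\<lambda>v. c * f v)"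
proof -
  have "const_fun c * f = (\<lambda>v. c * f v)" by (simp add: fun_eq_iff const_fun_def)
  then show ?thesis by (simp add: const_laurent_def lterm_mult)
qed

lemma torus_scale_lterm:
  "torus_scale s (lterm a b f) = const_laurent (chi s (a, b)) * lterm a b f"
  by (simp add: const_laurent_mult_lterm) (simp add: lterm_def torus_scale_single)

lemma torus_scale_const [simp]: "torus_scale s (const_laurent c) = const_laurent c"
  by (simp add: const_laurent_def torus_scale_lterm lterm_mult chi_def)
    (simp add: const_fun_def times_fun_def)

lemma torus_scale_torus_scale:
  "torus_scale s (torus_scale s' f) = torus_scale (fst s * fst s', snd s * snd s') f"
  by (rule poly_mapping_eqI) (simp add: lookup_torus_scale chi_mult mult.assoc)

lemma torus_scale_one [simp]: "torus_scale (1, 1) f = f"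
  by (rule poly_mapping_eqI) (simp add: lookup_torus_scale chi_def)

lemma const_in_R [simp]: "const_laurent c \<in> R"
  unfolding R_def by (rule subalg_gen.scalar)

lemma add_in_R: "f \<in> R \<Longrightarrow> g \<in> R \<Longrightarrow> f + g \<in> R"
  unfolding R_def by (rule subalg_gen.add)

lemma mult_in_R: "f \<in> R \<Longrightarrow> g \<in> R \<Longrightarrow> f * g \<in> R"
  unfolding R_def by (rule subalg_gen.mult)

lemma R_generators:
  "lterm (-2) 0 1 \<in> R" "lterm 0 (-2) 1 \<in> R" "lterm 1 1 phi02 \<in> R"
  "lterm 1 0 phi01 \<in> R" "lterm 1 0 phi03 \<in> R" "lterm 1 0 phi04 \<in> R"
  "lterm 0 1 phi12 \<in> R" "lterm 0 1 phi23 \<in> R" "lterm 0 1 phi24 \<in> R"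
  "lterm 0 0 phi13 \<in> R" "lterm 0 0 phi14 \<in> R" "lterm 0 0 phi34 \<in> R"
  unfolding R_def by (auto intro: subalg_gen.gen)

lemma torus_scale_in_R:
  assumes "s \<in> torus" "f \<in> R"
  shows "torus_scale s f \<in> R"
  using assms(2)[unfolded R_def]
proof induction
  case (gen g)
  then show ?case using R_generators by (auto simp: torus_scale_lterm intro!: mult_in_R)
next
  case (add f g)
  then show ?case by (simp add: torus_scale_add add_in_R)
next
  case (mult f g)
  then show ?case by (simp add: torus_scale_mult[OF assms(1)] mult_in_R)
qed simp

abbreviation SpecR :: "(laurent \<Rightarrow> complex) set" where
  "SpecR \<equiv> spec_points const_laurent R"

lemma SpecR_const [simp]: "p \<in> SpecR \<Longrightarrow> p (const_laurent c) = c"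
  unfolding spec_points_def by blast

lemma SpecR_add: "p \<in> SpecR \<Longrightarrow> f \<in> R \<Longrightarrow> g \<in> R \<Longrightarrow> p (f + g) = p f + p g"
  unfolding spec_points_def by blast

lemma SpecR_mult: "p \<in> SpecR \<Longrightarrow> f \<in> R \<Longrightarrow> g \<in> R \<Longrightarrow> p (f * g) = p f * p g"
  unfolding spec_points_def by blast

lemma SpecR_extensional: "p \<in> SpecR \<Longrightarrow> p \<in> extensional R"
  unfolding spec_points_def by blast

lemma restrict_in_SpecR:
  assumes "\<And>c. p (const_laurent c) = c"
    and "\<And>f g. f \<in> R \<Longrightarrow> g \<in> R \<Longrightarrow> p (f + g) = p f + p g"
    and "\<And>f g. f \<in> R \<Longrightarrow> g \<in> R \<Longrightarrow> p (f * g) = p f * p g"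
  shows "restrict p R \<in> SpecR"
  unfolding spec_points_def
proof (intro CollectI conjI ballI allI)
  show "restrict p R (const_laurent c) = c" for c using assms(1) by simp
  fix f g assume "f \<in> R" "g \<in> R"
  then show "restrict p R (f + g) = restrict p R f + restrict p R g"
    "restrict p R (f * g) = restrict p R f * restrict p R g"
    using assms(2,3) add_in_R mult_in_R by simp_all
qed simp

lemma SpecR_eqI:
  assumes "p \<in> SpecR" "q \<in> SpecR" "R = subalg_gen const_laurent B" "\<And>g. g \<in> B \<Longrightarrow> p g = q g"
  shows "p = q"
proof (rule extensionalityI[of p R q])
  fix f assume "f \<in> R"
  then have "f \<in> subalg_gen const_laurent B" using assms(3) by simp
  then show "p f = q f"
  proof induction
    case (add x y)
    then show ?case using assms(1,2,3) by (simp add: SpecR_add)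
  next
    case (mult x y)
    then show ?case using assms(1,2,3) by (simp add: SpecR_mult)
  qed (use assms in auto)
qed (use assms SpecR_extensional in auto)

lemma evaluation_in_SpecR: "t \<in> torus \<Longrightarrow> restrict (ev x t) R \<in> SpecR"
  by (rule restrict_in_SpecR) (simp_all add: ev_const ev_add ev_mult)

text \<open>Each \<open>P i\<close> is additive and multiplicative, and elements of \<open>R\<close>
  are polynomial expressions in \<open>B\<close>, so convergence propagates by induction without any
  knowledge of relations.\<close>

lemma tendsto_on_R:
  assumes "R = subalg_gen const_laurent B"
    and "\<And>i. P i \<in> SpecR"
    and "\<And>g. g \<in> B \<Longrightarrow> \<exists>l. ((\<lambda>i. P i g) \<longlongrightarrow> l) F"
    and "f \<in> R"
  shows "\<exists>l. ((\<lambda>i. P i f) \<longlongrightarrow> l) F"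
  using assms(4)[unfolded assms(1)]
proof induction
  case (scalar c)
  then show ?case using assms(2) by auto
next
  case (gen b)
  then show ?case using assms(3) by blast
next
  case (add x y)
  then obtain k l where "((\<lambda>i. P i x) \<longlongrightarrow> k) F" "((\<lambda>i. P i y) \<longlongrightarrow> l) F" by blast
  from tendsto_add[OF this] show ?case using add(1,2) assms(1,2) by (auto simp: SpecR_add)
next
  case (mult x y)
  then obtain k l where "((\<lambda>i. P i x) \<longlongrightarrow> k) F" "((\<lambda>i. P i y) \<longlongrightarrow> l) F" by blast
  from tendsto_mult[OF this] show ?case using mult(1,2) assms(1,2) by (auto simp: SpecR_mult)
qed

text \<open>Uniqueness of limits turns the pointwise limit into a function, and it is again a
  homomorphism because sums and products pass to the limit. This is the source of all boundary
  points of the spectrum.\<close>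

lemma limit_point_of_SpecR:
  assumes "R = subalg_gen const_laurent B"
    and P: "\<And>i. P i \<in> SpecR"
    and F: "F \<noteq> bot"
    and "\<And>g. g \<in> B \<Longrightarrow> ((\<lambda>i. P i g) \<longlongrightarrow> v g) F"
  obtains p where "p \<in> SpecR" "\<And>g. g \<in> B \<Longrightarrow> p g = v g" "\<And>f. f \<in> R \<Longrightarrow> ((\<lambda>i. P i f) \<longlongrightarrow> p f) F"
proof -
  have "\<forall>f. \<exists>l. f \<in> R \<longrightarrow> ((\<lambda>i. P i f) \<longlongrightarrow> l) F"
    using tendsto_on_R[OF assms(1), of P F] P assms(4) by blast
  then obtain q where q: "\<And>f. f \<in> R \<Longrightarrow> ((\<lambda>i. P i f) \<longlongrightarrow> q f) F" by metis
  have uniq: "\<And>f l. f \<in> R \<Longrightarrow> ((\<lambda>i. P i f) \<longlongrightarrow> l) F \<Longrightarrow> q f = l"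
    using q tendsto_unique[OF F] by blast
  have "restrict q R \<in> SpecR"
  proof (rule restrict_in_SpecR)
    fix c show "q (const_laurent c) = c"
      by (rule uniq) (simp_all add: P)
  next
    fix f g assume fg: "f \<in> R" "g \<in> R"
    show "q (f + g) = q f + q g"
      using tendsto_add[OF q q, OF fg] fg by (intro uniq) (simp_all add: P SpecR_add add_in_R)
    show "q (f * g) = q f * q g"
      using tendsto_mult[OF q q, OF fg] fg by (intro uniq) (simp_all add: P SpecR_mult mult_in_R)
  qed
  moreover have "restrict q R g = v g" if "g \<in> B" for g
  proof -
    have "g \<in> R" using that assms(1) subalg_gen.gen by blast
    then show ?thesis using uniq assms(4) that by simp
  qed
  ultimately show thesis using that[of "restrict q R"] q by simp
qed

lemma function_algebra_on_SpecR: "function_algebra_on SpecR ((\<lambda>f p. p f) ` R)"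
proof
  fix c show "\<exists>h\<in>(\<lambda>f p. p f) ` R. \<forall>x\<in>SpecR. h x = c"
    by (auto intro!: bexI[of _ "const_laurent c"])
next
  fix f g :: "(laurent \<Rightarrow> complex) \<Rightarrow> complex"
  assume "f \<in> (\<lambda>f p. p f) ` R" "g \<in> (\<lambda>f p. p f) ` R"
  then obtain k l where k: "k \<in> R" "l \<in> R" "f = (\<lambda>p. p k)" "g = (\<lambda>p. p l)" by blast
  then show "\<exists>h\<in>(\<lambda>f p. p f) ` R. \<forall>x\<in>SpecR. h x = f x + g x"
    by (auto intro!: bexI[of _ "k + l"] simp: SpecR_add add_in_R)
  from k show "\<exists>h\<in>(\<lambda>f p. p f) ` R. \<forall>x\<in>SpecR. h x = f x * g x"
    by (auto intro!: bexI[of _ "k * l"] simp: SpecR_mult mult_in_R)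
qed

section \<open>The torus action and the quotient\<close>

lemma torus_one: "(1, 1) \<in> torus"
  by (simp add: torus_def)

lemma torus_act_in_SpecR:
  assumes "s \<in> torus" "p \<in> SpecR"
  shows "torus_act s p \<in> SpecR"
  unfolding torus_act_def
  by (rule restrict_in_SpecR)
    (use assms in \<open>simp_all add: torus_scale_add torus_scale_mult torus_scale_in_R SpecR_add SpecR_mult\<close>)

lemma torus_act_torus_act:
  "s' \<in> torus \<Longrightarrow> torus_act s' (torus_act s p) = torus_act (fst s * fst s', snd s * snd s') p"
  by (auto simp: torus_act_def fun_eq_iff torus_scale_torus_scale torus_scale_in_R)

lemma torus_act_one: "p \<in> SpecR \<Longrightarrow> torus_act (1, 1) p = p"
  using extensional_restrict[OF SpecR_extensional] by (simp add: torus_act_def)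

lemma mem_torus_orbit: "p \<in> SpecR \<Longrightarrow> p \<in> torus_orbit p"
  unfolding torus_orbit_def using torus_act_one torus_one by (metis imageI)

lemma torus_orbit_act:
  assumes "s \<in> torus" "p \<in> SpecR"
  shows "torus_orbit (torus_act s p) = torus_orbit p"
proof
  show "torus_orbit (torus_act s p) \<subseteq> torus_orbit p"
    using assms by (auto simp: torus_orbit_def torus_act_torus_act torus_def)
  show "torus_orbit p \<subseteq> torus_orbit (torus_act s p)"
  proof
    fix q assume "q \<in> torus_orbit p"
    then obtain s' where s': "s' \<in> torus" "q = torus_act s' p" by (auto simp: torus_orbit_def)
    let ?s = "(fst s' / fst s, snd s' / snd s)"
    have t: "?s \<in> torus" using assms s' by (auto simp: torus_def)
    have "torus_act ?s (torus_act s p) = q"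
      using assms(1) s' by (subst torus_act_torus_act[OF t]) (auto simp: torus_def)
    then show "q \<in> torus_orbit (torus_act s p)" using t unfolding torus_orbit_def by blast
  qed
qed

lemma torus_orbit_eqD:
  assumes "torus_orbit p = torus_orbit q" "p \<in> SpecR"
  obtains s where "s \<in> torus" "p = torus_act s q"
  using assms mem_torus_orbit unfolding torus_orbit_def by blast

section \<open>Homogeneous elements and semistability\<close>

abbreviation R_degree :: "int \<times> int \<Rightarrow> laurent set" where
  "R_degree d \<equiv> R_deg (fst d) (snd d)"

lemma R_degree_in_R: "f \<in> R_degree d \<Longrightarrow> f \<in> R"
  by (simp add: R_deg_def)

lemma R_degree_eq_single:
  assumes "f \<in> R_degree d"
  shows "f = Poly_Mapping.single d (Poly_Mapping.lookup f d)"
proof (rule poly_mapping_eqI)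
  fix k
  have "k = d \<or> Poly_Mapping.lookup f k = 0" using assms by (auto simp: R_deg_def in_keys_iff)
  then show "Poly_Mapping.lookup f k =
      Poly_Mapping.lookup (Poly_Mapping.single d (Poly_Mapping.lookup f d)) k"
    by (auto simp: lookup_single when_def)
qed

lemma lterm_in_R_degree: "lterm a b f \<in> R \<Longrightarrow> lterm a b f \<in> R_degree (a, b)"
  by (simp add: R_deg_def lterm_def)

lemma R_degree_mult:
  assumes "f \<in> R_degree d" "g \<in> R_degree e"
  shows "f * g \<in> R_degree (d + e)"
proof -
  have "f * g = Poly_Mapping.single (d + e) (Poly_Mapping.lookup f d * Poly_Mapping.lookup g e)"
    using R_degree_eq_single[OF assms(1)] R_degree_eq_single[OF assms(2)] mult_single by metis
  then have "Poly_Mapping.keys (f * g) \<subseteq> {d + e}" by simp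
  moreover have "f * g \<in> R" using assms R_degree_in_R mult_in_R by blast
  ultimately show ?thesis by (simp add: R_deg_def plus_prod_def)
qed

lemma R_degree_add:
  assumes "f \<in> R_degree d" "g \<in> R_degree d"
  shows "f + g \<in> R_degree d"
  using assms Poly_Mapping.keys_add[of f g] add_in_R[of f g] unfolding R_deg_def by blast

lemma const_in_R_degree: "const_laurent c \<in> R_degree 0"
  using lterm_in_R_degree[of 0 0 "const_fun c"] const_in_R[of c]
  by (simp only: const_laurent_def zero_prod_def)

lemma R_degree_const_mult: "f \<in> R_degree d \<Longrightarrow> const_laurent c * f \<in> R_degree d"
  using R_degree_mult[OF const_in_R_degree, of f d c] by simp

lemma torus_scale_R_degree:
  assumes "f \<in> R_degree d"
  shows "torus_scale s f = const_laurent (chi s d) * f"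
  using torus_scale_lterm[of s "fst d" "snd d" "Poly_Mapping.lookup f d"]
    R_degree_eq_single[OF assms] by (simp add: lterm_def)

lemma torus_act_R_degree:
  assumes "p \<in> SpecR" "f \<in> R_degree d"
  shows "torus_act s p f = chi s d * p f"
  using assms R_degree_in_R[OF assms(2)]
  by (simp add: torus_act_def torus_scale_R_degree SpecR_mult)

lemma semistable_subset: "semistable a b \<subseteq> SpecR"
  by (auto simp: semistable_def)

text \<open>The easy half of the Hilbert--Mumford criterion: a one-parameter subgroup \<open>\<sigma>\<close> which has a
  limit at \<open>p\<close> but negative pairing with the linearization destabilizes \<open>p\<close>.\<close>

lemma not_semistable_of_one_parameter_subgroup:
  assumes "R = subalg_gen const_laurent B" and p: "p \<in> SpecR"
    and \<sigma>: "\<And>t. t \<noteq> 0 \<Longrightarrow> \<sigma> t \<in> torus" "\<And>t. t \<noteq> 0 \<Longrightarrow> chi (\<sigma> t) (a, b) = inverse t ^ Suc j"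
    and lim: "\<And>g. g \<in> B \<Longrightarrow> \<exists>n. \<forall>t. t \<noteq> 0 \<longrightarrow> torus_act (\<sigma> t) p g = t ^ n * p g"
  shows "p \<notin> semistable a b"
proof
  assume "p \<in> semistable a b"
  then obtain k f where k: "k \<ge> 1" and f: "f \<in> R_deg (k * a) (k * b)" and nz: "p f \<noteq> 0"
    by (auto simp: semistable_def)
  \<comment> \<open>\<open>tendsto_on_R\<close> wants a point of the spectrum for every index, so
    the family is completed at 0; the punctured limit at 0 does not see this value.\<close>
  define \<tau> where "\<tau> t = (if t = 0 then (1, 1) else \<sigma> t)" for t
  have "\<exists>l. ((\<lambda>t. torus_act (\<tau> t) p f) \<longlongrightarrow> l) (at 0)"
  proof (rule tendsto_on_R[OF assms(1)])
    show "torus_act (\<tau> t) p \<in> SpecR" for t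
      using \<sigma>(1) torus_one p by (auto simp: \<tau>_def intro: torus_act_in_SpecR)
    show "\<exists>l. ((\<lambda>t. torus_act (\<tau> t) p g) \<longlongrightarrow> l) (at 0)" if g: "g \<in> B" for g
    proof -
      obtain n where n: "\<And>t. t \<noteq> 0 \<Longrightarrow> torus_act (\<sigma> t) p g = t ^ n * p g" using lim[OF g] by blast
      have "((\<lambda>t. t ^ n * p g) \<longlongrightarrow> 0 ^ n * p g) (at 0)" by (intro tendsto_intros)
      then have "((\<lambda>t. torus_act (\<tau> t) p g) \<longlongrightarrow> 0 ^ n * p g) (at 0)"
        by (rule Lim_transform_eventually) (auto simp: eventually_at_filter \<tau>_def n)
      then show ?thesis by blast
    qed
    show "f \<in> R" using f by (simp add: R_deg_def)
  qed
  then obtain l where l: "((\<lambda>t. torus_act (\<tau> t) p f) \<longlongrightarrow> l) (at 0)" by blast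
  \<comment> \<open>By homogeneity the translate of \<open>p\<close> takes the value t^(-(j+1)k)
    \<open>p f\<close> on \<open>f\<close>. Multiplied by this power of t it is constantly
    \<open>p f\<close>, whereas the existing limit \<open>l\<close> forces the product to tend to
    0.\<close>
  have "((\<lambda>t. (t ^ Suc j) ^ nat k * torus_act (\<tau> t) p f) \<longlongrightarrow> (0 ^ Suc j) ^ nat k * l) (at 0)"
    by (intro tendsto_intros l)
  then have lim0: "((\<lambda>t. (t ^ Suc j) ^ nat k * torus_act (\<tau> t) p f) \<longlongrightarrow> 0) (at 0)"
    using k by (simp add: power_0_left)
  have "(t ^ Suc j) ^ nat k * torus_act (\<tau> t) p f = p f" if t: "t \<noteq> 0" for t
  proof -
    have "chi (\<sigma> t) (k * a, k * b) = chi (\<sigma> t) (a, b) powi k"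
      by (simp add: chi_def power_int_mult_distrib flip: power_int_mult)
        (simp add: mult.commute)
    also have "\<dots> = inverse ((t ^ Suc j) ^ nat k)"
      using k by (simp add: \<sigma>(2)[OF t] power_int_def power_inverse del: power_Suc)
    finally show ?thesis
      using torus_act_R_degree[OF p, of f "(k * a, k * b)" "\<sigma> t"] f t
      by (simp add: \<tau>_def del: power_Suc)
  qed
  then have "((\<lambda>t. p f) \<longlongrightarrow> 0) (at (0::complex))"
    by (intro Lim_transform_eventually[OF lim0]) (auto simp: eventually_at_filter)
  then show False using nz by (simp add: tendsto_const_iff)
qed

section \<open>Invariant polynomials\<close>

lemma vector_4:
  "(vector [a, b, c, d] :: 'a::zero ^ 4) $ 1 = a"
  "(vector [a, b, c, d] :: 'a::zero ^ 4) $ 2 = b"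
  "(vector [a, b, c, d] :: 'a::zero ^ 4) $ 3 = c"
  "(vector [a, b, c, d] :: 'a::zero ^ 4) $ 4 = d"
  unfolding vector_def by simp_all

lemmas phi_defs = phi13_def phi14_def phi34_def phi01_def phi03_def phi04_def phi12_def phi23_def
  phi24_def phi02_def

lemma T0_vector_mult: "T0 *v x = vector [x $ 1, - x $ 2, x $ 3, - x $ 4]"
  by (simp add: vec_eq_iff forall_4 matrix_vector_mult_def sum_4 T0_def vector_4)

lemma T2_vector_mult: "T2 *v x = vector [x $ 2, x $ 1, x $ 4, x $ 3]"
  by (simp add: vec_eq_iff forall_4 matrix_vector_mult_def sum_4 T2_def vector_4)

section \<open>Signs of the coefficients under the group\<close>

lemma ev_eq_on_R:
  assumes "t \<in> torus" "t' \<in> torus" "f \<in> R"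
    and "\<And>g. g \<in> {lterm (-2) 0 1, lterm 0 (-2) 1, lterm 1 1 phi02,
      lterm 1 0 phi01, lterm 1 0 phi03, lterm 1 0 phi04,
      lterm 0 1 phi12, lterm 0 1 phi23, lterm 0 1 phi24,
      lterm 0 0 phi13, lterm 0 0 phi14, lterm 0 0 phi34} \<Longrightarrow> ev x t g = ev x' t' g"
  shows "ev x t f = ev x' t' f"
  using assms(3)[unfolded R_def]
  by induction (use assms(1,2,4) in \<open>simp_all only: ev_const ev_add ev_mult\<close>)

text \<open>On each generator of \<open>R\<close> the matrix \<open>T0\<close> changes the
  coefficient by the parity of the exponent of t0, and \<open>T2\<close> does the same for t2.
  Acting on V thus amounts to putting -1 for the corresponding variable.\<close>

lemma ev_T0: "f \<in> R \<Longrightarrow> ev (T0 *v x) (1, 1) f = ev x (-1, 1) f"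
  by (rule ev_eq_on_R)
    (auto simp: torus_def ev_lterm chi_def T0_vector_mult phi_defs vector_4 algebra_simps)

lemma ev_T2: "f \<in> R \<Longrightarrow> ev (T2 *v x) (1, 1) f = ev x (1, -1) f"
  by (rule ev_eq_on_R)
    (auto simp: torus_def ev_lterm chi_def T2_vector_mult phi_defs vector_4 algebra_simps)

lemma coefficient_T0: "lterm a b h \<in> R \<Longrightarrow> h (T0 *v x) = (-1) powi a * h x"
  using ev_T0[of "lterm a b h" x] by (simp add: ev_lterm chi_def)

lemma coefficient_T2: "lterm a b h \<in> R \<Longrightarrow> h (T2 *v x) = (-1) powi b * h x"
  using ev_T2[of "lterm a b h" x] by (simp add: ev_lterm chi_def)

text \<open>Exponents are recorded only modulo 2: the generators t0^-2 and t2^-2 of \<open>R\<close>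
  bring an exponent 2 back to 0. The four parts correspond to the sign characters of
  \<open>T0\<close> and \<open>T2\<close>.\<close>

definition parity_part :: "bool \<Rightarrow> bool \<Rightarrow> (complex ^ 4 \<Rightarrow> complex) set" where
  "parity_part b c = {h. lterm (of_bool b) (of_bool c) h \<in> R}"

lemma parity_part_mult:
  assumes "h \<in> parity_part b c" "h' \<in> parity_part b' c'"
  shows "h * h' \<in> parity_part (b \<noteq> b') (c \<noteq> c')"
proof -
  let ?H = "lterm (of_bool b) (of_bool c) h * lterm (of_bool b') (of_bool c') h'"
  have H: "?H \<in> R" using assms unfolding parity_part_def by (auto intro: mult_in_R)
  \<comment> \<open>In each variable the exponents add up to at most 2; the variants of
    \<open>?H\<close> cover the cases where the first, the second or both have to be
    lowered.\<close>
  have 1: "lterm (-2) 0 1 * ?H \<in> R" using R_generators(1) H by (rule mult_in_R)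
  have 2: "lterm 0 (-2) 1 * ?H \<in> R" using R_generators(2) H by (rule mult_in_R)
  have 3: "lterm 0 (-2) 1 * (lterm (-2) 0 1 * ?H) \<in> R" using R_generators(2) 1 by (rule mult_in_R)
  show ?thesis using H 1 2 3
    by (cases b; cases c; cases b'; cases c') (simp_all add: parity_part_def lterm_mult)
qed

lemma parity_part_add: "h \<in> parity_part b c \<Longrightarrow> h' \<in> parity_part b c \<Longrightarrow> h + h' \<in> parity_part b c"
  unfolding parity_part_def by (metis add_in_R lterm_add mem_Collect_eq)

definition even_parts :: "(complex ^ 4 \<Rightarrow> complex) set" where
  "even_parts = {f. \<exists>h. (\<forall>b c. h b c \<in> parity_part b c) \<and>
     f = h False False + h False True + h True False + h True True}"

lemma zero_in_parity_part: "0 \<in> parity_part b c"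
proof -
  have "lterm (of_bool b) (of_bool c) 0 = const_laurent 0"
    by (simp add: lterm_def const_laurent_def const_fun_def flip: zero_fun_def)
  then show ?thesis unfolding parity_part_def using const_in_R by simp
qed

lemma parity_part_subset_even_parts:
  assumes "f \<in> parity_part b c"
  shows "f \<in> even_parts"
proof -
  let ?h = "\<lambda>b' c'. if b' = b \<and> c' = c then f else 0"
  have "f = ?h False False + ?h False True + ?h True False + ?h True True"
    by (cases b; cases c) simp_all
  moreover have "\<forall>b c. ?h b c \<in> parity_part b c"
    using assms zero_in_parity_part by auto
  ultimately show ?thesis unfolding even_parts_def by (intro CollectI exI[of _ ?h] conjI)
qed

lemma zero_in_even_parts: "0 \<in> even_parts"
  using zero_in_parity_part by (rule parity_part_subset_even_parts)

lemma even_parts_add: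
  assumes "f \<in> even_parts" "g \<in> even_parts"
  shows "f + g \<in> even_parts"
proof -
  obtain h k where h: "\<forall>b c. h b c \<in> parity_part b c"
      "f = h False False + h False True + h True False + h True True"
    and k: "\<forall>b c. k b c \<in> parity_part b c"
      "g = k False False + k False True + k True False + k True True"
    using assms unfolding even_parts_def by blast
  have "f + g = (\<lambda>b c. h b c + k b c) False False + (\<lambda>b c. h b c + k b c) False True +
      (\<lambda>b c. h b c + k b c) True False + (\<lambda>b c. h b c + k b c) True True"
    by (simp add: h k)
  moreover have "\<forall>b c. (\<lambda>b c. h b c + k b c) b c \<in> parity_part b c"
    using h k parity_part_add by simp
  ultimately show ?thesis unfolding even_parts_def
    by (intro CollectI exI[of _ "\<lambda>b c. h b c + k b c"] conjI)
qed

lemma even_parts_mult: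
  assumes "f \<in> even_parts" "g \<in> even_parts"
  shows "f * g \<in> even_parts"
proof -
  obtain h k where h: "\<forall>b c. h b c \<in> parity_part b c"
      "f = h False False + h False True + h True False + h True True"
    and k: "\<forall>b c. k b c \<in> parity_part b c"
      "g = k False False + k False True + k True False + k True True"
    using assms unfolding even_parts_def by blast
  have "h b c * k b' c' \<in> even_parts" for b c b' c'
    using parity_part_mult h(1) k(1) parity_part_subset_even_parts by blast
  then show ?thesis unfolding h(2) k(2) distrib_left distrib_right
    by (intro even_parts_add)
qed

lemma const_in_even_parts: "const_fun c \<in> even_parts"
proof (rule parity_part_subset_even_parts)
  show "const_fun c \<in> parity_part False False"
    using const_in_R[of c] by (simp add: parity_part_def const_laurent_def)
qed

lemma scaled_in_even_parts: "f \<in> even_parts \<Longrightarrow> const_fun c * f \<in> even_parts"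
  by (rule even_parts_mult[OF const_in_even_parts])

lemma phi_in_even_parts:
  "phi02 \<in> even_parts" "phi01 \<in> even_parts" "phi03 \<in> even_parts" "phi04 \<in> even_parts"
  "phi12 \<in> even_parts" "phi23 \<in> even_parts" "phi24 \<in> even_parts"
  "phi13 \<in> even_parts" "phi14 \<in> even_parts" "phi34 \<in> even_parts"
proof -
  note parity_part_def [simp]
  show "phi02 \<in> even_parts"
    by (rule parity_part_subset_even_parts[of _ True True]) (simp add: R_generators)
  show "phi01 \<in> even_parts" "phi03 \<in> even_parts" "phi04 \<in> even_parts"
    by (rule parity_part_subset_even_parts[of _ True False], simp add: R_generators)+
  show "phi12 \<in> even_parts" "phi23 \<in> even_parts" "phi24 \<in> even_parts"
    by (rule parity_part_subset_even_parts[of _ False True], simp add: R_generators)+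
  show "phi13 \<in> even_parts" "phi14 \<in> even_parts" "phi34 \<in> even_parts"
    by (rule parity_part_subset_even_parts[of _ False False], simp add: R_generators)+
qed

section \<open>Splitting polynomials by parity\<close>

abbreviation coord :: "4 \<Rightarrow> complex ^ 4 \<Rightarrow> complex" where
  "coord k \<equiv> (\<lambda>v. v $ k)"

text \<open>The ten forms are a basis of the quadratic forms in four variables; the identities in
  the proof invert their definitions.\<close>

lemma quadratic_monomial_in_even_parts: "coord k * coord l \<in> even_parts"
proof -
  let ?c = "\<lambda>c f. const_fun c * f"
  note defs = fun_eq_iff const_fun_def phi_defs power2_eq_square algebra_simps
  have "coord 1 * coord 1 =
      ?c (-1/4) phi13 + ?c (-\<i>/4) phi14 + ?c (\<i>/4) phi23 + ?c (1/4) phi24"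
    "coord 2 * coord 2 =
      ?c (-1/4) phi13 + ?c (-\<i>/4) phi14 + ?c (-\<i>/4) phi23 + ?c (-1/4) phi24"
    "coord 3 * coord 3 =
      ?c (1/4) phi13 + ?c (-\<i>/4) phi14 + ?c (\<i>/4) phi23 + ?c (-1/4) phi24"
    "coord 4 * coord 4 =
      ?c (1/4) phi13 + ?c (-\<i>/4) phi14 + ?c (-\<i>/4) phi23 + ?c (1/4) phi24"
    by (simp_all add: defs)
  then have sq: "coord 1 * coord 1 \<in> even_parts" "coord 2 * coord 2 \<in> even_parts"
    "coord 3 * coord 3 \<in> even_parts" "coord 4 * coord 4 \<in> even_parts"
    by (simp_all only: even_parts_add scaled_in_even_parts phi_in_even_parts)
  have "coord 1 * coord 3 = ?c (1/4) phi34 + ?c (1/4) phi12"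
    "coord 2 * coord 4 = ?c (1/4) phi34 + ?c (-1/4) phi12"
    "coord 1 * coord 4 = ?c (-1/4) phi01 + ?c (-\<i>/4) phi02"
    "coord 2 * coord 3 = ?c (-1/4) phi01 + ?c (\<i>/4) phi02"
    "coord 1 * coord 2 = ?c (-\<i>/4) phi03 + ?c (-1/4) phi04"
    "coord 3 * coord 4 = ?c (-\<i>/4) phi03 + ?c (1/4) phi04"
    by (simp_all add: defs)
  then have mixed: "coord 1 * coord 3 \<in> even_parts" "coord 2 * coord 4 \<in> even_parts"
    "coord 1 * coord 4 \<in> even_parts" "coord 2 * coord 3 \<in> even_parts"
    "coord 1 * coord 2 \<in> even_parts" "coord 3 * coord 4 \<in> even_parts"
    by (simp_all only: even_parts_add scaled_in_even_parts phi_in_even_parts)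
  have "\<forall>k l. coord k * coord l \<in> even_parts"
    unfolding forall_4 using sq mixed by (simp add: mult.commute)
  then show ?thesis by blast
qed

lemma even_parts_sum: "(\<And>k. k \<in> K \<Longrightarrow> f k \<in> even_parts) \<Longrightarrow> (\<Sum>k\<in>K. f k) \<in> even_parts"
proof (induction K rule: infinite_finite_induct)
  case (infinite A)
  show ?case unfolding sum.infinite[OF infinite(1)] by (rule zero_in_even_parts)
next
  case empty
  show ?case unfolding sum.empty by (rule zero_in_even_parts)
next
  case (insert x F)
  then show ?case unfolding sum.insert[OF insert(1,2)] by (intro even_parts_add) blast+
qed

text \<open>Odd polynomials as a module over the even ones, generated by the coordinates. The
  coefficients are not unique; only their existence matters.\<close>

definition odd_parts :: "(complex ^ 4 \<Rightarrow> complex) set" where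
  "odd_parts = {f. \<exists>e. (\<forall>k. e k \<in> even_parts) \<and> f = (\<Sum>k\<in>UNIV. coord k * e k)}"

lemma odd_parts_add:
  assumes "f \<in> odd_parts" "g \<in> odd_parts"
  shows "f + g \<in> odd_parts"
proof -
  obtain e d where e: "\<forall>k. e k \<in> even_parts" "f = (\<Sum>k\<in>UNIV. coord k * e k)"
    and d: "\<forall>k. d k \<in> even_parts" "g = (\<Sum>k\<in>UNIV. coord k * d k)"
    using assms unfolding odd_parts_def by blast
  have "f + g = (\<Sum>k\<in>UNIV. coord k * (e k + d k))"
    by (simp add: e d distrib_left sum.distrib)
  then show ?thesis unfolding odd_parts_def using e(1) d(1) even_parts_add
    by (intro CollectI exI[of _ "\<lambda>k. e k + d k"]) auto
qed

lemma odd_parts_even_mult: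
  assumes "f \<in> even_parts" "g \<in> odd_parts"
  shows "f * g \<in> odd_parts"
proof -
  obtain d where d: "\<forall>k. d k \<in> even_parts" "g = (\<Sum>k\<in>UNIV. coord k * d k)"
    using assms unfolding odd_parts_def by blast
  have "f * g = (\<Sum>k\<in>UNIV. coord k * (f * d k))"
    by (simp add: d sum_distrib_left mult.left_commute)
  then show ?thesis unfolding odd_parts_def using d(1) even_parts_mult[OF assms(1)]
    by (intro CollectI exI[of _ "\<lambda>k. f * d k"]) auto
qed

lemma odd_parts_mult:
  assumes "f \<in> odd_parts" "g \<in> odd_parts"
  shows "f * g \<in> even_parts"
proof -
  obtain e d where e: "\<forall>k. e k \<in> even_parts" "f = (\<Sum>k\<in>UNIV. coord k * e k)"
    and d: "\<forall>k. d k \<in> even_parts" "g = (\<Sum>k\<in>UNIV. coord k * d k)"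
    using assms unfolding odd_parts_def by blast
  have "f * g = (\<Sum>k\<in>UNIV. \<Sum>l\<in>UNIV. (coord k * coord l) * (e k * d l))"
    unfolding e(2) d(2) sum_product by (intro sum.cong refl) (simp only: mult_ac)
  also have "\<dots> \<in> even_parts"
    by (intro even_parts_sum even_parts_mult[of "coord _ * coord _"] even_parts_mult
        quadratic_monomial_in_even_parts e(1)[rule_format] d(1)[rule_format])
  finally show ?thesis .
qed

text \<open>Polynomial functions are given as an inductive closure, not by monomials, so the
  splitting is carried through sums and products. Odd times odd is even because quadratic monomials
  lie in \<open>even_parts\<close>.\<close>

lemma poly_functions_parts:
  assumes "f \<in> poly_functions"
  shows "\<exists>e\<in>even_parts. \<exists>d\<in>odd_parts. f = e + d"
  using assms[unfolded poly_functions_def]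
proof induction
  case (scalar c)
  have "0 \<in> odd_parts" unfolding odd_parts_def using zero_in_even_parts
    by (intro CollectI exI[of _ "\<lambda>_. 0"]) simp
  then show ?case using const_in_even_parts by (metis add_0_right)
next
  case (gen b)
  then obtain l where b: "b = coord l" by blast
  note e0 = zero_in_even_parts
  have e1: "1 \<in> even_parts" using const_in_even_parts[of 1] by (simp add: const_fun_def one_fun_def)
  have "b = (\<Sum>k\<in>UNIV. coord k * (if k = l then 1 else 0))"
    by (simp add: b if_distrib cong: if_cong)
  then have "b \<in> odd_parts" unfolding odd_parts_def using e0 e1
    by (intro CollectI exI[of _ "\<lambda>k. if k = l then 1 else 0"]) simp
  then show ?case using e0 by (metis add_0_left)
next
  case (add x y)
  then obtain e d e' d' where "e \<in> even_parts" "d \<in> odd_parts" "x = e + d"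
    "e' \<in> even_parts" "d' \<in> odd_parts" "y = e' + d'" by blast
  then show ?case using even_parts_add[of e e'] odd_parts_add[of d d']
    by (intro bexI[of _ "e + e'"] bexI[of _ "d + d'"]) (simp_all add: algebra_simps)
next
  case (mult x y)
  then obtain e d e' d' where x: "e \<in> even_parts" "d \<in> odd_parts" "x = e + d"
    and y: "e' \<in> even_parts" "d' \<in> odd_parts" "y = e' + d'" by blast
  have "e * e' + d * d' \<in> even_parts" 
    by (intro even_parts_add even_parts_mult[OF x(1) y(1)] odd_parts_mult[OF x(2) y(2)])
  moreover have "e * d' + e' * d \<in> odd_parts" 
    by (intro odd_parts_add odd_parts_even_mult[OF x(1) y(2)] odd_parts_even_mult[OF y(1) x(2)])
  moreover have "x * y = (e * e' + d * d') + (e * d' + e' * d)"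
    unfolding x(3) y(3) by (simp add: algebra_simps)
  ultimately show ?case by blast
qed

lemma even_parts_uminus: "f \<in> even_parts \<Longrightarrow> f (- x) = f x"
proof -
  assume "f \<in> even_parts"
  then obtain h where h: "\<forall>b c. h b c \<in> parity_part b c"
      "f = h False False + h False True + h True False + h True True"
    unfolding even_parts_def by blast
  have m: "ev (- x) (1, 1) F = ev x (1, 1) F" if "F \<in> R" for F
    by (rule ev_eq_on_R[OF _ _ that])
      (auto simp: torus_def ev_lterm chi_def phi_defs)
  have "h b c (- x) = h b c x" for b c
    using m[of "lterm (of_bool b) (of_bool c) (h b c)"] h(1)
    by (simp add: parity_part_def ev_lterm chi_def)
  then show ?thesis by (simp add: h(2))
qed

lemma odd_parts_uminus: "f \<in> odd_parts \<Longrightarrow> f (- x) = - f x"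
proof -
  assume "f \<in> odd_parts"
  then obtain e where e: "\<forall>k. e k \<in> even_parts" "f = (\<Sum>k\<in>UNIV. coord k * e k)"
    unfolding odd_parts_def by blast
  then have "e k (- x) = e k x" for k using even_parts_uminus by blast
  then show ?thesis by (simp add: e(2) sum_4)
qed

text \<open>Invariance under -id removes the odd part, and invariance under \<open>T0\<close> and
  \<open>T2\<close> removes the three parity parts with a nontrivial sign. What remains is the
  coefficient of a degree zero element of \<open>R\<close>.\<close>

lemma invariants_in_R:
  assumes "f \<in> invariants"
  shows "lterm 0 0 f \<in> R"
proof -
  have inv: "f (g *v v) = f v" if "g \<in> G" for g v
    using assms that unfolding invariants_def by blast
  obtain e d where e: "e \<in> even_parts" and d: "d \<in> odd_parts" and f: "f = e + d"
    using assms poly_functions_parts unfolding invariants_def by blast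
  have G: "T0 \<in> G" "T2 \<in> G" "T0 ** T2 \<in> G" "(T0 ** T2) ** (T0 ** T2) \<in> G"
    using G.intros by blast+
  \<comment> \<open>As \<open>T0\<close> and \<open>T2\<close> are involutions, this product is
    their commutator.\<close>
  have "((T0 ** T2) ** (T0 ** T2)) *v x = - x" for x
    by (simp add: T0_vector_mult T2_vector_mult vector_4 vec_eq_iff forall_4
        flip: matrix_vector_mul_assoc)
  then have neg: "f (- x) = f x" for x using inv[OF G(4)] by metis
  have "d x = 0" for x
    using neg[of x] even_parts_uminus[OF e, of x] odd_parts_uminus[OF d, of x] by (simp add: f)
  then have fe: "f = e" by (simp add: f fun_eq_iff)
  obtain h where h: "\<forall>b c. h b c \<in> parity_part b c"
      "f = h False False + h False True + h True False + h True True"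
    using e unfolding fe even_parts_def by blast
  have hR: "lterm (of_bool b) (of_bool c) (h b c) \<in> R" for b c
    using h(1) unfolding parity_part_def by blast
  have h0: "h b c (T0 *v x) = (if b then - h b c x else h b c x)" for b c x
    using coefficient_T0[OF hR, of b c x] by simp
  have h2: "h b c (T2 *v x) = (if c then - h b c x else h b c x)" for b c x
    using coefficient_T2[OF hR, of b c x] by simp
  have "f x = h False False x" for x
  proof -
    \<comment> \<open>The three equations say that the nontrivial parts at \<open>x\<close> have
      pairwise sums zero, hence all vanish.\<close>
    have "f (T0 *v x) = f x" "f (T2 *v x) = f x" "f (T0 *v (T2 *v x)) = f x"
      using inv[OF G(1)] inv[OF G(2)] by metis+
    then show ?thesis by (simp add: h(2) h0 h2) algebra
  qed
  then have "f = h False False" by blast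
  then show ?thesis using h(1)[rule_format, of False False] by (simp add: parity_part_def)
qed

section \<open>Polynomial functions and the converse inclusion of degree zero coefficients\<close>

lemma poly_functions_intros:
  fixes f g :: "complex ^ 'n \<Rightarrow> complex"
  shows "(\<lambda>_. c) \<in> (poly_functions :: (complex ^ 'n \<Rightarrow> complex) set)"
    and "(\<lambda>v. v $ k) \<in> (poly_functions :: (complex ^ 'n \<Rightarrow> complex) set)"
    and "f \<in> poly_functions \<Longrightarrow> g \<in> poly_functions \<Longrightarrow> (\<lambda>v. f v + g v) \<in> poly_functions"
    and "f \<in> poly_functions \<Longrightarrow> g \<in> poly_functions \<Longrightarrow> (\<lambda>v. f v * g v) \<in> poly_functions"
    and "f \<in> poly_functions \<Longrightarrow> (\<lambda>v. - f v) \<in> poly_functions"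
    and "f \<in> poly_functions \<Longrightarrow> g \<in> poly_functions \<Longrightarrow> (\<lambda>v. f v - g v) \<in> poly_functions"
    and "f \<in> poly_functions \<Longrightarrow> (\<lambda>v. f v ^ j) \<in> poly_functions"
proof -
  show c: "(\<lambda>_. c) \<in> (poly_functions :: (complex ^ 'n \<Rightarrow> complex) set)" for c
    unfolding poly_functions_def using subalg_gen.scalar[of const_fun] by (simp add: const_fun_def)
  show "(\<lambda>v. v $ k) \<in> (poly_functions :: (complex ^ 'n \<Rightarrow> complex) set)"
    unfolding poly_functions_def by (auto intro: subalg_gen.gen)
  show a: "f \<in> poly_functions \<Longrightarrow> g \<in> poly_functions \<Longrightarrow> (\<lambda>v. f v + g v) \<in> poly_functions"
    for f g :: "complex ^ 'n \<Rightarrow> complex"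
    unfolding poly_functions_def using subalg_gen.add[of f _ _ g] by (simp add: plus_fun_def)
  show m: "f \<in> poly_functions \<Longrightarrow> g \<in> poly_functions \<Longrightarrow> (\<lambda>v. f v * g v) \<in> poly_functions"
    for f g :: "complex ^ 'n \<Rightarrow> complex"
    unfolding poly_functions_def using subalg_gen.mult[of f _ _ g] by (simp add: times_fun_def)
  show u: "f \<in> poly_functions \<Longrightarrow> (\<lambda>v. - f v) \<in> poly_functions" for f :: "complex ^ 'n \<Rightarrow> complex"
    using m[OF c[of "-1"], of f] by simp
  show "f \<in> poly_functions \<Longrightarrow> g \<in> poly_functions \<Longrightarrow> (\<lambda>v. f v - g v) \<in> poly_functions"
    using a[of f "\<lambda>v. - g v"] u[of g] by simp
  show "f \<in> poly_functions \<Longrightarrow> (\<lambda>v. f v ^ j) \<in> poly_functions"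
    by (induction j) (simp_all add: c m)
qed

lemma phi_in_poly_functions:
  "phi02 \<in> poly_functions" "phi01 \<in> poly_functions" "phi03 \<in> poly_functions"
  "phi04 \<in> poly_functions" "phi12 \<in> poly_functions" "phi23 \<in> poly_functions"
  "phi24 \<in> poly_functions" "phi13 \<in> poly_functions" "phi14 \<in> poly_functions"
  "phi34 \<in> poly_functions"
  unfolding phi_defs[abs_def] by (intro poly_functions_intros)+

lemma continuous_on_poly_functions: "f \<in> poly_functions \<Longrightarrow> continuous_on UNIV f"
  unfolding poly_functions_def
proof (induction rule: subalg_gen.induct)
  case (gen b)
  then show ?case by (auto intro: continuous_intros)
qed (simp_all add: const_fun_def plus_fun_def times_fun_def continuous_on_add continuous_on_mult)

lemma invariantsI:
  assumes "f \<in> poly_functions" "lterm 0 0 f \<in> R"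
  shows "f \<in> invariants"
proof -
  have "f (g *v v) = f v" if "g \<in> G" for g v
    using that
  proof (induction arbitrary: v)
    case T0
    then show ?case using coefficient_T0[OF assms(2)] by simp
  next
    case T2
    then show ?case using coefficient_T2[OF assms(2)] by simp
  next
    case (mult g h)
    then show ?case by (metis matrix_vector_mul_assoc)
  qed simp
  then show ?thesis using assms(1) unfolding invariants_def by blast
qed

section \<open>Points over the origin as limits\<close>

text \<open>Positions 1, 2, 3 stand for the indices 1, 3, 4, so that \<open>phi0 i\<close> and
  \<open>phi2 i\<close> join the same index with 0 and with 2.\<close>

definition phi0 :: "3 \<Rightarrow> complex ^ 4 \<Rightarrow> complex" where
  "phi0 i = (vector [phi01, phi03, phi04] :: (complex ^ 4 \<Rightarrow> complex) ^ 3) $ i"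

definition phi2 :: "3 \<Rightarrow> complex ^ 4 \<Rightarrow> complex" where
  "phi2 i = (vector [phi12, phi23, phi24] :: (complex ^ 4 \<Rightarrow> complex) ^ 3) $ i"

definition phi_rest :: "3 \<Rightarrow> complex ^ 4 \<Rightarrow> complex" where
  "phi_rest i = (vector [phi13, phi14, phi34] :: (complex ^ 4 \<Rightarrow> complex) ^ 3) $ i"

lemma phi_vector_simps:
  "phi0 1 = phi01" "phi0 2 = phi03" "phi0 3 = phi04"
  "phi2 1 = phi12" "phi2 2 = phi23" "phi2 3 = phi24"
  "phi_rest 1 = phi13" "phi_rest 2 = phi14" "phi_rest 3 = phi34"
  by (simp_all add: phi0_def phi2_def phi_rest_def)

definition standard_gens :: "laurent set" where
  "standard_gens = range (\<lambda>i. lterm 1 0 (phi0 i)) \<union> range (\<lambda>i. lterm 0 1 (phi2 i)) \<union>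
     range (\<lambda>i. lterm 0 0 (phi_rest i)) \<union>
     {lterm 1 1 phi02, lterm (-2) 0 1, lterm 0 (-2) 1}"

lemma R_eq_standard: "R = subalg_gen const_laurent standard_gens"
proof -
  have "range f = {f 1, f 2, f 3}" for f :: "3 \<Rightarrow> laurent"
    by (auto simp: UNIV_3)
  then show ?thesis
    unfolding R_def standard_gens_def
    by (intro arg_cong[where f = "subalg_gen const_laurent"]) (auto simp: phi_vector_simps)
qed

lemma standard_gens_in_R: "g \<in> standard_gens \<Longrightarrow> g \<in> R"
  unfolding R_eq_standard by (rule subalg_gen.gen)

lemma standard_in_R:
  "lterm 1 0 (phi0 i) \<in> R" "lterm 0 1 (phi2 i) \<in> R" "lterm 0 0 (phi_rest i) \<in> R"
  by (auto intro!: standard_gens_in_R simp: standard_gens_def)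

lemma to_VG_eq_origin_iff:
  "to_VG p = VG_origin \<longleftrightarrow> (\<forall>h\<in>invariants. p (lterm 0 0 h) = h 0)"
  unfolding to_VG_def VG_origin_def by (metis (mono_tags, lifting) restrict_apply' restrict_ext)

text \<open>A point of \<open>Spec \<R>\<close> over the origin is described by the limits of the generators along
  a family \<open>(x, t\<^sub>0, t\<^sub>2)\<close> of points of \<open>V \<times> \<T>\<close> with \<open>x \<rightarrow> 0\<close>.\<close>

definition central_limit ::
  "complex ^ 3 \<Rightarrow> complex ^ 3 \<Rightarrow> complex \<Rightarrow> complex \<Rightarrow> complex \<Rightarrow> bool" where
  "central_limit z y w s u \<longleftrightarrow> (\<exists>x t0 t2. (\<forall>k::nat. t0 k \<noteq> 0 \<and> t2 k \<noteq> 0) \<and> x \<longlonglongrightarrow> 0 \<and>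
     (\<forall>i. (\<lambda>k. t0 k * phi0 i (x k)) \<longlonglongrightarrow> z $ i) \<and>
     (\<forall>i. (\<lambda>k. t2 k * phi2 i (x k)) \<longlonglongrightarrow> y $ i) \<and>
     (\<forall>i. (\<lambda>k. phi_rest i (x k)) \<longlonglongrightarrow> 0) \<and>
     (\<lambda>k. t0 k * t2 k * phi02 (x k)) \<longlonglongrightarrow> w \<and>
     (\<lambda>k. inverse (t0 k ^ 2)) \<longlonglongrightarrow> s \<and> (\<lambda>k. inverse (t2 k ^ 2)) \<longlonglongrightarrow> u)"

definition has_values :: "(laurent \<Rightarrow> complex) \<Rightarrow>
    complex ^ 3 \<Rightarrow> complex ^ 3 \<Rightarrow> complex \<Rightarrow> complex \<Rightarrow> complex \<Rightarrow> bool" where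
  "has_values p z y w s u \<longleftrightarrow> (\<forall>i. p (lterm 1 0 (phi0 i)) = z $ i) \<and>
     (\<forall>i. p (lterm 0 1 (phi2 i)) = y $ i) \<and> (\<forall>i. p (lterm 0 0 (phi_rest i)) = 0) \<and>
     p (lterm 1 1 phi02) = w \<and> p (lterm (-2) 0 1) = s \<and> p (lterm 0 (-2) 1) = u"

text \<open>Evaluations at (x k, t0 k, t2 k) converge on the generators, hence on \<open>R\<close>.
  The limit lies over the origin since an invariant \<open>h\<close> occurs in degree zero of
  \<open>R\<close>, where evaluation gives \<open>h (x k)\<close>, and \<open>h\<close> is
  continuous.\<close>

lemma central_point_of_limit:
  assumes t: "\<And>k. t0 k \<noteq> 0 \<and> t2 k \<noteq> 0" and x: "x \<longlonglongrightarrow> 0"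
    and lim: "\<And>i. (\<lambda>k. t0 k * phi0 i (x k)) \<longlonglongrightarrow> z $ i"
      "\<And>i. (\<lambda>k. t2 k * phi2 i (x k)) \<longlonglongrightarrow> y $ i"
      "\<And>i. (\<lambda>k. phi_rest i (x k)) \<longlonglongrightarrow> 0"
      "(\<lambda>k. t0 k * t2 k * phi02 (x k)) \<longlonglongrightarrow> w"
      "(\<lambda>k. inverse (t0 k ^ 2)) \<longlonglongrightarrow> s" "(\<lambda>k. inverse (t2 k ^ 2)) \<longlonglongrightarrow> u"
  shows "\<exists>p\<in>SpecR. to_VG p = VG_origin \<and> has_values p z y w s u"
proof -
  define P where "P k = restrict (ev (x k) (t0 k, t2 k)) R" for k :: nat
  have P: "P k \<in> SpecR" for k
    unfolding P_def by (rule evaluation_in_SpecR) (use t in \<open>auto simp: torus_def\<close>)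
  have PR: "P k f = ev (x k) (t0 k, t2 k) f" if "f \<in> R" for k f
    using that by (simp add: P_def)
  have Pl: "P k (lterm a b h) = t0 k powi a * t2 k powi b * h (x k)" if "lterm a b h \<in> R" for k a b h
    using that by (simp add: PR ev_lterm chi_def)
  note in_R = standard_in_R
  have lims: "(\<lambda>k. P k (lterm 1 0 (phi0 i))) \<longlonglongrightarrow> z $ i"
    "(\<lambda>k. P k (lterm 0 1 (phi2 i))) \<longlonglongrightarrow> y $ i" "(\<lambda>k. P k (lterm 0 0 (phi_rest i))) \<longlonglongrightarrow> 0"
    "(\<lambda>k. P k (lterm 1 1 phi02)) \<longlonglongrightarrow> w"
    "(\<lambda>k. P k (lterm (-2) 0 1)) \<longlonglongrightarrow> s" "(\<lambda>k. P k (lterm 0 (-2) 1)) \<longlonglongrightarrow> u" for i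
    using lim by (simp_all add: Pl in_R R_generators power_int_minus)
  \<comment> \<open>Using \<open>lim\<close> gives one function on the set of generators without
    showing that differently named generators are distinct.\<close>
  define v where "v g = lim (\<lambda>k. P k g)" for g
  have V: "(\<lambda>k. P k g) \<longlonglongrightarrow> v g" if "g \<in> standard_gens" for g
  proof -
    have "\<exists>l. (\<lambda>k. P k g) \<longlonglongrightarrow> l" using that lims unfolding standard_gens_def by blast
    then show ?thesis unfolding v_def by (metis limI)
  qed
  obtain p where p: "p \<in> SpecR" "\<And>f. f \<in> R \<Longrightarrow> (\<lambda>k. P k f) \<longlonglongrightarrow> p f"
    using limit_point_of_SpecR[OF R_eq_standard P sequentially_bot V] by metis
  have "p (lterm 0 0 h) = h 0" if h: "h \<in> invariants" for h
  proof -
    have hR: "lterm 0 0 h \<in> R" by (rule invariants_in_R[OF h])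
    have "isCont h 0"
      using continuous_on_poly_functions[of h] h
      by (simp add: invariants_def continuous_on_eq_continuous_at)
    then have "(\<lambda>k. h (x k)) \<longlonglongrightarrow> h 0" using x by (rule isCont_tendsto_compose)
    then have "(\<lambda>k. P k (lterm 0 0 h)) \<longlonglongrightarrow> h 0" by (simp add: Pl[OF hR])
    then show ?thesis using p(2)[OF hR] LIMSEQ_unique by blast
  qed
  moreover have "has_values p z y w s u"
    unfolding has_values_def using lims p(2) in_R R_generators LIMSEQ_unique by meson
  ultimately show ?thesis using p(1) by (auto simp: to_VG_eq_origin_iff)
qed

lemma central_limit_point:
  "central_limit z y w s u \<Longrightarrow> \<exists>p\<in>SpecR. to_VG p = VG_origin \<and> has_values p z y w s u"
  unfolding central_limit_def using central_point_of_limit by (elim exE conjE) blast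

text \<open>A symplectic involution mixing the vectors \<open>(x\<^sub>1, x\<^sub>3)\<close> and \<open>(x\<^sub>2, x\<^sub>4)\<close>.
  It exchanges the indices \<open>0\<close> and \<open>2\<close> of the \<open>\<phi>\<^sub>i\<^sub>j\<close> up to sign.\<close>

definition index_swap :: "complex ^ 4 \<Rightarrow> complex ^ 4" where
  "index_swap x = (let c = complex_of_real (1 / sqrt 2) in
     vector [c * (x $ 1 + x $ 2), c * (x $ 1 - x $ 2), c * (x $ 3 + x $ 4), c * (x $ 3 - x $ 4)])"

lemma phi_index_swap:
  "phi0 i (index_swap x) = - phi2 i x" "phi2 i (index_swap x) = - phi0 i x"
  "phi_rest i (index_swap x) = phi_rest i x" "phi02 (index_swap x) = - phi02 x"
proof -
  have c: "complex_of_real (1 / sqrt 2) * complex_of_real (1 / sqrt 2) = 1/2"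
    by (simp flip: of_real_mult)
  define c where "c = complex_of_real (1 / sqrt 2)"
  have c2: "c * c = 1 / 2" using c by (simp add: c_def)
  have c3: "c * (c * a) = a / 2" for a using c2 by (metis mult.assoc mult_1 times_divide_eq_left)
  have "\<forall>i. phi0 i (index_swap x) = - phi2 i x" "\<forall>i. phi2 i (index_swap x) = - phi0 i x"
    "\<forall>i. phi_rest i (index_swap x) = phi_rest i x"
    unfolding forall_3 phi_vector_simps index_swap_def Let_def c_def[symmetric] phi_defs vector_4
    by (simp_all add: power2_eq_square algebra_simps c3)
  then show "phi0 i (index_swap x) = - phi2 i x" "phi2 i (index_swap x) = - phi0 i x"
    "phi_rest i (index_swap x) = phi_rest i x" by blast+
  show "phi02 (index_swap x) = - phi02 x"
    unfolding index_swap_def Let_def c_def[symmetric] phi_defs vector_4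
    by (simp add: power2_eq_square algebra_simps c3)
qed

lemma tendsto_index_swap: "x \<longlonglongrightarrow> 0 \<Longrightarrow> (\<lambda>k. index_swap (x k)) \<longlonglongrightarrow> 0"
proof (rule vec_tendstoI)
  fix i :: 4 assume "x \<longlonglongrightarrow> 0"
  then have x: "(\<lambda>k. x k $ j) \<longlonglongrightarrow> 0" for j using tendsto_vec_nth[of x 0 sequentially j] by simp
  have "\<forall>i. (\<lambda>k. index_swap (x k) $ i) \<longlonglongrightarrow> 0"
    unfolding forall_4 index_swap_def Let_def vector_4
    by (intro conjI tendsto_mult_right_zero tendsto_add_zero x)
      (use tendsto_diff[OF x x] in simp_all)
  then show "(\<lambda>k. index_swap (x k) $ i) \<longlonglongrightarrow> 0 $ i" by simp
qed

text \<open>Applying \<open>index_swap\<close> along the family and exchanging t0 with t2 again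
  gives a convergent family; the signs are those of \<open>phi_index_swap\<close>.\<close>

lemma central_limit_point_swapped:
  assumes "central_limit z y w s u"
  shows "\<exists>p\<in>SpecR. to_VG p = VG_origin \<and> has_values p (- y) (- z) (- w) u s"
proof -
  obtain x t0 t2 where t: "\<And>k::nat. t0 k \<noteq> 0 \<and> t2 k \<noteq> 0" and x: "x \<longlonglongrightarrow> 0"
    and lim: "\<And>i. (\<lambda>k. t0 k * phi0 i (x k)) \<longlonglongrightarrow> z $ i"
      "\<And>i. (\<lambda>k. t2 k * phi2 i (x k)) \<longlonglongrightarrow> y $ i"
      "\<And>i. (\<lambda>k. phi_rest i (x k)) \<longlonglongrightarrow> 0"
      "(\<lambda>k. t0 k * t2 k * phi02 (x k)) \<longlonglongrightarrow> w"
      "(\<lambda>k. inverse (t0 k ^ 2)) \<longlonglongrightarrow> s" "(\<lambda>k. inverse (t2 k ^ 2)) \<longlonglongrightarrow> u"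
    using assms unfolding central_limit_def by blast
  show ?thesis
    by (rule central_point_of_limit[of t2 t0 "\<lambda>k. index_swap (x k)"])
      (use t tendsto_index_swap[OF x] lim(3,5,6) lim(1,2,4)[THEN tendsto_minus]
        in \<open>simp_all add: phi_index_swap mult.commute[of "t2 _" "t0 _"]\<close>)
qed

section \<open>Curves degenerating to points over the origin\<close>

definition conic_point :: "complex \<Rightarrow> complex \<Rightarrow> complex ^ 3" where
  "conic_point m n = vector [2 * m * n, - \<i> * (m^2 + n^2), m^2 - n^2]"

lemma conic_point_isotropic: "(\<Sum>i\<in>UNIV. conic_point m n $ i ^ 2) = 0"
  by (simp add: conic_point_def sum_3 power_mult_distrib) algebra

text \<open>The squares of \<open>m\<close> and \<open>n\<close> are linear in the last two
  coordinates. The equation then fixes the first coordinate up to sign, which is absorbed by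
  replacing \<open>n\<close> with \<open>- n\<close>.\<close>

lemma isotropic_eq_conic_point:
  assumes "(\<Sum>i\<in>UNIV. z $ i ^ 2) = 0"
  obtains m n where "z = conic_point m n"
proof -
  define m where "m = csqrt ((\<i> * z $ 2 + z $ 3) / 2)"
  define n where "n = csqrt ((\<i> * z $ 2 - z $ 3) / 2)"
  have m2: "m^2 = (\<i> * z $ 2 + z $ 3) / 2" and n2: "n^2 = (\<i> * z $ 2 - z $ 3) / 2"
    by (simp_all add: m_def n_def)
  have "(2 * m * n)^2 = 4 * (m^2 * n^2)" by (simp add: power_mult_distrib)
  also have "\<dots> = - ((z $ 2)^2) - (z $ 3)^2"
    unfolding m2 n2 by (simp add: power2_eq_square field_simps)
  also have "\<dots> = (z $ 1)^2" using assms by (simp add: sum_3) algebra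
  finally have "z $ 1 = 2 * m * n \<or> z $ 1 = - (2 * m * n)" by (metis power2_eq_iff)
  moreover have "z $ 2 = - \<i> * (m^2 + n^2)" "z $ 3 = m^2 - n^2"
    unfolding m2 n2 by (simp_all add: field_simps)
  ultimately have "z = conic_point m n \<or> z = conic_point m (- n)"
    by (auto simp: conic_point_def vec_eq_iff forall_3)
  then show thesis using that by blast
qed

lemma conic_point_eq_0_iff: "conic_point m n = 0 \<longleftrightarrow> m = 0 \<and> n = 0"
proof
  assume "conic_point m n = 0"
  then have "conic_point m n $ 2 = 0" "conic_point m n $ 3 = 0" by simp_all
  then have "m^2 + n^2 = 0" "m^2 - n^2 = 0" by (simp_all add: conic_point_def)
  then have "m^2 = 0" "n^2 = 0" by algebra+
  then show "m = 0 \<and> n = 0" by simp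
qed (simp add: conic_point_def vec_eq_iff forall_3)

text \<open>The vectors (x1,x3) and (x2,x4) are taken nearly parallel to (m,n), of sizes e and e^3.
  The bilinear \<open>phi0\<close> then has order e^4 and the difference \<open>phi2\<close> order
  e^2, which dictates t0 = e^-4 and t2 = e^-2. A deviation of relative order e^2 from being parallel
  makes the determinant \<open>phi02\<close> of order e^6, matching t0 t2.\<close>

lemma central_limit_conic:
  assumes z: "(\<Sum>i\<in>UNIV. z $ i ^ 2) = 0" "z \<noteq> 0" and \<beta>: "\<beta> \<noteq> 0"
  shows "central_limit z (\<beta> *s z) w 0 0"
proof -
  \<comment> \<open>At y = z = (m,n) the bilinear forms \<open>phi0\<close> give -2 times
    \<open>conic_point m n\<close>; dividing the parameters by a root of -2 absorbs this
    factor.\<close>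
  define q where "q = csqrt (- 2)"
  have q2: "q^2 = -2" unfolding q_def by (rule power2_csqrt)
  then have q0: "q \<noteq> 0" by auto
  obtain m' n' where z': "z = conic_point m' n'" using isotropic_eq_conic_point[OF z(1)] by metis
  define m where "m = m' / q"
  define n where "n = n' / q"
  have zc: "z = vector [-4 * m * n, 2 * \<i> * (m^2 + n^2), 2 * (n^2 - m^2)]"
    unfolding z' conic_point_def m_def n_def using q2 q0
    by (simp add: vec_eq_iff forall_3 power_divide field_simps power2_eq_square)
  have mn: "m \<noteq> 0 \<or> n \<noteq> 0"
    using z(2) q0 unfolding z' conic_point_eq_0_iff by (auto simp: m_def n_def)
  \<comment> \<open>The direction (d1,d2) of the deviation is chosen so that its determinant with
    the nonzero vector (m,n) produces \<open>w\<close>.\<close>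
  obtain d1 d2 where d: "2 * \<i> * (m * d2 - n * d1) = w"
  proof (cases "m = 0")
    case True
    then show ?thesis using mn by (intro that[of 0 "- w / (2 * \<i> * n)"]) simp
  next
    case False
    then show ?thesis by (intro that[of "w / (2 * \<i> * m)" 0]) simp
  qed
  \<comment> \<open>Multiplying (x1,x3) and dividing (x2,x4) by \<open>\<rho>\<close> leaves
    bilinear expressions unchanged but scales the leading term of \<open>phi2\<close> by its square.
    The factor -2 is again that between \<open>phi0\<close> and \<open>conic_point\<close>.\<close>
  define \<rho> where "\<rho> = csqrt (- 2 * \<beta>)"
  have \<rho>2: "\<rho>^2 = - 2 * \<beta>" unfolding \<rho>_def by (rule power2_csqrt)
  then have \<rho>0: "\<rho> \<noteq> 0" using \<beta> by auto
  define e :: "nat \<Rightarrow> complex" where "e k = of_real (inverse (real (Suc k)))" for k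
  have e0: "e k \<noteq> 0" for k unfolding e_def by (simp del: of_nat_Suc)
  have e: "e \<longlonglongrightarrow> 0"
    unfolding e_def using LIMSEQ_inverse_real_of_nat tendsto_of_real by (metis of_real_0)
  define b1 where "b1 k = m + e k ^ 2 * d1" for k
  define b2 where "b2 k = n + e k ^ 2 * d2" for k
  have b: "b1 \<longlonglongrightarrow> m" "b2 \<longlonglongrightarrow> n"
    unfolding b1_def b2_def by (rule tendsto_eq_intros e | simp)+
  define x :: "nat \<Rightarrow> complex ^ 4" where
    "x k = vector [e k * \<rho> * m, e k ^ 3 * b1 k / \<rho>, e k * \<rho> * n, e k ^ 3 * b2 k / \<rho>]" for k
  define t0 where "t0 k = inverse (e k ^ 4)" for k
  define t2 where "t2 k = inverse (e k ^ 2)" for k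
  have x0: "x \<longlonglongrightarrow> 0"
  proof (rule vec_tendstoI)
    fix i
    have "\<forall>i. (\<lambda>k. x k $ i) \<longlonglongrightarrow> 0"
      unfolding forall_4 x_def vector_4 using \<rho>0
      by (intro conjI) (rule tendsto_eq_intros e b | simp)+
    then show "(\<lambda>k. x k $ i) \<longlonglongrightarrow> 0 $ i" by simp
  qed
  have "\<forall>i. (\<lambda>k. t0 k * phi0 i (x k)) \<longlonglongrightarrow> z $ i"
    unfolding forall_3
  proof (intro conjI)
    have "t0 k * phi0 1 (x k) = - 2 * (m * b2 k + n * b1 k)" for k
      using e0[of k] \<rho>0 unfolding phi_vector_simps phi_defs x_def t0_def vector_4
      by (simp add: field_simps eval_nat_numeral)
    then show "(\<lambda>k. t0 k * phi0 1 (x k)) \<longlonglongrightarrow> z $ 1"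
      unfolding zc by simp (rule tendsto_eq_intros b | simp)+
    have "t0 k * phi0 2 (x k) = 2 * \<i> * (m * b1 k + n * b2 k)" for k
      using e0[of k] \<rho>0 unfolding phi_vector_simps phi_defs x_def t0_def vector_4
      by (simp add: field_simps eval_nat_numeral)
    then show "(\<lambda>k. t0 k * phi0 2 (x k)) \<longlonglongrightarrow> z $ 2"
      unfolding zc by simp (rule tendsto_eq_intros b | simp add: power2_eq_square)+
    have "t0 k * phi0 3 (x k) = 2 * (n * b2 k - m * b1 k)" for k
      using e0[of k] \<rho>0 unfolding phi_vector_simps phi_defs x_def t0_def vector_4
      by (simp add: field_simps eval_nat_numeral)
    then show "(\<lambda>k. t0 k * phi0 3 (x k)) \<longlonglongrightarrow> z $ 3"
      unfolding zc by simp (rule tendsto_eq_intros b | simp add: power2_eq_square)+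
  qed
  moreover have "\<forall>i. (\<lambda>k. t2 k * phi2 i (x k)) \<longlonglongrightarrow> (\<beta> *s z) $ i"
    unfolding forall_3
  proof (intro conjI)
    have "t2 k * phi2 1 (x k) = 2 * (\<rho>^2 * m * n - e k ^ 4 * b1 k * b2 k / \<rho>^2)" for k
      using e0[of k] \<rho>0 unfolding phi_vector_simps phi_defs x_def t2_def vector_4
      by (simp add: field_simps eval_nat_numeral)
    then show "(\<lambda>k. t2 k * phi2 1 (x k)) \<longlonglongrightarrow> (\<beta> *s z) $ 1"
      using \<beta> unfolding zc \<rho>2
      by simp (rule tendsto_eq_intros b e | simp add: algebra_simps power2_eq_square)+
    have "t2 k * phi2 2 (x k) =
        \<i> * (- (\<rho>^2 * m^2) + e k ^ 4 * b1 k ^ 2 / \<rho>^2 - \<rho>^2 * n^2 + e k ^ 4 * b2 k ^ 2 / \<rho>^2)" for k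
      using e0[of k] \<rho>0 unfolding phi_vector_simps phi_defs x_def t2_def vector_4
      by (simp add: field_simps eval_nat_numeral)
    then show "(\<lambda>k. t2 k * phi2 2 (x k)) \<longlonglongrightarrow> (\<beta> *s z) $ 2"
      using \<beta> unfolding zc \<rho>2
      by simp (rule tendsto_eq_intros b e | simp add: algebra_simps power2_eq_square)+
    have "t2 k * phi2 3 (x k) =
        \<rho>^2 * m^2 - e k ^ 4 * b1 k ^ 2 / \<rho>^2 - \<rho>^2 * n^2 + e k ^ 4 * b2 k ^ 2 / \<rho>^2" for k
      using e0[of k] \<rho>0 unfolding phi_vector_simps phi_defs x_def t2_def vector_4
      by (simp add: field_simps eval_nat_numeral)
    moreover have "(\<lambda>k. \<rho>^2 * m^2 - e k ^ 4 * b1 k ^ 2 / \<rho>^2 - \<rho>^2 * n^2 + e k ^ 4 * b2 k ^ 2 / \<rho>^2)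
        \<longlonglongrightarrow> \<rho>^2 * m^2 - 0 ^ 4 * m ^ 2 / \<rho>^2 - \<rho>^2 * n^2 + 0 ^ 4 * n ^ 2 / \<rho>^2"
      using \<rho>0 by (intro tendsto_intros b e) auto
    ultimately show "(\<lambda>k. t2 k * phi2 3 (x k)) \<longlonglongrightarrow> (\<beta> *s z) $ 3"
      unfolding zc \<rho>2 by (simp add: right_diff_distrib mult_ac)
  qed
  moreover have "\<forall>i. (\<lambda>k. phi_rest i (x k)) \<longlonglongrightarrow> 0"
    unfolding forall_3 phi_vector_simps phi_defs x_def vector_4 using \<rho>0
    by (intro conjI) (rule tendsto_eq_intros b e | simp)+
  moreover have "(\<lambda>k. t0 k * t2 k * phi02 (x k)) \<longlonglongrightarrow> w"
  proof -
    have "t0 k * t2 k * phi02 (x k) = w" for k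
      using e0[of k] \<rho>0 unfolding phi_defs x_def t0_def t2_def vector_4 d[symmetric] b1_def b2_def
      by (simp add: field_simps eval_nat_numeral)
    then show ?thesis by simp
  qed
  moreover have "(\<lambda>k. inverse (t0 k ^ 2)) \<longlonglongrightarrow> 0" "(\<lambda>k. inverse (t2 k ^ 2)) \<longlonglongrightarrow> 0"
    unfolding t0_def t2_def by (simp_all add: power_inverse) (rule tendsto_eq_intros e | simp)+
  moreover have "\<forall>k. t0 k \<noteq> 0 \<and> t2 k \<noteq> 0" using e0 by (simp add: t0_def t2_def)
  ultimately show ?thesis unfolding central_limit_def using x0 by blast
qed

text \<open>The hypothesis is the vanishing of the determinant of the 2 x 2 matrix with rows (p,r)
  and (s,q), which is to be written as the product of the column (x1,x3) and the row
  (x2,x4).\<close>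

lemma rank_one_factorization:
  fixes p q r s :: complex
  assumes "p * q = r * s"
  obtains x1 x2 x3 x4 where "x1 * x2 = p" "x3 * x4 = q" "x1 * x4 = r" "x2 * x3 = s"
proof -
  consider "p \<noteq> 0" | "p = 0" "r = 0" | "p = 0" "s = 0" "r \<noteq> 0"
    using assms by (cases "p = 0"; cases "r = 0") auto
  then show thesis
  proof cases
    case 1
    then show ?thesis using assms by (intro that[of 1 p "s / p" r]) (auto simp: field_simps)
  next
    case 2
    then show ?thesis by (intro that[of 0 s 1 q]) auto
  next
    case 3
    then show ?thesis by (intro that[of r 0 q 1]) auto
  qed
qed

text \<open>With t2 constant, shrinking x by e and putting t0 = e^-2 keeps all bilinear data fixed,
  while \<open>phi2\<close> and \<open>phi_rest\<close> tend to 0. It remains to realize the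
  bilinear data by two vectors, and the quadric equation is exactly the required rank one
  condition.\<close>

lemma central_limit_plane:
  assumes z: "(\<Sum>i\<in>UNIV. z $ i ^ 2) = - (w^2) * u" and u: "u \<noteq> 0"
  shows "central_limit z 0 w 0 u"
proof -
  define r where "r = csqrt u"
  have r2: "r^2 = u" by (simp add: r_def)
  then have r0: "r \<noteq> 0" using u by auto
  \<comment> \<open>With t2 = 1/r this is the value that t0 \<open>phi02\<close> must take. The four
    numbers below solve the linear equations for the products x1 x2, x3 x4, x1 x4, x2 x3.\<close>
  define \<omega> where "\<omega> = w * r"
  let ?p = "(- \<i> * z $ 2 - z $ 3) / 4" and ?q = "(- \<i> * z $ 2 + z $ 3) / 4"
  let ?r = "(- z $ 1 - \<i> * \<omega>) / 4" and ?s = "(- z $ 1 + \<i> * \<omega>) / 4"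
  have "(z $ 1)^2 + (z $ 2)^2 + (z $ 3)^2 + \<omega>^2 = 0"
    using z by (simp add: sum_3 \<omega>_def power_mult_distrib r2)
  then have "- ((z $ 2)^2) - (z $ 3)^2 = (z $ 1)^2 + \<omega>^2" by algebra
  moreover have "?p * ?q = (- ((z $ 2)^2) - (z $ 3)^2) / 16" "?r * ?s = ((z $ 1)^2 + \<omega>^2) / 16"
    by (simp_all add: field_simps power2_eq_square)
  ultimately have "?p * ?q = ?r * ?s" by simp
  then obtain y1 y2 y3 y4 where y: "y1 * y2 = ?p" "y3 * y4 = ?q" "y1 * y4 = ?r" "y2 * y3 = ?s"
    by (rule rank_one_factorization)
  have y': "y3 * y2 = ?s" using y(4) by (simp add: mult.commute)
  define e :: "nat \<Rightarrow> complex" where "e k = of_real (inverse (real (Suc k)))" for k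
  have e0: "e k \<noteq> 0" for k unfolding e_def by (simp del: of_nat_Suc)
  have e: "e \<longlonglongrightarrow> 0"
    unfolding e_def using LIMSEQ_inverse_real_of_nat tendsto_of_real by (metis of_real_0)
  define x :: "nat \<Rightarrow> complex ^ 4" where
    "x k = vector [e k * y1, e k * y2, e k * y3, e k * y4]" for k
  define t0 where "t0 k = inverse (e k ^ 2)" for k
  define t2 where "t2 k = inverse r" for k :: nat
  have x0: "x \<longlonglongrightarrow> 0"
  proof (rule vec_tendstoI)
    fix i
    have "\<forall>i. (\<lambda>k. x k $ i) \<longlonglongrightarrow> 0"
      unfolding forall_4 x_def vector_4 by (intro conjI) (rule tendsto_eq_intros e | simp)+
    then show "(\<lambda>k. x k $ i) \<longlonglongrightarrow> 0 $ i" by simp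
  qed
  have scale: "t0 k * (e k * e k) = 1" for k
    using e0[of k] by (simp add: t0_def power2_eq_square field_simps)
  have "\<forall>i. t0 k * phi0 i (x k) = z $ i" for k
  proof -
    have "t0 k * phi0 1 (x k) = - 2 * (y1 * y4 + y2 * y3)"
      using scale[of k] unfolding phi_vector_simps phi_defs x_def vector_4 by algebra
    moreover have "t0 k * phi0 2 (x k) = 2 * \<i> * (y1 * y2 + y3 * y4)"
      using scale[of k] unfolding phi_vector_simps phi_defs x_def vector_4 by algebra
    moreover have "t0 k * phi0 3 (x k) = 2 * (- (y1 * y2) + y3 * y4)"
      using scale[of k] unfolding phi_vector_simps phi_defs x_def vector_4 by algebra
    ultimately show ?thesis unfolding forall_3 y by (simp add: field_simps)
  qed
  then have "\<forall>i. (\<lambda>k. t0 k * phi0 i (x k)) \<longlonglongrightarrow> z $ i" by simp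
  moreover have "t0 k * t2 k * phi02 (x k) = w" for k
  proof -
    have "t0 k * phi02 (x k) = 2 * \<i> * (y1 * y4 - y2 * y3)"
      using scale[of k] unfolding phi_defs x_def vector_4 by algebra
    also have "\<dots> = \<omega>" unfolding y by (simp add: field_simps)
    finally show ?thesis using r0 by (simp add: t2_def \<omega>_def mult.commute mult.left_commute)
  qed
  then have "(\<lambda>k. t0 k * t2 k * phi02 (x k)) \<longlonglongrightarrow> w" by simp
  moreover have "\<forall>i. (\<lambda>k. t2 k * phi2 i (x k)) \<longlonglongrightarrow> (0 :: complex ^ 3) $ i"
    "\<forall>i. (\<lambda>k. phi_rest i (x k)) \<longlonglongrightarrow> 0"
    unfolding forall_3 phi_vector_simps phi_defs x_def vector_4 t2_def
    by (intro conjI; (rule tendsto_eq_intros e | simp)+)+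
  moreover have "(\<lambda>k. inverse (t0 k ^ 2)) \<longlonglongrightarrow> 0"
    unfolding t0_def by (simp add: power_inverse) (rule tendsto_eq_intros e | simp)+
  moreover have "(\<lambda>k. inverse (t2 k ^ 2)) \<longlonglongrightarrow> u"
    unfolding t2_def by (simp add: power_inverse r2)
  moreover have "\<forall>k. t0 k \<noteq> 0 \<and> t2 k \<noteq> 0" using e0 r0 by (simp add: t0_def t2_def)
  ultimately show ?thesis unfolding central_limit_def using x0 by blast
qed

section \<open>Functions on the GIT quotient\<close>

lemma function_sheaf_spec: "function_sheaf (spec const_laurent R)"
  unfolding spec_def by (rule function_algebra_on.function_sheaf_zariski[OF function_algebra_on_SpecR])

lemma points_spec: "points (spec const_laurent R) = SpecR"
  unfolding spec_def by (rule function_algebra_on.points_zariski[OF function_algebra_on_SpecR])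

lemma openin_spec: "f \<in> R \<Longrightarrow> openin (topo (spec const_laurent R)) {p \<in> SpecR. p f \<noteq> 0}"
  unfolding spec_def
  using function_algebra_on.openin_zariski_basis[OF function_algebra_on_SpecR, of "\<lambda>p. p f"] by blast

lemma function_sheaf_git_quotient: "function_sheaf (git_quotient a b)"
  unfolding git_quotient_def
  by (intro function_sheaf_quot function_sheaf_sub function_sheaf_spec)

lemma points_sub_spec: "points (sub_fspace (spec const_laurent R) (semistable a b)) = semistable a b"
  using semistable_subset by (auto simp: points_sub_fspace points_spec)

lemma points_git_quotient: "points (git_quotient a b) = torus_orbit ` semistable a b"
  unfolding git_quotient_def by (simp add: points_quot_fspace points_sub_spec)

lemma openin_git_quotient:
  assumes "W \<subseteq> points (git_quotient a b)" "V \<subseteq> R"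
    and "\<And>p. p \<in> semistable a b \<Longrightarrow> torus_orbit p \<in> W \<longleftrightarrow> (\<exists>f\<in>V. p f \<noteq> 0)"
  shows "openin (topo (git_quotient a b)) W"
proof -
  have "openin (topo (spec const_laurent R)) (\<Union>f\<in>V. {p \<in> SpecR. p f \<noteq> 0})"
    using assms(2) openin_spec by blast
  moreover have "{p \<in> semistable a b. torus_orbit p \<in> W} =
      (\<Union>f\<in>V. {p \<in> SpecR. p f \<noteq> 0}) \<inter> semistable a b"
    using assms(3) semistable_subset[of a b] by auto
  ultimately have "openin (topo (sub_fspace (spec const_laurent R) (semistable a b)))
      {p \<in> semistable a b. torus_orbit p \<in> W}"
    unfolding openin_sub_fspace by blast
  then show ?thesis
    using assms(1) unfolding points_git_quotient
    unfolding git_quotient_def openin_quot_fspace points_sub_spec by blast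
qed

lemma closedin_git_quotient:
  assumes "K \<subseteq> points (git_quotient a b)" "V \<subseteq> R"
    and "\<And>p. p \<in> semistable a b \<Longrightarrow> torus_orbit p \<in> K \<longleftrightarrow> (\<forall>f\<in>V. p f = 0)"
  shows "closedin (topo (git_quotient a b)) K"
proof -
  have "openin (topo (git_quotient a b)) (points (git_quotient a b) - K)"
    by (rule openin_git_quotient[OF _ assms(2)]) (use assms(3) in \<open>auto simp: points_git_quotient\<close>)
  then show ?thesis using assms(1) by (simp add: closedin_def points_def)
qed

text \<open>\<open>the_elem\<close> is meaningful when both elements have the same degree: the
  characters cancel and the fraction is constant on orbits.\<close>

definition quotient_fraction ::
  "laurent \<Rightarrow> laurent \<Rightarrow> (laurent \<Rightarrow> complex) set \<Rightarrow> complex" where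
  "quotient_fraction f g x = the_elem ((\<lambda>p. p f / p g) ` x)"

definition nonvanishing :: "int \<Rightarrow> int \<Rightarrow> laurent \<Rightarrow> (laurent \<Rightarrow> complex) set set" where
  "nonvanishing a b g = {x \<in> points (git_quotient a b). \<forall>p\<in>x. p g \<noteq> 0}"

lemma the_elem_image_orbit:
  assumes "p \<in> SpecR" "\<And>s. s \<in> torus \<Longrightarrow> h (torus_act s p) = h p"
  shows "the_elem (h ` torus_orbit p) = h p"
proof -
  have "h ` torus_orbit p = {h p}"
    using assms mem_torus_orbit[of p] unfolding torus_orbit_def by auto
  then show ?thesis by simp
qed

lemma quotient_fraction_orbit:
  assumes "p \<in> SpecR" "f \<in> R_degree d" "g \<in> R_degree d"
  shows "quotient_fraction f g (torus_orbit p) = p f / p g"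
  unfolding quotient_fraction_def
  by (rule the_elem_image_orbit)
    (use assms chi_nonzero in \<open>auto simp: torus_act_R_degree\<close>)

lemma orbit_in_nonvanishing_iff:
  assumes "p \<in> semistable a b" "g \<in> R_degree d"
  shows "torus_orbit p \<in> nonvanishing a b g \<longleftrightarrow> p g \<noteq> 0"
proof -
  have p: "p \<in> SpecR" using assms semistable_subset by blast
  have "torus_act s p g \<noteq> 0" if "s \<in> torus" "p g \<noteq> 0" for s
    using torus_act_R_degree[OF p assms(2), of s] chi_nonzero[OF that(1)] that(2) by simp
  then show ?thesis
    using assms(1) mem_torus_orbit[OF p]
    unfolding nonvanishing_def points_git_quotient by (auto simp: torus_orbit_def)
qed

lemma openin_nonvanishing:
  assumes "g \<in> R_degree d"
  shows "openin (topo (git_quotient a b)) (nonvanishing a b g)"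
  by (rule openin_git_quotient[of _ _ _ "{g}"])
    (use orbit_in_nonvanishing_iff[OF _ assms] R_degree_in_R[OF assms] in \<open>auto simp: nonvanishing_def\<close>)

lemma regular_quotient_fraction:
  assumes f: "f \<in> R_degree d" and g: "g \<in> R_degree d"
  shows "regular (git_quotient a b) (nonvanishing a b g) (quotient_fraction f g)"
proof -
  let ?U = "{p \<in> SpecR. p g \<noteq> 0}"
  have R: "f \<in> R" "g \<in> R" using f g R_degree_in_R by blast+
  have 1: "regular (spec const_laurent R) ?U (\<lambda>p. p f / p g)"
    unfolding spec_def function_algebra_on.regular_zariski[OF function_algebra_on_SpecR]
    using R by (intro ballI bexI[of _ "\<lambda>p. p f"] bexI[of _ "\<lambda>p. p g"]) auto
  show ?thesis
    unfolding git_quotient_def regular_quot_fspace points_sub_spec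
    unfolding regular_sub_fspace
  proof
    fix z assume z: "z \<in> {p \<in> semistable a b. torus_orbit p \<in> nonvanishing a b g}"
    then have "z g \<noteq> 0" using orbit_in_nonvanishing_iff g by blast
    then have "z \<in> ?U" using z semistable_subset by blast
    moreover have "(quotient_fraction f g \<circ> torus_orbit) w = w f / w g" if "w \<in> ?U" for w
      using quotient_fraction_orbit[OF _ f g] that by simp
    ultimately show "\<exists>U h. openin (topo (spec const_laurent R)) U \<and> z \<in> U \<and>
        regular (spec const_laurent R) U h \<and>
        (\<forall>w\<in>{p \<in> semistable a b. torus_orbit p \<in> nonvanishing a b g} \<inter> U.
          (quotient_fraction f g \<circ> torus_orbit) w = h w)"
      using 1 openin_spec[OF R(2)] by (intro exI[of _ ?U] exI[of _ "\<lambda>p. p f / p g"]) auto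
  qed
qed

text \<open>The points \<open>P v\<close> may come from a choice without any formula. Polynomial
  dependence of the values on generators propagates to all of \<open>R\<close>, which makes
  \<open>P\<close> a morphism to the spectrum.\<close>

lemma fs_morphism_to_git_quotient:
  fixes Y :: "(complex ^ 'n) set"
  assumes gens: "R = subalg_gen const_laurent B"
    and P: "\<And>v. v \<in> Y \<Longrightarrow> P v \<in> semistable a b"
    and poly: "\<And>g. g \<in> B \<Longrightarrow> \<exists>q\<in>poly_functions. \<forall>v\<in>Y. P v g = q v"
  shows "fs_morphism (sub_fspace affine_space Y) (git_quotient a b) (\<lambda>v. torus_orbit (P v))"
proof -
  let ?A = "sub_fspace affine_space Y"
  have sA: "function_sheaf ?A" using function_sheaf_sub function_sheaf_affine_space by blast
  have pA: "points ?A = Y" by (simp add: points_sub_fspace points_affine_space)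
  have PS: "P v \<in> SpecR" if "v \<in> Y" for v using P[OF that] semistable_subset by blast
  have "\<exists>q\<in>poly_functions. \<forall>v\<in>Y. P v f = q v" if f: "f \<in> R" for f
    using f[unfolded gens]
  proof induction
    case (scalar c)
    then show ?case using PS poly_functions_intros(1)[of c] by (intro bexI[of _ "\<lambda>_. c"]) auto
  next
    case (gen b)
    then show ?case using poly by blast
  next
    case (add x y)
    then obtain q r where "q \<in> poly_functions" "\<forall>v\<in>Y. P v x = q v"
      "r \<in> poly_functions" "\<forall>v\<in>Y. P v y = r v" by blast
    then show ?case using add(1,2) PS poly_functions_intros(3)[of q r]
      by (intro bexI[of _ "\<lambda>v. q v + r v"]) (auto simp: SpecR_add gens[symmetric])
  next
    case (mult x y)
    then obtain q r where "q \<in> poly_functions" "\<forall>v\<in>Y. P v x = q v"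
      "r \<in> poly_functions" "\<forall>v\<in>Y. P v y = r v" by blast
    then show ?case using mult(1,2) PS poly_functions_intros(4)[of q r]
      by (intro bexI[of _ "\<lambda>v. q v * r v"]) (auto simp: SpecR_mult gens[symmetric])
  qed
  note poly_R = this
  have "fs_morphism ?A (spec const_laurent R) P"
    unfolding spec_def
  proof (rule fs_morphism_into_zariski[OF sA function_algebra_on_SpecR])
    fix f :: "(laurent \<Rightarrow> complex) \<Rightarrow> complex" assume "f \<in> (\<lambda>f p. p f) ` R"
    then obtain g where g: "g \<in> R" "f = (\<lambda>p. p g)" by blast
    obtain q where q: "q \<in> poly_functions" "\<forall>v\<in>Y. P v g = q v" using poly_R[OF g(1)] by blast
    have "regular affine_space UNIV q"
      unfolding affine_space_def
      by (rule function_algebra_on.regular_zariski_global[OF function_algebra_on_poly_functions q(1)]) simp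
    moreover have "openin (topo affine_space) (UNIV :: (complex ^ 'n) set)"
      using openin_points[of affine_space] by (simp add: points_affine_space)
    ultimately show "regular ?A (points ?A) (f \<circ> P)"
      unfolding regular_sub_fspace pA using q(2) g(2)
      by (intro ballI exI[of _ UNIV] exI[of _ q]) auto
  qed (use PS pA in auto)
  then have "fs_morphism ?A (sub_fspace (spec const_laurent R) (semistable a b)) P"
    by (rule fs_morphism_into_sub[OF sA]) (use P pA in auto)
  from fs_morphism_compose[OF this fs_morphism_proj[of _ torus_orbit]]
  show ?thesis by (simp add: git_quotient_def o_def)
qed

lemma to_VG_torus_act:
  assumes "p \<in> SpecR" "s \<in> torus"
  shows "to_VG (torus_act s p) = to_VG p"
  unfolding to_VG_def
proof (rule restrict_ext)
  fix h assume "h \<in> invariants"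
  then have "lterm 0 0 h \<in> R_degree (0, 0)" using invariants_in_R lterm_in_R_degree by simp
  from torus_act_R_degree[OF assms(1) this] show "torus_act s p (lterm 0 0 h) = p (lterm 0 0 h)"
    by (simp add: chi_def)
qed

lemma central_fiber_iff:
  assumes "p \<in> semistable a b"
  shows "torus_orbit p \<in> central_fiber a b \<longleftrightarrow> to_VG p = VG_origin"
proof -
  have "p \<in> SpecR" using assms semistable_subset by blast
  then have "resolution_map (torus_orbit p) = to_VG p"
    unfolding resolution_map_def by (intro the_elem_image_orbit to_VG_torus_act)
  then show ?thesis using assms by (auto simp: central_fiber_def points_git_quotient)
qed

section \<open>The central fiber\<close>

lemma proj_class_scale:
  assumes "c \<noteq> 0"
  shows "proj_class (c *s z) = proj_class z"
proof -
  have "\<exists>k. d *s (c *s z) = k *s z \<and> k \<noteq> 0" if "d \<noteq> 0" for d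
    using that assms by (intro exI[of _ "d * c"]) (simp add: vector_smult_assoc)
  moreover have "\<exists>k. d *s z = k *s (c *s z) \<and> k \<noteq> 0" if "d \<noteq> 0" for d
    using that assms by (intro exI[of _ "d / c"]) (simp add: vector_smult_assoc)
  ultimately show ?thesis unfolding proj_class_def by blast
qed

text \<open>The two linearizations are exchanged by swapping the indices \<open>0\<close> and \<open>2\<close>. The locale collects
  what the argument uses; here \<open>A\<close>, \<open>B\<close>, \<open>C\<close> stand for the generators \<open>\<phi>\<^sub>0\<^sub>jt\<^sub>0\<close>, \<open>\<phi>\<^sub>2\<^sub>jt\<^sub>2\<close>, \<open>\<phi>\<^sub>j\<^sub>k\<close> with
  \<open>j, k \<in> {1,3,4}\<close>, and \<open>W = \<phi>\<^sub>0\<^sub>2t\<^sub>0t\<^sub>2\<close>, \<open>S = t\<^sub>0\<^sup>-\<^sup>2\<close>, \<open>U = t\<^sub>2\<^sup>-\<^sup>2\<close>.\<close>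

lemma hirzebruch_class_scale:
  assumes "l \<noteq> 0" "m \<noteq> 0"
  shows "hirzebruch_class n (vector [l * v $ 1, l * v $ 2, m * v $ 3, inverse l ^ n * m * v $ 4]) =
    hirzebruch_class n v" (is "hirzebruch_class n ?w = _")
proof
  show "hirzebruch_class n ?w \<subseteq> hirzebruch_class n v"
  proof
    fix x assume "x \<in> hirzebruch_class n ?w"
    then obtain l' m' where x: "l' \<noteq> 0" "m' \<noteq> 0"
      "x = vector [l' * ?w $ 1, l' * ?w $ 2, m' * ?w $ 3, inverse l' ^ n * m' * ?w $ 4]"
      unfolding hirzebruch_class_def by blast
    have "x = vector [(l' * l) * v $ 1, (l' * l) * v $ 2, (m' * m) * v $ 3,
        inverse (l' * l) ^ n * (m' * m) * v $ 4]"
      unfolding x(3) vector_4 by (simp add: power_mult_distrib mult_ac)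
    then show "x \<in> hirzebruch_class n v"
      using x(1,2) assms unfolding hirzebruch_class_def by (metis (mono_tags, lifting) CollectI mult_eq_0_iff)
  qed
  show "hirzebruch_class n v \<subseteq> hirzebruch_class n ?w"
  proof
    fix x assume "x \<in> hirzebruch_class n v"
    then obtain l' m' where x: "l' \<noteq> 0" "m' \<noteq> 0"
      "x = vector [l' * v $ 1, l' * v $ 2, m' * v $ 3, inverse l' ^ n * m' * v $ 4]"
      unfolding hirzebruch_class_def by blast
    have "x = vector [(l' / l) * ?w $ 1, (l' / l) * ?w $ 2, (m' / m) * ?w $ 3,
        inverse (l' / l) ^ n * (m' / m) * ?w $ 4]"
      unfolding x(3) vector_4 using assms by (simp add: power_divide power_inverse field_simps)
    then show "x \<in> hirzebruch_class n ?w"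
      using x(1,2) assms unfolding hirzebruch_class_def
      by (metis (mono_tags, lifting) CollectI divide_eq_0_iff)
  qed
qed

lemma mem_hirzebruch_class: "v \<in> hirzebruch_class n v"
  unfolding hirzebruch_class_def
  by (intro CollectI exI[of _ 1]) (simp add: vec_eq_iff forall_4 vector_4)

lemma conic_point_scale: "conic_point (l * m) (l * n) = l^2 *s conic_point m n"
  by (simp add: conic_point_def vec_eq_iff forall_3 power2_eq_square algebra_simps)

locale central_fiber_data =
  fixes e1 e2 :: "int \<times> int" and A B C :: "3 \<Rightarrow> laurent" and W S U :: laurent
    and tor :: "complex \<Rightarrow> complex \<Rightarrow> complex \<times> complex"
    and has_vals :: "(laurent \<Rightarrow> complex) \<Rightarrow>
      complex ^ 3 \<Rightarrow> complex ^ 3 \<Rightarrow> complex \<Rightarrow> complex \<Rightarrow> complex \<Rightarrow> bool"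
  assumes gens: "R = subalg_gen const_laurent (range A \<union> range B \<union> range C \<union> {W, S, U})"
    and has_vals: "has_vals p z y w s u \<longleftrightarrow> (\<forall>i. p (A i) = z $ i \<and> p (B i) = y $ i \<and> p (C i) = 0) \<and>
      p W = w \<and> p S = s \<and> p U = u"
    and degA: "A i \<in> R_degree e1" and degB: "B i \<in> R_degree e2" and degC: "C i \<in> R_degree 0"
    and degW: "W \<in> R_degree (e1 + e2)" and degS: "S \<in> R_degree (- e1 - e1)"
    and degU: "U \<in> R_degree (- e2 - e2)"
    and tor: "c \<noteq> 0 \<Longrightarrow> d \<noteq> 0 \<Longrightarrow> tor c d \<in> torus \<and> chi (tor c d) e1 = c \<and> chi (tor c d) e2 = d"
    and quadric: "p \<in> SpecR \<Longrightarrow> (\<Sum>i\<in>UNIV. p (A i) ^ 2) = - (p W ^ 2) * p U"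
    and parallel: "p \<in> SpecR \<Longrightarrow> (\<And>i. p (C i) = 0) \<Longrightarrow> p (A i) * p (B j) = p (A j) * p (B i)"
    and central: "p \<in> SpecR \<Longrightarrow> to_VG p = VG_origin \<Longrightarrow>
      p (C i) = 0 \<and> p (A i) ^ 2 * p S = 0 \<and> p (B i) ^ 2 * p U = 0"
    and exists_conic: "(\<Sum>i\<in>UNIV. z $ i ^ 2) = 0 \<Longrightarrow> z \<noteq> 0 \<Longrightarrow> \<beta> \<noteq> 0 \<Longrightarrow>
      \<exists>p\<in>SpecR. to_VG p = VG_origin \<and> has_vals p z (\<beta> *s z) w 0 0"
    and exists_plane: "(\<Sum>i\<in>UNIV. z $ i ^ 2) = - (w^2) * u \<Longrightarrow> u \<noteq> 0 \<Longrightarrow>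
      \<exists>p\<in>SpecR. to_VG p = VG_origin \<and> has_vals p z 0 w 0 u"
begin

abbreviation "gen_set \<equiv> range A \<union> range B \<union> range C \<union> {W, S, U}"

lemma gens_in_R: "A i \<in> R" "B i \<in> R" "C i \<in> R" "W \<in> R" "S \<in> R" "U \<in> R"
  using degA degB degC degW degS degU R_degree_in_R by blast+

lemma chi_tor:
  assumes "x \<noteq> 0" "y \<noteq> 0"
  shows "chi (tor x y) (e1 + e2) = x * y"
    and "chi (tor x y) (- e1 - e1) = inverse (x^2)" and "chi (tor x y) (- e2 - e2) = inverse (y^2)"
    and "chi (tor x y) (e1 + e1 + e2) = x^2 * y"
proof -
  have t: "tor x y \<in> torus" "chi (tor x y) e1 = x" "chi (tor x y) e2 = y" using tor assms by blast+
  have m: "chi (tor x y) (- d) = inverse (chi (tor x y) d)" for d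
    using chi_add[OF t(1), of d "- d"] by (simp add: inverse_unique)
  show "chi (tor x y) (e1 + e2) = x * y" "chi (tor x y) (- e1 - e1) = inverse (x^2)"
    "chi (tor x y) (- e2 - e2) = inverse (y^2)" "chi (tor x y) (e1 + e1 + e2) = x^2 * y"
    using t(2,3) chi_add[OF t(1), of "- e1" "- e1"] chi_add[OF t(1), of "- e2" "- e2"]
    by (simp_all add: chi_add[OF t(1)] m power2_eq_square)
qed

lemma act_tor:
  assumes "x \<noteq> 0" "y \<noteq> 0" "p \<in> SpecR"
  shows "torus_act (tor x y) p (A i) = x * p (A i)" "torus_act (tor x y) p (B i) = y * p (B i)"
    "torus_act (tor x y) p (C i) = p (C i)" "torus_act (tor x y) p W = x * y * p W"
    "torus_act (tor x y) p S = inverse (x^2) * p S" "torus_act (tor x y) p U = inverse (y^2) * p U"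
  using tor[OF assms(1,2)] chi_tor[OF assms(1,2)]
  by (simp_all add: torus_act_R_degree[OF assms(3)] degA degB degC degW degS degU
      torus_act_R_degree[OF assms(3) degA] torus_act_R_degree[OF assms(3) degB]
      torus_act_R_degree[OF assms(3) degC] torus_act_R_degree[OF assms(3) degW]
      torus_act_R_degree[OF assms(3) degS] torus_act_R_degree[OF assms(3) degU])

lemma has_vals_unique:
  assumes "p \<in> SpecR" "q \<in> SpecR" "has_vals p z y w s u" "has_vals q z y w s u"
  shows "p = q"
  by (rule SpecR_eqI[OF assms(1,2) gens]) (use assms(3,4) in \<open>auto simp: has_vals\<close>)

text \<open>The curves divide by a root of \<open>\<beta>\<close>, so the case
  \<open>\<beta> = 0\<close> is reached by one more limit, along \<open>\<beta> = 1/(k+1)\<close>.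
  Lying over the origin is preserved, as each invariant is constant along this sequence.\<close>

lemma exists_conic':
  assumes "(\<Sum>i\<in>UNIV. z $ i ^ 2) = 0" "z \<noteq> 0"
  shows "\<exists>p\<in>SpecR. to_VG p = VG_origin \<and> has_vals p z (\<beta> *s z) w 0 0"
proof (cases "\<beta> = 0")
  case False
  then show ?thesis using exists_conic assms by blast
next
  case True
  define e :: "nat \<Rightarrow> complex" where "e k = of_real (inverse (real (Suc k)))" for k
  have e0: "e k \<noteq> 0" for k unfolding e_def by (simp del: of_nat_Suc)
  have e: "e \<longlonglongrightarrow> 0"
    unfolding e_def using LIMSEQ_inverse_real_of_nat tendsto_of_real by (metis of_real_0)
  have "\<forall>k. \<exists>p\<in>SpecR. to_VG p = VG_origin \<and> has_vals p z (e k *s z) w 0 0"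
    using exists_conic[OF assms e0] by blast
  then obtain P where P: "\<And>k. P k \<in> SpecR" "\<And>k. to_VG (P k) = VG_origin"
    "\<And>k. has_vals (P k) z (e k *s z) w 0 0" by metis
  define v where "v g = lim (\<lambda>k. P k g)" for g
  have lB: "(\<lambda>k. P k (B i)) \<longlonglongrightarrow> 0" for i
  proof -
    have "(\<lambda>k. e k * z $ i) \<longlonglongrightarrow> 0 * z $ i" by (intro tendsto_intros e)
    then show ?thesis using P(3) by (simp add: has_vals)
  qed
  have lims: "(\<lambda>k. P k (A i)) \<longlonglongrightarrow> z $ i" "(\<lambda>k. P k (C i)) \<longlonglongrightarrow> 0"
    "(\<lambda>k. P k W) \<longlonglongrightarrow> w" "(\<lambda>k. P k S) \<longlonglongrightarrow> 0" "(\<lambda>k. P k U) \<longlonglongrightarrow> 0" for i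
    using P(3) by (simp_all add: has_vals)
  have V: "(\<lambda>k. P k g) \<longlonglongrightarrow> v g" if "g \<in> gen_set" for g
  proof -
    have "\<exists>l. (\<lambda>k. P k g) \<longlonglongrightarrow> l" using that lims lB by blast
    then show ?thesis unfolding v_def by (metis limI)
  qed
  obtain p where p: "p \<in> SpecR" "\<And>f. f \<in> R \<Longrightarrow> (\<lambda>k. P k f) \<longlonglongrightarrow> p f"
    using limit_point_of_SpecR[OF gens P(1) sequentially_bot V] by metis
  have "p (lterm 0 0 h) = h 0" if h: "h \<in> invariants" for h
  proof -
    have "P k (lterm 0 0 h) = h 0" for k using P(2) h unfolding to_VG_eq_origin_iff by blast
    then have "(\<lambda>k. P k (lterm 0 0 h)) \<longlonglongrightarrow> h 0" by simp
    then show ?thesis using p(2)[OF invariants_in_R[OF h]] LIMSEQ_unique by blast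
  qed
  moreover have "has_vals p z (\<beta> *s z) w 0 0"
  proof -
    note u = LIMSEQ_unique[OF p(2)]
    show ?thesis
      unfolding has_vals using True u[OF gens_in_R(1) lims(1)] u[OF gens_in_R(2) lB]
        u[OF gens_in_R(3) lims(2)] u[OF gens_in_R(4) lims(3)] u[OF gens_in_R(5) lims(4)]
        u[OF gens_in_R(6) lims(5)] by simp
  qed
  ultimately show ?thesis using p(1) by (auto simp: to_VG_eq_origin_iff)
qed

context
  fixes a b :: int
  assumes ab: "(a, b) = e1 + e1 + e2"
begin

section \<open>Semistable points for the linearization 2 e1 + e2\<close>

lemma not_semistable:
  assumes p: "p \<in> SpecR"
    and nz: "\<And>t. t \<noteq> 0 \<Longrightarrow> x t \<noteq> 0 \<and> y t \<noteq> 0 \<and> x t ^ 2 * y t = inverse t ^ Suc j"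
    and lim: "\<And>g. g \<in> gen_set \<Longrightarrow> \<exists>n. \<forall>t. t \<noteq> 0 \<longrightarrow> torus_act (tor (x t) (y t)) p g = t ^ n * p g"
  shows "p \<notin> semistable a b"
proof (rule not_semistable_of_one_parameter_subgroup[OF gens p])
  fix t :: complex assume "t \<noteq> 0"
  then show "tor (x t) (y t) \<in> torus" "chi (tor (x t) (y t)) (a, b) = inverse t ^ Suc j"
    using nz tor chi_tor ab by (metis, metis)
qed (rule lim)

lemma semistable_iff:
  assumes p: "p \<in> SpecR"
  shows "p \<in> semistable a b \<longleftrightarrow> (\<exists>i. p (A i) \<noteq> 0) \<and> (p W \<noteq> 0 \<or> (\<exists>i. p (B i) \<noteq> 0))"
proof
  assume ss: "p \<in> semistable a b"
  show "(\<exists>i. p (A i) \<noteq> 0) \<and> (p W \<noteq> 0 \<or> (\<exists>i. p (B i) \<noteq> 0))"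
  proof (rule ccontr)
    assume "\<not> ?thesis"
    then consider "\<And>i. p (A i) = 0" "p W = 0" | "\<And>i. p (A i) = 0" "p W \<noteq> 0"
      | "\<And>i. p (B i) = 0" "p W = 0" by blast
    then have "p \<notin> semistable a b"
    proof cases
      case 1
      show ?thesis
      proof (rule not_semistable[OF p, of "\<lambda>t. inverse t" "\<lambda>t. 1" 1])
        fix g assume "g \<in> gen_set"
        then consider i where "g = A i" | i where "g = B i" | i where "g = C i" | "g = W" | "g = S"
          | "g = U" by blast
        then show "\<exists>n. \<forall>t. t \<noteq> 0 \<longrightarrow> torus_act (tor (inverse t) 1) p g = t ^ n * p g"
        proof cases
          case 5
          then show ?thesis by (intro exI[of _ 2]) (simp add: act_tor p power_inverse)
        qed (intro exI[of _ 0]; simp add: act_tor p 1)+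
      qed (simp add: power2_eq_square)
    next
      case 2
      \<comment> \<open>The weights (-1, 1) multiply \<open>U\<close> by t^-2, so a limit exists
        only if \<open>U\<close> vanishes; the quadric relation ensures this as \<open>A\<close> is
        zero and \<open>W\<close> is not.\<close>
      have "p W ^ 2 * p U = 0" using quadric[OF p] 2 by simp
      then have U: "p U = 0" using 2 by simp
      show ?thesis
      proof (rule not_semistable[OF p, of "\<lambda>t. inverse t" "\<lambda>t. t" 0])
        fix g assume "g \<in> gen_set"
        then consider i where "g = A i" | i where "g = B i" | i where "g = C i" | "g = W" | "g = S"
          | "g = U" by blast
        then show "\<exists>n. \<forall>t. t \<noteq> 0 \<longrightarrow> torus_act (tor (inverse t) t) p g = t ^ n * p g"
        proof cases
          case (2 i)
          then show ?thesis by (intro exI[of _ 1]) (simp add: act_tor p)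
        next
          case 5
          then show ?thesis by (intro exI[of _ 2]) (simp add: act_tor p power_inverse)
        qed (intro exI[of _ 0]; simp add: act_tor p 2 U)+
      qed (simp add: power2_eq_square)
    next
      case 3
      show ?thesis
      proof (rule not_semistable[OF p, of "\<lambda>t. 1" "\<lambda>t. inverse t" 0])
        fix g assume "g \<in> gen_set"
        then consider i where "g = A i" | i where "g = B i" | i where "g = C i" | "g = W" | "g = S"
          | "g = U" by blast
        then show "\<exists>n. \<forall>t. t \<noteq> 0 \<longrightarrow> torus_act (tor 1 (inverse t)) p g = t ^ n * p g"
        proof cases
          case 6
          then show ?thesis by (intro exI[of _ 2]) (simp add: act_tor p power_inverse)
        qed (intro exI[of _ 0]; simp add: act_tor p 3)+
      qed simp
    qed
    then show False using ss by blast
  qed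
next
  assume "(\<exists>i. p (A i) \<noteq> 0) \<and> (p W \<noteq> 0 \<or> (\<exists>i. p (B i) \<noteq> 0))"
  then obtain i where i: "p (A i) \<noteq> 0" and "p W \<noteq> 0 \<or> (\<exists>i. p (B i) \<noteq> 0)" by blast
  then consider "p W \<noteq> 0" | j where "p (B j) \<noteq> 0" by blast
  \<comment> \<open>The witnesses \<open>A i * W\<close> and \<open>A i * A i * B j\<close> already
    have the degree of the linearization, so k = 1 suffices.\<close>
  then have "\<exists>f\<in>R_degree (e1 + e1 + e2). p f \<noteq> 0"
  proof cases
    case 1
    have "A i * W \<in> R_degree (e1 + e1 + e2)"
      using R_degree_mult[OF degA degW, of i] by (simp add: add.assoc)
    then show ?thesis using i 1 p gens_in_R by (intro bexI[of _ "A i * W"]) (auto simp: SpecR_mult)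
  next
    case 2
    have "A i * A i * B j \<in> R_degree (e1 + e1 + e2)"
      by (intro R_degree_mult degA degB)
    then show ?thesis using i 2 p gens_in_R mult_in_R
      by (intro bexI[of _ "A i * A i * B j"]) (auto simp: SpecR_mult)
  qed
  then obtain f where "f \<in> R_deg (1 * a) (1 * b)" "p f \<noteq> 0" using ab[symmetric] by auto
  then show "p \<in> semistable a b" unfolding semistable_def using p by (intro CollectI conjI exI[of _ 1]) auto
qed

section \<open>Parametrizations of the two components\<close>

definition YF :: "(complex ^ 4) set" where
  "YF = {v. (v $ 1 \<noteq> 0 \<or> v $ 2 \<noteq> 0) \<and> (v $ 3 \<noteq> 0 \<or> v $ 4 \<noteq> 0)}"

text \<open>The coordinates of \<open>v\<close> are (m, n, w, \<beta>). The choice is of a unique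
  point, since values on generators determine a homomorphism.\<close>

definition ptF :: "complex ^ 4 \<Rightarrow> laurent \<Rightarrow> complex" where
  "ptF v = (SOME p. p \<in> SpecR \<and> to_VG p = VG_origin \<and>
     has_vals p (conic_point (v $ 1) (v $ 2)) (v $ 4 *s conic_point (v $ 1) (v $ 2)) (v $ 3) 0 0)"

text \<open>The representative of the orbit with \<open>W\<close> equal to 1; the value of
  \<open>U\<close> is then forced by the quadric relation.\<close>

definition ptP :: "complex ^ 3 \<Rightarrow> laurent \<Rightarrow> complex" where
  "ptP z = (SOME p. p \<in> SpecR \<and> to_VG p = VG_origin \<and>
     has_vals p z 0 1 0 (- (\<Sum>i\<in>UNIV. z $ i ^ 2)))"

lemma ptF:
  assumes "v \<in> YF"
  shows "ptF v \<in> SpecR" "to_VG (ptF v) = VG_origin"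
    "has_vals (ptF v) (conic_point (v $ 1) (v $ 2)) (v $ 4 *s conic_point (v $ 1) (v $ 2)) (v $ 3) 0 0"
proof -
  have "conic_point (v $ 1) (v $ 2) \<noteq> 0" using assms by (auto simp: YF_def conic_point_eq_0_iff)
  then have "\<exists>p. p \<in> SpecR \<and> to_VG p = VG_origin \<and>
      has_vals p (conic_point (v $ 1) (v $ 2)) (v $ 4 *s conic_point (v $ 1) (v $ 2)) (v $ 3) 0 0"
    using exists_conic'[OF conic_point_isotropic] by blast
  from someI_ex[OF this] show "ptF v \<in> SpecR" "to_VG (ptF v) = VG_origin"
    "has_vals (ptF v) (conic_point (v $ 1) (v $ 2)) (v $ 4 *s conic_point (v $ 1) (v $ 2)) (v $ 3) 0 0"
    unfolding ptF_def by blast+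
qed

lemma ptP:
  assumes "z \<noteq> 0"
  shows "ptP z \<in> SpecR" "to_VG (ptP z) = VG_origin"
    "has_vals (ptP z) z 0 1 0 (- (\<Sum>i\<in>UNIV. z $ i ^ 2))"
proof -
  have "\<exists>p. p \<in> SpecR \<and> to_VG p = VG_origin \<and> has_vals p z 0 1 0 (- (\<Sum>i\<in>UNIV. z $ i ^ 2))"
  proof (cases "(\<Sum>i\<in>UNIV. z $ i ^ 2) = 0")
    case True
    then show ?thesis using exists_conic'[OF True assms, of 0 1] by auto
  next
    case False
    then show ?thesis using exists_plane[of z 1 "- (\<Sum>i\<in>UNIV. z $ i ^ 2)"] by auto
  qed
  from someI_ex[OF this] show "ptP z \<in> SpecR" "to_VG (ptP z) = VG_origin"
    "has_vals (ptP z) z 0 1 0 (- (\<Sum>i\<in>UNIV. z $ i ^ 2))"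
    unfolding ptP_def by blast+
qed

lemma ptF_semistable:
  assumes v: "v \<in> YF"
  shows "ptF v \<in> semistable a b"
proof -
  have "conic_point (v $ 1) (v $ 2) \<noteq> 0" using v by (auto simp: YF_def conic_point_eq_0_iff)
  then obtain i where i: "conic_point (v $ 1) (v $ 2) $ i \<noteq> 0" by (auto simp: vec_eq_iff)
  have vals: "ptF v (A i) = conic_point (v $ 1) (v $ 2) $ i"
    "ptF v (B i) = v $ 4 * conic_point (v $ 1) (v $ 2) $ i" "ptF v W = v $ 3"
    using ptF(3)[OF v] by (simp_all add: has_vals)
  have "v $ 3 \<noteq> 0 \<or> v $ 4 \<noteq> 0" using v by (simp add: YF_def)
  then have "ptF v W \<noteq> 0 \<or> ptF v (B i) \<noteq> 0" using i vals by simp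
  moreover have "ptF v (A i) \<noteq> 0" using i vals by simp
  ultimately show ?thesis unfolding semistable_iff[OF ptF(1)[OF v]] by blast
qed

lemma ptP_semistable:
  assumes z: "z \<noteq> 0"
  shows "ptP z \<in> semistable a b"
  using ptP(3)[OF z] z unfolding semistable_iff[OF ptP(1)[OF z]] has_vals
  by (auto simp: vec_eq_iff)

abbreviation "SF \<equiv> (\<lambda>v. torus_orbit (ptF v)) ` YF"
abbreviation "SP \<equiv> (\<lambda>z. torus_orbit (ptP z)) ` (UNIV - {0})"

lemma orbit_values:
  assumes "torus_orbit p = torus_orbit q" "p \<in> SpecR" "q \<in> SpecR" "f \<in> R_degree d"
  shows "p f = 0 \<longleftrightarrow> q f = 0"
proof -
  obtain s where "s \<in> torus" "p = torus_act s q" using torus_orbit_eqD assms(1,2) by blast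
  then show ?thesis using torus_act_R_degree[OF assms(3,4)] chi_nonzero by simp
qed

text \<open>Given these equations, \<open>U = 0\<close> makes the vector of \<open>A\<close>
  isotropic and \<open>parallel\<close> makes \<open>B\<close> a multiple of it, so the values are
  those of some \<open>ptF v\<close>. The form as vanishing of elements of \<open>R\<close> also
  yields closedness.\<close>

lemma orbit_in_SF_iff:
  assumes ss: "p \<in> semistable a b"
  shows "torus_orbit p \<in> SF \<longleftrightarrow> (\<forall>f \<in> range C \<union> {S, U}. p f = 0)"
proof
  have p: "p \<in> SpecR" using ss semistable_subset by blast
  assume "torus_orbit p \<in> SF"
  then obtain v where v: "v \<in> YF" "torus_orbit p = torus_orbit (ptF v)" by blast
  show "\<forall>f \<in> range C \<union> {S, U}. p f = 0"
    using ptF(3)[OF v(1)] orbit_values[OF v(2) p ptF(1)[OF v(1)] degC]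
      orbit_values[OF v(2) p ptF(1)[OF v(1)] degS] orbit_values[OF v(2) p ptF(1)[OF v(1)] degU]
    by (auto simp: has_vals)
next
  have p: "p \<in> SpecR" using ss semistable_subset by blast
  assume "\<forall>f \<in> range C \<union> {S, U}. p f = 0"
  then have C: "\<And>i. p (C i) = 0" and S: "p S = 0" and U: "p U = 0" by auto
  define z :: "complex ^ 3" where "z = (\<chi> i. p (A i))"
  have "(\<Sum>i\<in>UNIV. z $ i ^ 2) = 0" using quadric[OF p] U by (simp add: z_def)
  then obtain m n where mn: "z = conic_point m n" by (rule isotropic_eq_conic_point)
  obtain i where i: "p (A i) \<noteq> 0" using ss unfolding semistable_iff[OF p] by blast
  define \<beta> where "\<beta> = p (B i) / p (A i)"
  have B: "p (B j) = \<beta> * p (A j)" for j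
    using parallel[OF p C, of i j] i by (simp add: \<beta>_def field_simps)
  have "p W \<noteq> 0 \<or> \<beta> \<noteq> 0" using ss B unfolding semistable_iff[OF p] by auto
  moreover have "z \<noteq> 0" using i by (auto simp: z_def vec_eq_iff)
  ultimately have v: "vector [m, n, p W, \<beta>] \<in> YF"
    by (simp add: YF_def vector_4 mn conic_point_eq_0_iff)
  have "has_vals p z (\<beta> *s z) (p W) 0 0"
    using B C S U by (simp add: has_vals z_def)
  then have "p = ptF (vector [m, n, p W, \<beta>])"
    using has_vals_unique[OF p ptF(1)[OF v]] ptF(3)[OF v] by (simp add: vector_4 mn)
  then show "torus_orbit p \<in> SF" by (intro image_eqI[OF _ v]) simp
qed

lemma orbit_in_SP_iff:
  assumes ss: "p \<in> semistable a b"
  shows "torus_orbit p \<in> SP \<longleftrightarrow> (\<forall>f \<in> range C \<union> range B \<union> {S}. p f = 0)"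
proof
  have p: "p \<in> SpecR" using ss semistable_subset by blast
  assume "torus_orbit p \<in> SP"
  then obtain z where z: "z \<noteq> 0" "torus_orbit p = torus_orbit (ptP z)" by blast
  show "\<forall>f \<in> range C \<union> range B \<union> {S}. p f = 0"
    using ptP(3)[OF z(1)] orbit_values[OF z(2) p ptP(1)[OF z(1)] degC]
      orbit_values[OF z(2) p ptP(1)[OF z(1)] degS] orbit_values[OF z(2) p ptP(1)[OF z(1)] degB]
    by (auto simp: has_vals)
next
  have p: "p \<in> SpecR" using ss semistable_subset by blast
  assume "\<forall>f \<in> range C \<union> range B \<union> {S}. p f = 0"
  then have C: "\<And>i. p (C i) = 0" and S: "p S = 0" and B: "\<And>i. p (B i) = 0" by auto
  have W: "p W \<noteq> 0" using ss B unfolding semistable_iff[OF p] by blast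
  define z :: "complex ^ 3" where "z = (\<chi> i. p (A i))"
  have z: "z \<noteq> 0" using ss unfolding semistable_iff[OF p] by (auto simp: z_def vec_eq_iff)
  \<comment> \<open>This element normalizes \<open>W\<close> to 1 without moving \<open>A\<close>;
    \<open>U\<close> is multiplied by \<open>p W ^ 2\<close>.\<close>
  let ?s = "tor 1 (inverse (p W))"
  have s: "?s \<in> torus" using tor W by simp
  have q: "torus_act ?s p \<in> SpecR" by (rule torus_act_in_SpecR[OF s p])
  have "inverse ((inverse (p W))^2) * p U = - (\<Sum>i\<in>UNIV. z $ i ^ 2)"
    using quadric[OF p] by (simp add: z_def power_inverse)
  then have "has_vals (torus_act ?s p) z 0 1 0 (- (\<Sum>i\<in>UNIV. z $ i ^ 2))"
    using W B C S by (simp add: has_vals act_tor p z_def)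
  then have "torus_act ?s p = ptP z" using has_vals_unique[OF q ptP(1)[OF z] _ ptP(3)[OF z]] by blast
  then have "torus_orbit p = torus_orbit (ptP z)" using torus_orbit_act[OF s p] by simp
  then show "torus_orbit p \<in> SP" using z by blast
qed

lemma closed_SF: "closedin (topo (git_quotient a b)) SF"
proof (rule closedin_git_quotient)
  show "SF \<subseteq> points (git_quotient a b)" using ptF_semistable by (auto simp: points_git_quotient)
  show "range C \<union> {S, U} \<subseteq> R" using gens_in_R by auto
qed (rule orbit_in_SF_iff)

lemma closed_SP: "closedin (topo (git_quotient a b)) SP"
proof (rule closedin_git_quotient)
  show "SP \<subseteq> points (git_quotient a b)" using ptP_semistable by (auto simp: points_git_quotient)
  show "range C \<union> range B \<union> {S} \<subseteq> R" using gens_in_R by auto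
qed (rule orbit_in_SP_iff)

lemma central_fiber_eq: "central_fiber a b = SF \<union> SP"
proof
  show "central_fiber a b \<subseteq> SF \<union> SP"
  proof
    fix x assume x: "x \<in> central_fiber a b"
    then obtain p where ss: "p \<in> semistable a b" and xp: "x = torus_orbit p"
      by (auto simp: central_fiber_def points_git_quotient)
    have p: "p \<in> SpecR" using ss semistable_subset by blast
    have c: "to_VG p = VG_origin" using x central_fiber_iff[OF ss] xp by blast
    note cen = central[OF p c]
    have S: "p S = 0" using ss cen unfolding semistable_iff[OF p] by auto
    show "x \<in> SF \<union> SP"
    proof (cases "\<forall>i. p (B i) = 0")
      case True
      then have "torus_orbit p \<in> SP" unfolding orbit_in_SP_iff[OF ss] using S cen by auto
      then show ?thesis using xp by blast
    next
      case False
      then have "p U = 0" using cen by auto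
      then have "torus_orbit p \<in> SF" unfolding orbit_in_SF_iff[OF ss] using S cen by auto
      then show ?thesis using xp by blast
    qed
  qed
  show "SF \<union> SP \<subseteq> central_fiber a b"
    using central_fiber_iff[OF ptF_semistable] central_fiber_iff[OF ptP_semistable] ptF(2) ptP(2)
    by auto
qed

lemma morphism_F:
  "fs_morphism (sub_fspace affine_space YF) (git_quotient a b) (\<lambda>v. torus_orbit (ptF v))"
proof (rule fs_morphism_to_git_quotient[OF gens ptF_semistable])
  have vals: "ptF v (A i) = conic_point (v $ 1) (v $ 2) $ i" "ptF v (B i) = v $ 4 * conic_point (v $ 1) (v $ 2) $ i"
    "ptF v (C i) = 0" "ptF v W = v $ 3" "ptF v S = 0" "ptF v U = 0" if "v \<in> YF" for v i
    using ptF(3)[OF that] by (simp_all add: has_vals)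
  have conic_poly: "(\<lambda>v. conic_point (v $ 1) (v $ 2) $ i) \<in> poly_functions" for i
  proof -
    have "\<forall>i. (\<lambda>v. conic_point (v $ 1) (v $ 2) $ i) \<in> poly_functions"
      unfolding forall_3 conic_point_def vector_3 by (intro conjI poly_functions_intros)
    then show ?thesis by blast
  qed
  fix g assume "g \<in> gen_set"
  then consider i where "g = A i" | i where "g = B i" | i where "g = C i" | "g = W" | "g = S"
    | "g = U" by blast
  then show "\<exists>q\<in>poly_functions. \<forall>v\<in>YF. ptF v g = q v"
  proof cases
    case (1 i)
    then show ?thesis using conic_poly vals by (intro bexI[of _ "\<lambda>v. conic_point (v $ 1) (v $ 2) $ i"]) auto
  next
    case (2 i)
    then show ?thesis using vals
      by (intro bexI[of _ "\<lambda>v. v $ 4 * conic_point (v $ 1) (v $ 2) $ i"] poly_functions_intros conic_poly) auto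
  next
    case 4
    then show ?thesis using vals by (intro bexI[of _ "\<lambda>v. v $ 3"] poly_functions_intros) auto
  qed (use vals in \<open>intro bexI[of _ "\<lambda>v. 0"] poly_functions_intros; simp\<close>)+
qed

lemma morphism_P:
  "fs_morphism (sub_fspace affine_space (UNIV - {0})) (git_quotient a b) (\<lambda>z. torus_orbit (ptP z))"
proof (rule fs_morphism_to_git_quotient[OF gens])
  show "ptP z \<in> semistable a b" if "z \<in> UNIV - {0}" for z using ptP_semistable that by blast
  have vals: "ptP z (A i) = z $ i" "ptP z (B i) = 0" "ptP z (C i) = 0" "ptP z W = 1"
    "ptP z S = 0" "ptP z U = - (z $ 1 ^ 2 + z $ 2 ^ 2 + z $ 3 ^ 2)" if "z \<in> UNIV - {0}" for z i
    using ptP(3)[of z] that by (simp_all add: has_vals sum_3)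
  fix g assume "g \<in> gen_set"
  then consider i where "g = A i" | i where "g = B i" | i where "g = C i" | "g = W" | "g = S"
    | "g = U" by blast
  then show "\<exists>q\<in>poly_functions. \<forall>z\<in>UNIV - {0}. ptP z g = q z"
  proof cases
    case (1 i)
    then show ?thesis using vals by (intro bexI[of _ "\<lambda>z. z $ i"] poly_functions_intros) auto
  next
    case 4
    then show ?thesis using vals by (intro bexI[of _ "\<lambda>z. 1"] poly_functions_intros) auto
  next
    case 6
    then show ?thesis using vals
      by (intro bexI[of _ "\<lambda>z. - (z $ 1 ^ 2 + z $ 2 ^ 2 + z $ 3 ^ 2)"] poly_functions_intros) auto
  qed (use vals in \<open>intro bexI[of _ "\<lambda>z. 0"] poly_functions_intros; simp\<close>)+
qed

section \<open>The isomorphism of P with the projective plane\<close>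

lemma iso_P:
  "\<exists>h. fs_iso (sub_fspace (git_quotient a b) SP) (proj_space :: (complex ^ 3) set fspace) h \<and>
    (\<forall>z\<in>UNIV - {0}. h (torus_orbit (ptP z)) = proj_class z)"
  unfolding proj_space_def
proof (rule fs_iso_of_charts[OF function_sheaf_git_quotient morphism_P])
  fix z z' :: "complex ^ 3"
  assume z: "z \<in> UNIV - {0}" and z': "z' \<in> UNIV - {0}" and eq: "proj_class z = proj_class z'"
  have "z \<in> proj_class z" unfolding proj_class_def by (intro CollectI exI[of _ 1]) simp
  then obtain c where c: "c \<noteq> 0" "z = c *s z'" unfolding eq unfolding proj_class_def by blast
  \<comment> \<open>This one-parameter group is the stabilizer of the normalization
    \<open>W = 1\<close>; it scales \<open>A\<close> by c and \<open>U\<close> by c^2, as the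
    homogeneity of \<open>ptP\<close> demands.\<close>
  have s: "tor c (inverse c) \<in> torus" using tor c by simp
  have p': "ptP z' \<in> SpecR" and p: "ptP z \<in> SpecR" using ptP z z' by blast+
  have "has_vals (torus_act (tor c (inverse c)) (ptP z')) z 0 1 0 (- (\<Sum>i\<in>UNIV. z $ i ^ 2))"
    using ptP(3)[of z'] z' c
    by (simp add: has_vals act_tor p' power_inverse power_mult_distrib sum_distrib_left)
  then have "torus_act (tor c (inverse c)) (ptP z') = ptP z"
    using has_vals_unique[OF torus_act_in_SpecR[OF s p'] p] ptP(3) z by blast
  then show "torus_orbit (ptP z) = torus_orbit (ptP z')" using torus_orbit_act[OF s p'] by simp
next
  fix z :: "complex ^ 3" assume z: "z \<in> UNIV - {0}"
  then obtain i where i: "z $ i \<noteq> 0" by (auto simp: vec_eq_iff)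
  define \<psi> :: "(laurent \<Rightarrow> complex) set \<Rightarrow> complex ^ 3" where
    "\<psi> x = (\<chi> j. quotient_fraction (A j) (A i) x)" for x
  have in_iff: "torus_orbit (ptP z) \<in> nonvanishing a b (A i) \<longleftrightarrow> z $ i \<noteq> 0" if "z \<in> UNIV - {0}" for z
    using orbit_in_nonvanishing_iff[OF ptP_semistable degA, of z i] that ptP(3)[of z]
    by (simp add: has_vals)
  have \<psi>: "\<psi> (torus_orbit (ptP z)) = inverse (z $ i) *s z" if "z \<in> UNIV - {0}" for z
  proof -
    have z: "z \<noteq> 0" using that by blast
    have "quotient_fraction (A j) (A i) (torus_orbit (ptP z)) = z $ j / z $ i" for j
      using quotient_fraction_orbit[OF ptP(1)[OF z] degA degA, of j i] ptP(3)[OF z]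
      by (simp add: has_vals)
    then show ?thesis by (simp add: \<psi>_def vec_eq_iff divide_inverse mult.commute)
  qed
  show "\<exists>W \<psi>. openin (topo (git_quotient a b)) W \<and> torus_orbit (ptP z) \<in> W \<and>
      (\<forall>k. regular (git_quotient a b) W (\<lambda>x. \<psi> x $ k)) \<and>
      (\<forall>v\<in>UNIV - {0}. torus_orbit (ptP v) \<in> W \<longrightarrow>
        \<psi> (torus_orbit (ptP v)) \<in> UNIV - {0} \<and> proj_class (\<psi> (torus_orbit (ptP v))) = proj_class v)"
  proof (intro exI[of _ "nonvanishing a b (A i)"] exI[of _ \<psi>] conjI allI ballI impI)
    show "openin (topo (git_quotient a b)) (nonvanishing a b (A i))"
      by (rule openin_nonvanishing[OF degA])
    show "torus_orbit (ptP z) \<in> nonvanishing a b (A i)" using in_iff[OF z] i by blast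
    show "regular (git_quotient a b) (nonvanishing a b (A i)) (\<lambda>x. \<psi> x $ k)" for k
      using regular_quotient_fraction[OF degA degA, of a b i k] by (simp add: \<psi>_def)
    fix v :: "complex ^ 3"
    assume v: "v \<in> UNIV - {0}" "torus_orbit (ptP v) \<in> nonvanishing a b (A i)"
    then have "v $ i \<noteq> 0" using in_iff by blast
    then show "proj_class (\<psi> (torus_orbit (ptP v))) = proj_class v"
      using \<psi>[OF v(1)] proj_class_scale[of "inverse (v $ i)" v] by simp
    show "\<psi> (torus_orbit (ptP v)) \<in> UNIV - {0}"
      using \<psi>[OF v(1)] \<open>v $ i \<noteq> 0\<close> v(1) by simp
  qed
qed

text \<open>On the points of \<open>F\<close> parametrized by \<open>(m, n, w, \<beta>)\<close> the elements \<open>square True A\<close>,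
  \<open>square False A\<close> and \<open>mixed\<close> take the values \<open>m\<^sup>2\<close>, \<open>n\<^sup>2\<close> and \<open>m n\<close>.\<close>

definition square :: "bool \<Rightarrow> (3 \<Rightarrow> laurent) \<Rightarrow> laurent" where
  "square \<sigma> X = const_laurent (\<i> / 2) * X 2 + const_laurent (if \<sigma> then 1 / 2 else - 1 / 2) * X 3"

definition mixed :: laurent where
  "mixed = const_laurent (1 / 2) * A 1"

lemma degree_square:
  "square \<sigma> A \<in> R_degree e1" "square \<sigma> B \<in> R_degree e2" "mixed \<in> R_degree e1"
  "square \<sigma> A * square \<sigma> B \<in> R_degree (e1 + e2)"
proof -
  show d: "square \<sigma> A \<in> R_degree e1" "square \<sigma> B \<in> R_degree e2"
    unfolding square_def by (intro R_degree_add R_degree_const_mult degA degB)+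
  show "mixed \<in> R_degree e1" unfolding mixed_def by (intro R_degree_const_mult degA)
  show "square \<sigma> A * square \<sigma> B \<in> R_degree (e1 + e2)" by (rule R_degree_mult[OF d])
qed

section \<open>Charts of the Hirzebruch surface and the isomorphism with F\<close>

definition pivot :: "bool \<Rightarrow> complex ^ 4 \<Rightarrow> complex" where
  "pivot \<sigma> v = (if \<sigma> then v $ 1 else v $ 2)"

lemma ptF_square:
  assumes v: "v \<in> YF"
  shows "ptF v (square \<sigma> A) = pivot \<sigma> v ^ 2" "ptF v (square \<sigma> B) = v $ 4 * pivot \<sigma> v ^ 2"
    "ptF v mixed = pivot \<sigma> v * pivot (\<not> \<sigma>) v"
    "ptF v (square \<sigma> A * square \<sigma> B) = v $ 4 * pivot \<sigma> v ^ 4" "ptF v W = v $ 3"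
proof -
  note p = ptF(1)[OF v]
  have vals: "ptF v (A i) = conic_point (v $ 1) (v $ 2) $ i"
    "ptF v (B i) = v $ 4 * conic_point (v $ 1) (v $ 2) $ i" for i
    using ptF(3)[OF v] by (simp_all add: has_vals)
  show "ptF v W = v $ 3" using ptF(3)[OF v] by (simp add: has_vals)
  show 1: "ptF v (square \<sigma> A) = pivot \<sigma> v ^ 2"
    by (simp add: square_def SpecR_add SpecR_mult mult_in_R p gens_in_R vals conic_point_def pivot_def
        field_simps)
  show 2: "ptF v (square \<sigma> B) = v $ 4 * pivot \<sigma> v ^ 2"
    by (simp add: square_def SpecR_add SpecR_mult mult_in_R p gens_in_R vals conic_point_def pivot_def
        field_simps)
  show "ptF v mixed = pivot \<sigma> v * pivot (\<not> \<sigma>) v"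
    by (simp add: mixed_def SpecR_mult p gens_in_R vals conic_point_def pivot_def)
  show "ptF v (square \<sigma> A * square \<sigma> B) = v $ 4 * pivot \<sigma> v ^ 4"
    by (subst SpecR_mult[OF p R_degree_in_R[OF degree_square(1)] R_degree_in_R[OF degree_square(2)]])
      (simp add: 1 2 eval_nat_numeral)
qed

text \<open>A representative normalized by \<open>pivot\<close> = 1; \<open>\<sigma>\<close> tells
  which of m, n is nonzero, that is, which affine chart of the base line is used.\<close>

definition chart_vector :: "bool \<Rightarrow> complex \<Rightarrow> complex \<Rightarrow> complex \<Rightarrow> complex ^ 4" where
  "chart_vector \<sigma> q c d = vector [if \<sigma> then 1 else q, if \<sigma> then q else 1, c, d]"

text \<open>The normalization uses \<open>l\<close> = 1 / \<open>pivot\<close>, and the weight 4 of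
  the last coordinate turns this into the fourth power. The factor \<open>k\<close> is the remaining
  scaling of the fibre.\<close>

lemma chart_vector_class:
  assumes "pivot \<sigma> v \<noteq> 0" "k \<noteq> 0"
  shows "hirzebruch_class 4
      (chart_vector \<sigma> (pivot (\<not> \<sigma>) v / pivot \<sigma> v) (k * v $ 3) (k * pivot \<sigma> v ^ 4 * v $ 4)) =
    hirzebruch_class 4 v"
  using hirzebruch_class_scale[of "inverse (pivot \<sigma> v)" k 4 v] assms
  by (cases \<sigma>) (simp_all add: chart_vector_def pivot_def divide_inverse mult_ac)

lemma regular_const_git: "openin (topo (git_quotient a b)) V \<Longrightarrow> regular (git_quotient a b) V (\<lambda>_. c)"
  by (rule function_sheaf.regular_const[OF function_sheaf_git_quotient])

lemma regular_chart_vector: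
  assumes V: "openin (topo (git_quotient a b)) V"
    and "regular (git_quotient a b) V q" "regular (git_quotient a b) V c" "regular (git_quotient a b) V d"
  shows "regular (git_quotient a b) V (\<lambda>x. chart_vector \<sigma> (q x) (c x) (d x) $ k)"
proof -
  have "\<forall>k. regular (git_quotient a b) V (\<lambda>x. chart_vector \<sigma> (q x) (c x) (d x) $ k)"
    unfolding forall_4 chart_vector_def vector_4
    using assms regular_const_git[OF V] by (cases \<sigma>) simp_all
  then show ?thesis by blast
qed

lemma iso_F:
  "fs_isomorphic (sub_fspace (git_quotient a b) SF) (hirzebruch 4)"
proof -
  interpret X: function_sheaf "git_quotient a b" by (rule function_sheaf_git_quotient)
  have "\<exists>h. fs_iso (sub_fspace (git_quotient a b) SF)
      (quot_fspace (sub_fspace affine_space YF) (hirzebruch_class 4)) h \<and>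
    (\<forall>v\<in>YF. h (torus_orbit (ptF v)) = hirzebruch_class 4 v)"
  proof (rule fs_iso_of_charts[OF function_sheaf_git_quotient morphism_F])
    fix v v' assume v: "v \<in> YF" and v': "v' \<in> YF"
      and eq: "hirzebruch_class 4 v = hirzebruch_class 4 v'"
    have "v \<in> hirzebruch_class 4 v'" using eq mem_hirzebruch_class by blast
    then obtain l m where lm: "l \<noteq> 0" "m \<noteq> 0"
      "v = vector [l * v' $ 1, l * v' $ 2, m * v' $ 3, inverse l ^ 4 * m * v' $ 4]"
      unfolding hirzebruch_class_def by blast
    \<comment> \<open>As \<open>conic_point\<close> is quadratic, \<open>A\<close> must scale by
      l^2; for \<open>W\<close> to scale by m, the other weight has to be m l^-2. Since
      \<open>B\<close> is \<open>v $ 4\<close> times \<open>A\<close>, the last coordinate scales by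
      m l^-4, which is where the 4 of F_4 comes from.\<close>
    let ?s = "tor (l^2) (m * inverse (l^2))"
    have s: "?s \<in> torus" using tor lm by simp
    have "conic_point (v $ 1) (v $ 2) = l^2 *s conic_point (v' $ 1) (v' $ 2)"
      by (simp add: lm(3) vector_4 conic_point_scale)
    moreover have "v $ 3 = m * v' $ 3" "v $ 4 = inverse l ^ 4 * m * v' $ 4"
      unfolding lm(3) vector_4 by simp_all
    moreover have "inverse l ^ 4 * l^2 = inverse (l^2)"
      using lm(1) by (simp add: field_simps eval_nat_numeral)
    ultimately have "has_vals (torus_act ?s (ptF v'))
        (conic_point (v $ 1) (v $ 2)) (v $ 4 *s conic_point (v $ 1) (v $ 2)) (v $ 3) 0 0"
      using ptF(3)[OF v'] lm(1,2) by (simp add: has_vals act_tor ptF(1)[OF v'] field_simps)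
    then have "torus_act ?s (ptF v') = ptF v"
      using has_vals_unique[OF torus_act_in_SpecR[OF s ptF(1)[OF v']] ptF(1)[OF v]] ptF(3)[OF v] by blast
    then show "torus_orbit (ptF v) = torus_orbit (ptF v')"
      using torus_orbit_act[OF s ptF(1)[OF v']] by simp
  next
    fix v assume v: "v \<in> YF"
    have "pivot True v \<noteq> 0 \<or> pivot False v \<noteq> 0" using v by (simp add: YF_def pivot_def)
    then obtain \<sigma> where \<sigma>: "pivot \<sigma> v \<noteq> 0" by blast
    \<comment> \<open>\<open>?AB\<close> has the same degree as \<open>W\<close> and the value
      \<open>v $ 4 * pivot \<sigma> v ^ 4\<close>, so its ratio to \<open>W\<close> is the
      coordinate on the fibre. Inverting \<open>W\<close> or \<open>?AB\<close> gives the two charts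
      of the fibre.\<close>
    let ?A = "square \<sigma> A" and ?AB = "square \<sigma> A * square \<sigma> B"
    let ?q = "quotient_fraction mixed ?A"
    have in_iff: "torus_orbit (ptF v) \<in> nonvanishing a b ?A \<longleftrightarrow> pivot \<sigma> v \<noteq> 0"
      "torus_orbit (ptF v) \<in> nonvanishing a b W \<longleftrightarrow> v $ 3 \<noteq> 0"
      "torus_orbit (ptF v) \<in> nonvanishing a b ?AB \<longleftrightarrow> v $ 4 * pivot \<sigma> v ^ 4 \<noteq> 0"
      if "v \<in> YF" for v
      using orbit_in_nonvanishing_iff[OF ptF_semistable[OF that] degree_square(1)]
        orbit_in_nonvanishing_iff[OF ptF_semistable[OF that] degW]
        orbit_in_nonvanishing_iff[OF ptF_semistable[OF that] degree_square(4)]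
      by (simp_all add: ptF_square[OF that])
    have fractions: "?q (torus_orbit (ptF v)) = pivot (\<not> \<sigma>) v / pivot \<sigma> v"
      "quotient_fraction ?AB W (torus_orbit (ptF v)) = v $ 4 * pivot \<sigma> v ^ 4 / v $ 3"
      "quotient_fraction W ?AB (torus_orbit (ptF v)) = v $ 3 / (v $ 4 * pivot \<sigma> v ^ 4)"
      if "v \<in> YF" "pivot \<sigma> v \<noteq> 0" for v
      using quotient_fraction_orbit[OF ptF(1)[OF that(1)] degree_square(3,1), of \<sigma>]
        quotient_fraction_orbit[OF ptF(1)[OF that(1)] degree_square(4) degW, of \<sigma>]
        quotient_fraction_orbit[OF ptF(1)[OF that(1)] degW degree_square(4), of \<sigma>] that(2)
      by (simp_all add: ptF_square(1,2,4,5)[OF that(1)] ptF_square(3)[OF that(1), of \<sigma>] power2_eq_square)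
    have ratio_in_YF: "chart_vector \<sigma> q c d \<in> YF" if "c \<noteq> 0 \<or> d \<noteq> 0" for q c d
      using that by (simp add: YF_def chart_vector_def vector_4)
    note open_A = openin_nonvanishing[OF degree_square(1), of a b \<sigma>]
    note regular_q = regular_quotient_fraction[OF degree_square(3,1), of a b \<sigma>]
    show "\<exists>V \<psi>. openin (topo (git_quotient a b)) V \<and> torus_orbit (ptF v) \<in> V \<and>
        (\<forall>k. regular (git_quotient a b) V (\<lambda>x. \<psi> x $ k)) \<and>
        (\<forall>v\<in>YF. torus_orbit (ptF v) \<in> V \<longrightarrow> \<psi> (torus_orbit (ptF v)) \<in> YF \<and>
          hirzebruch_class 4 (\<psi> (torus_orbit (ptF v))) = hirzebruch_class 4 v)"
    proof (cases "v $ 3 = 0")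
      case False
      let ?V = "nonvanishing a b ?A \<inter> nonvanishing a b W"
      let ?\<psi> = "\<lambda>x. chart_vector \<sigma> (?q x) 1 (quotient_fraction ?AB W x)"
      note open_W = openin_nonvanishing[OF degW, of a b]
      have open_V: "openin (topo (git_quotient a b)) ?V" using open_A open_W by blast
      show ?thesis
      proof (intro exI[of _ ?V] exI[of _ ?\<psi>] conjI allI ballI impI open_V)
        show "torus_orbit (ptF v) \<in> ?V" using in_iff[OF v] \<sigma> False by blast
        show "regular (git_quotient a b) ?V (\<lambda>x. ?\<psi> x $ k)" for k
        proof (rule regular_chart_vector[OF open_V _ regular_const_git[OF open_V]])
          show "regular (git_quotient a b) ?V ?q"
            by (rule X.regular_restrict[OF open_A regular_q open_V]) auto
          show "regular (git_quotient a b) ?V (quotient_fraction ?AB W)"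
            by (rule X.regular_restrict[OF open_W regular_quotient_fraction[OF degree_square(4) degW] open_V])
              auto
        qed
        fix v assume v: "v \<in> YF" and "torus_orbit (ptF v) \<in> ?V"
        then have nz: "pivot \<sigma> v \<noteq> 0" "v $ 3 \<noteq> 0" using in_iff[OF v] by blast+
        show "?\<psi> (torus_orbit (ptF v)) \<in> YF" by (rule ratio_in_YF) simp
        show "hirzebruch_class 4 (?\<psi> (torus_orbit (ptF v))) = hirzebruch_class 4 v"
          using chart_vector_class[of \<sigma> v "inverse (v $ 3)"] nz
          by (simp add: fractions[OF v nz(1)] divide_inverse mult_ac)
      qed
    next
      case True
      then have v4: "v $ 4 \<noteq> 0" using v by (simp add: YF_def)
      let ?V = "nonvanishing a b ?A \<inter> nonvanishing a b ?AB"
      let ?\<psi> = "\<lambda>x. chart_vector \<sigma> (?q x) (quotient_fraction W ?AB x) 1"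
      note open_AB = openin_nonvanishing[OF degree_square(4), of a b \<sigma>]
      have open_V: "openin (topo (git_quotient a b)) ?V" using open_A open_AB by blast
      show ?thesis
      proof (intro exI[of _ ?V] exI[of _ ?\<psi>] conjI allI ballI impI open_V)
        show "torus_orbit (ptF v) \<in> ?V" using in_iff[OF v] \<sigma> v4 by simp
        show "regular (git_quotient a b) ?V (\<lambda>x. ?\<psi> x $ k)" for k
        proof (rule regular_chart_vector[OF open_V _ _ regular_const_git[OF open_V]])
          show "regular (git_quotient a b) ?V ?q"
            by (rule X.regular_restrict[OF open_A regular_q open_V]) auto
          show "regular (git_quotient a b) ?V (quotient_fraction W ?AB)"
            by (rule X.regular_restrict[OF open_AB regular_quotient_fraction[OF degW degree_square(4)] open_V])
              auto
        qed
        fix v assume v: "v \<in> YF" and "torus_orbit (ptF v) \<in> ?V"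
        then have nz: "pivot \<sigma> v \<noteq> 0" "v $ 4 \<noteq> 0" using in_iff[OF v] by auto
        show "?\<psi> (torus_orbit (ptF v)) \<in> YF" by (rule ratio_in_YF) simp
        show "hirzebruch_class 4 (?\<psi> (torus_orbit (ptF v))) = hirzebruch_class 4 v"
          using chart_vector_class[of \<sigma> v "inverse (v $ 4 * pivot \<sigma> v ^ 4)"] nz
          by (simp add: fractions[OF v nz(1)] divide_inverse mult_ac)
      qed
    qed
  qed
  then show ?thesis unfolding fs_isomorphic_def hirzebruch_def YF_def by blast
qed

text \<open>On P the remaining equation of F is \<open>U = 0\<close>, that is, the sum of squares of
  the plane coordinates. Its gradient 2 z vanishes only at 0.\<close>

lemma smooth_intersection:
  assumes h: "\<And>z. z \<in> UNIV - {0} \<Longrightarrow> h (torus_orbit (ptP z)) = proj_class z"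
  shows "smooth_quadric (h ` (SF \<inter> SP))"
proof -
  have form: "quad_form (mat 1) z = (\<Sum>i\<in>UNIV. z $ i ^ 2)" for z :: "complex ^ 3"
    by (simp add: quad_form_def sum_3 mat_def power2_eq_square)
  have in_SF: "torus_orbit (ptP z) \<in> SF \<longleftrightarrow> quad_form (mat 1) z = 0" if "z \<noteq> 0" for z
    using ptP(3)[OF that] unfolding orbit_in_SF_iff[OF ptP_semistable[OF that]]
    by (auto simp: has_vals form)
  have "SF \<inter> SP = (\<lambda>z. torus_orbit (ptP z)) ` {z. z \<noteq> 0 \<and> quad_form (mat 1) z = 0}"
    using in_SF by auto
  then have "h ` (SF \<inter> SP) = (\<lambda>z. h (torus_orbit (ptP z))) ` {z. z \<noteq> 0 \<and> quad_form (mat 1) z = 0}"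
    by (simp only: image_image)
  also have "\<dots> = proj_class ` {z. z \<noteq> 0 \<and> quad_form (mat 1) z = 0}"
    using h by (intro image_cong) auto
  also have "\<dots> = {proj_class z | z. z \<noteq> 0 \<and> quad_form (mat 1) z = 0}" by blast
  finally have eq: "h ` (SF \<inter> SP) = {proj_class z | z. z \<noteq> 0 \<and> quad_form (mat 1) z = 0}" .
  have "(mat 1 + transpose (mat 1)) *v z = z + z" for z :: "complex ^ 3"
    unfolding transpose_mat matrix_vector_mult_add_rdistrib matrix_vector_mul_lid ..
  then have "(mat 1 + transpose (mat 1)) *v z \<noteq> 0" if "z \<noteq> 0" for z :: "complex ^ 3"
    using that by (simp add: vec_eq_iff)
  then show ?thesis unfolding smooth_quadric_def eq by blast
qed

lemma central_fiber_structure: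
  "\<exists>F P. closedin (topo (git_quotient a b)) F \<and> closedin (topo (git_quotient a b)) P \<and>
    central_fiber a b = F \<union> P \<and>
    fs_isomorphic (sub_fspace (git_quotient a b) F) (hirzebruch 4) \<and>
    (\<exists>h. fs_iso (sub_fspace (git_quotient a b) P) (proj_space :: (complex ^ 3) set fspace) h \<and>
      smooth_quadric (h ` (F \<inter> P)))"
proof -
  obtain h where h: "fs_iso (sub_fspace (git_quotient a b) SP) (proj_space :: (complex ^ 3) set fspace) h"
    "\<And>z. z \<in> UNIV - {0} \<Longrightarrow> h (torus_orbit (ptP z)) = proj_class z"
    using iso_P by blast
  show ?thesis
    by (intro exI[of _ SF] exI[of _ SP] exI[of _ h] conjI closed_SF closed_SP central_fiber_eq iso_F h(1)
        smooth_intersection h(2))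
qed

end

end

section \<open>The locale assumptions for the two linearizations\<close>

lemma phi_squares_in_invariants:
  "(\<lambda>v. phi0 i v ^ 2) \<in> invariants" "(\<lambda>v. phi2 i v ^ 2) \<in> invariants" "phi_rest i \<in> invariants"
proof -
  note R = standard_in_R
  have "\<forall>i. phi0 i \<in> poly_functions" "\<forall>i. phi2 i \<in> poly_functions" "\<forall>i. phi_rest i \<in> poly_functions"
    unfolding forall_3 phi_vector_simps using phi_in_poly_functions by blast+
  then have poly: "phi0 i \<in> poly_functions" "phi2 i \<in> poly_functions" "phi_rest i \<in> poly_functions"
    by blast+
  show "phi_rest i \<in> invariants" by (rule invariantsI[OF poly(3) R(3)])
  have "lterm 1 0 (phi0 i) * lterm 1 0 (phi0 i) * lterm (-2) 0 1 \<in> R"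
    "lterm 0 1 (phi2 i) * lterm 0 1 (phi2 i) * lterm 0 (-2) 1 \<in> R"
    by (intro mult_in_R R R_generators)+
  then have "lterm 0 0 (\<lambda>v. phi0 i v ^ 2) \<in> R" "lterm 0 0 (\<lambda>v. phi2 i v ^ 2) \<in> R"
    by (simp_all add: lterm_mult power2_eq_square times_fun_def)
  then show "(\<lambda>v. phi0 i v ^ 2) \<in> invariants" "(\<lambda>v. phi2 i v ^ 2) \<in> invariants"
    using poly by (auto intro: invariantsI poly_functions_intros)
qed

text \<open>The first two say that the rows 0 and 2 of the skew matrix of the forms are isotropic.
  The other three are, up to signs, the Plucker relations on four indices containing 0 and
  2.\<close>

lemma phi_relations:
  "(\<Sum>i\<in>UNIV. phi0 i v ^ 2) = - (phi02 v ^ 2)" "(\<Sum>i\<in>UNIV. phi2 i v ^ 2) = - (phi02 v ^ 2)"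
  "phi0 1 v * phi2 2 v - phi0 2 v * phi2 1 v = - phi02 v * phi_rest 1 v"
  "phi0 1 v * phi2 3 v - phi0 3 v * phi2 1 v = phi02 v * phi_rest 2 v"
  "phi0 2 v * phi2 3 v - phi0 3 v * phi2 2 v = phi02 v * phi_rest 3 v"
  unfolding sum_3 phi_vector_simps phi_defs by (simp_all add: power2_eq_square algebra_simps)

lemma sum_3_SpecR:
  assumes "p \<in> SpecR" "\<And>i::3. f i \<in> R"
  shows "(\<Sum>i\<in>UNIV. p (f i) ^ 2) = p (f 1 * f 1 + f 2 * f 2 + f 3 * f 3)"
  using assms by (simp add: sum_3 SpecR_add SpecR_mult mult_in_R add_in_R power2_eq_square)

text \<open>Isotropy of the rows made homogeneous: t2^-2 removes the surplus t2^2 in the square of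
  \<open>phi02\<close> t0 t2, and t0^-2 does so for the other row.\<close>

lemma SpecR_quadric:
  assumes p: "p \<in> SpecR"
  shows "(\<Sum>i\<in>UNIV. p (lterm 1 0 (phi0 i)) ^ 2) = - (p (lterm 1 1 phi02) ^ 2) * p (lterm 0 (-2) 1)"
    and "(\<Sum>i\<in>UNIV. p (lterm 0 1 (phi2 i)) ^ 2) = - (p (lterm 1 1 phi02) ^ 2) * p (lterm (-2) 0 1)"
proof -
  have "(\<lambda>v. - 1 * (phi02 * phi02) v) = phi0 1 * phi0 1 + phi0 2 * phi0 2 + phi0 3 * phi0 3"
    using phi_relations(1) by (simp add: fun_eq_iff sum_3 power2_eq_square)
  then have "lterm 1 0 (phi0 1) * lterm 1 0 (phi0 1) + lterm 1 0 (phi0 2) * lterm 1 0 (phi0 2) +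
      lterm 1 0 (phi0 3) * lterm 1 0 (phi0 3) =
    const_laurent (- 1) * (lterm 1 1 phi02 * lterm 1 1 phi02 * lterm 0 (-2) 1)"
    by (simp add: lterm_mult lterm_add const_laurent_mult_lterm)
  then show "(\<Sum>i\<in>UNIV. p (lterm 1 0 (phi0 i)) ^ 2) =
      - (p (lterm 1 1 phi02) ^ 2) * p (lterm 0 (-2) 1)"
    unfolding sum_3_SpecR[OF p standard_in_R(1)] using p R_generators
    by (simp add: SpecR_mult mult_in_R power2_eq_square)
  have "(\<lambda>v. - 1 * (phi02 * phi02) v) = phi2 1 * phi2 1 + phi2 2 * phi2 2 + phi2 3 * phi2 3"
    using phi_relations(2) by (simp add: fun_eq_iff sum_3 power2_eq_square)
  then have "lterm 0 1 (phi2 1) * lterm 0 1 (phi2 1) + lterm 0 1 (phi2 2) * lterm 0 1 (phi2 2) +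
      lterm 0 1 (phi2 3) * lterm 0 1 (phi2 3) =
    const_laurent (- 1) * (lterm 1 1 phi02 * lterm 1 1 phi02 * lterm (-2) 0 1)"
    by (simp add: lterm_mult lterm_add const_laurent_mult_lterm)
  then show "(\<Sum>i\<in>UNIV. p (lterm 0 1 (phi2 i)) ^ 2) =
      - (p (lterm 1 1 phi02) ^ 2) * p (lterm (-2) 0 1)"
    unfolding sum_3_SpecR[OF p standard_in_R(2)] using p R_generators
    by (simp add: SpecR_mult mult_in_R power2_eq_square)
qed

text \<open>By the Plucker relations the 2 x 2 minors of the two rows are multiples of
  \<open>phi02\<close> t0 t2 times an entry of \<open>phi_rest\<close>, and these entries vanish by
  hypothesis.\<close>

lemma SpecR_parallel:
  assumes p: "p \<in> SpecR" and c: "\<And>i. p (lterm 0 0 (phi_rest i)) = 0"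
  shows "p (lterm 1 0 (phi0 i)) * p (lterm 0 1 (phi2 j)) =
    p (lterm 1 0 (phi0 j)) * p (lterm 0 1 (phi2 i))"
proof -
  have rel: "p (lterm 1 0 (phi0 i)) * p (lterm 0 1 (phi2 j)) =
      p (lterm 1 0 (phi0 j)) * p (lterm 0 1 (phi2 i))"
    if "\<And>v. phi0 i v * phi2 j v - phi0 j v * phi2 i v = k * phi02 v * phi_rest l v" for i j k l
  proof -
    have "phi0 i * phi2 j = phi0 j * phi2 i + (\<lambda>v. k * (phi02 * phi_rest l) v)"
      using that by (simp add: fun_eq_iff algebra_simps)
    then have "lterm 1 0 (phi0 i) * lterm 0 1 (phi2 j) = lterm 1 0 (phi0 j) * lterm 0 1 (phi2 i) +
        const_laurent k * (lterm 1 1 phi02 * lterm 0 0 (phi_rest l))"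
      by (simp add: lterm_mult lterm_add const_laurent_mult_lterm)
    then have "p (lterm 1 0 (phi0 i) * lterm 0 1 (phi2 j)) =
        p (lterm 1 0 (phi0 j) * lterm 0 1 (phi2 i) +
          const_laurent k * (lterm 1 1 phi02 * lterm 0 0 (phi_rest l)))"
      by (rule arg_cong)
    then show ?thesis
      using p R_generators standard_in_R c by (simp add: SpecR_mult SpecR_add mult_in_R)
  qed
  have "\<forall>i j. p (lterm 1 0 (phi0 i)) * p (lterm 0 1 (phi2 j)) =
      p (lterm 1 0 (phi0 j)) * p (lterm 0 1 (phi2 i))"
    unfolding forall_3
    using rel[of 1 2 "- 1" 1] rel[of 1 3 1 2] rel[of 2 3 1 3] phi_relations by auto
  then show ?thesis by blast
qed

lemma SpecR_central:
  assumes p: "p \<in> SpecR" "to_VG p = VG_origin"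
  shows "p (lterm 0 0 (phi_rest i)) = 0"
    and "p (lterm 1 0 (phi0 i)) ^ 2 * p (lterm (-2) 0 1) = 0"
    and "p (lterm 0 1 (phi2 i)) ^ 2 * p (lterm 0 (-2) 1) = 0"
proof -
  have o: "p (lterm 0 0 h) = h 0" if "h \<in> invariants" for h
    using p(2) that unfolding to_VG_eq_origin_iff by blast
  have z: "\<forall>i. phi0 i 0 = 0" "\<forall>i. phi2 i 0 = 0" "\<forall>i. phi_rest i 0 = 0"
    unfolding forall_3 phi_vector_simps phi_defs by simp_all
  show "p (lterm 0 0 (phi_rest i)) = 0" using o[OF phi_squares_in_invariants(3)] z by simp
  have "lterm 1 0 (phi0 i) * lterm 1 0 (phi0 i) * lterm (-2) 0 1 = lterm 0 0 (\<lambda>v. phi0 i v ^ 2)"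
    "lterm 0 1 (phi2 i) * lterm 0 1 (phi2 i) * lterm 0 (-2) 1 = lterm 0 0 (\<lambda>v. phi2 i v ^ 2)"
    by (simp_all add: lterm_mult power2_eq_square times_fun_def)
  then have "p (lterm 1 0 (phi0 i) * lterm 1 0 (phi0 i) * lterm (-2) 0 1) = 0"
    "p (lterm 0 1 (phi2 i) * lterm 0 1 (phi2 i) * lterm 0 (-2) 1) = 0"
    using o[OF phi_squares_in_invariants(1), of i] o[OF phi_squares_in_invariants(2), of i] z by simp_all
  then show "p (lterm 1 0 (phi0 i)) ^ 2 * p (lterm (-2) 0 1) = 0"
    "p (lterm 0 1 (phi2 i)) ^ 2 * p (lterm 0 (-2) 1) = 0"
    using p R_generators standard_in_R by (simp_all add: SpecR_mult mult_in_R power2_eq_square)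
qed

lemma standard_degrees:
  "lterm 1 0 (phi0 i) \<in> R_deg 1 0" "lterm 0 1 (phi2 i) \<in> R_deg 0 1"
  "lterm 0 0 (phi_rest i) \<in> R_deg 0 0" "lterm 1 1 phi02 \<in> R_deg 1 1"
  "lterm (-2) 0 1 \<in> R_deg (-2) 0" "lterm 0 (-2) 1 \<in> R_deg 0 (-2)"
  using lterm_in_R_degree standard_in_R R_generators by fastforce+

lemma central_fiber_data_2_1:
  "central_fiber_data (1, 0) (0, 1) (\<lambda>i. lterm 1 0 (phi0 i)) (\<lambda>i. lterm 0 1 (phi2 i))
    (\<lambda>i. lterm 0 0 (phi_rest i)) (lterm 1 1 phi02) (lterm (-2) 0 1) (lterm 0 (-2) 1) Pair has_values"
proof
  show "R = subalg_gen const_laurent (range (\<lambda>i. lterm 1 0 (phi0 i)) \<union> range (\<lambda>i. lterm 0 1 (phi2 i)) \<union>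
      range (\<lambda>i. lterm 0 0 (phi_rest i)) \<union> {lterm 1 1 phi02, lterm (-2) 0 1, lterm 0 (-2) 1})"
    using R_eq_standard unfolding standard_gens_def .
  fix z :: "complex ^ 3" and \<beta> w :: complex
  assume z: "(\<Sum>i\<in>UNIV. z $ i ^ 2) = 0" "z \<noteq> 0" "\<beta> \<noteq> 0"
  show "\<exists>p\<in>SpecR. to_VG p = VG_origin \<and> has_values p z (\<beta> *s z) w 0 0"
    by (rule central_limit_point[OF central_limit_conic[OF z]])
next
  fix z :: "complex ^ 3" and w u :: complex
  assume "(\<Sum>i\<in>UNIV. z $ i ^ 2) = - (w^2) * u" "u \<noteq> 0"
  then show "\<exists>p\<in>SpecR. to_VG p = VG_origin \<and> has_values p z 0 w 0 u"
    by (intro central_limit_point central_limit_plane)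
next
  fix p :: "laurent \<Rightarrow> complex" and i j
  assume p: "p \<in> SpecR"
  show "(\<Sum>i\<in>UNIV. p (lterm 1 0 (phi0 i)) ^ 2) = - (p (lterm 1 1 phi02) ^ 2) * p (lterm 0 (-2) 1)"
    by (rule SpecR_quadric(1)[OF p])
  show "p (lterm 1 0 (phi0 i)) * p (lterm 0 1 (phi2 j)) = p (lterm 1 0 (phi0 j)) * p (lterm 0 1 (phi2 i))"
    if "\<And>i. p (lterm 0 0 (phi_rest i)) = 0"
    by (rule SpecR_parallel[OF p that])
  show "p (lterm 0 0 (phi_rest i)) = 0 \<and> p (lterm 1 0 (phi0 i)) ^ 2 * p (lterm (-2) 0 1) = 0 \<and>
      p (lterm 0 1 (phi2 i)) ^ 2 * p (lterm 0 (-2) 1) = 0" if "to_VG p = VG_origin"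
    using SpecR_central[OF p that] by blast
qed (auto simp: has_values_def standard_degrees torus_def chi_def)

lemma central_fiber_data_1_2:
  "central_fiber_data (0, 1) (1, 0) (\<lambda>i. lterm 0 1 (phi2 i)) (\<lambda>i. lterm 1 0 (phi0 i))
    (\<lambda>i. lterm 0 0 (phi_rest i)) (lterm 1 1 phi02) (lterm 0 (-2) 1) (lterm (-2) 0 1) (\<lambda>c d. (d, c))
    (\<lambda>p z y w s u. has_values p y z w u s)"
proof
  show "R = subalg_gen const_laurent (range (\<lambda>i. lterm 0 1 (phi2 i)) \<union> range (\<lambda>i. lterm 1 0 (phi0 i)) \<union>
      range (\<lambda>i. lterm 0 0 (phi_rest i)) \<union> {lterm 1 1 phi02, lterm 0 (-2) 1, lterm (-2) 0 1})"
    using R_eq_standard unfolding standard_gens_def by (simp add: insert_commute Un_commute)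
  fix z :: "complex ^ 3" and \<beta> w :: complex
  assume z: "(\<Sum>i\<in>UNIV. z $ i ^ 2) = 0" "z \<noteq> 0" "\<beta> \<noteq> 0"
  \<comment> \<open>The curves are taken for the negated data, since \<open>index_swap\<close>
    negates \<open>phi0\<close>, \<open>phi2\<close> and \<open>phi02\<close>.\<close>
  have "central_limit (- z) (\<beta> *s (- z)) (- w) 0 0"
    using z by (intro central_limit_conic) auto
  moreover have "- (\<beta> *s (- z)) = \<beta> *s z" by (simp add: vec_eq_iff)
  ultimately show "\<exists>p\<in>SpecR. to_VG p = VG_origin \<and> has_values p (\<beta> *s z) z w 0 0"
    using central_limit_point_swapped[of "- z" "\<beta> *s (- z)" "- w" 0 0] by (simp only: minus_minus)
next
  fix z :: "complex ^ 3" and w u :: complex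
  assume "(\<Sum>i\<in>UNIV. z $ i ^ 2) = - (w^2) * u" "u \<noteq> 0"
  then have "central_limit (- z) 0 (- w) 0 u" by (intro central_limit_plane) auto
  from central_limit_point_swapped[OF this]
  show "\<exists>p\<in>SpecR. to_VG p = VG_origin \<and> has_values p 0 z w u 0" by simp
next
  fix p :: "laurent \<Rightarrow> complex" and i j
  assume p: "p \<in> SpecR"
  show "(\<Sum>i\<in>UNIV. p (lterm 0 1 (phi2 i)) ^ 2) = - (p (lterm 1 1 phi02) ^ 2) * p (lterm (-2) 0 1)"
    by (rule SpecR_quadric(2)[OF p])
  show "p (lterm 0 1 (phi2 i)) * p (lterm 1 0 (phi0 j)) = p (lterm 0 1 (phi2 j)) * p (lterm 1 0 (phi0 i))"
    if "\<And>i. p (lterm 0 0 (phi_rest i)) = 0"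
    using SpecR_parallel[OF p that, of j i] by (simp only: mult.commute)
  show "p (lterm 0 0 (phi_rest i)) = 0 \<and> p (lterm 0 1 (phi2 i)) ^ 2 * p (lterm 0 (-2) 1) = 0 \<and>
      p (lterm 1 0 (phi0 i)) ^ 2 * p (lterm (-2) 0 1) = 0" if "to_VG p = VG_origin"
    using SpecR_central[OF p that] by blast
qed (auto simp: has_values_def standard_degrees torus_def chi_def)

theorem proposition5p22:
  fixes a b :: int
  assumes "(a, b) \<in> {(2, 1), (1, 2)}"
  shows "\<exists>F P. closedin (topo (git_quotient a b)) F \<and> closedin (topo (git_quotient a b)) P \<and>
           central_fiber a b = F \<union> P \<and>
           fs_isomorphic (sub_fspace (git_quotient a b) F) (hirzebruch 4) \<and>
           (\<exists>h. fs_iso (sub_fspace (git_quotient a b) P) (proj_space :: (complex ^ 3) set fspace) h \<and>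
                smooth_quadric (h ` (F \<inter> P)))"
proof -
  from assms consider "(a, b) = (1, 0) + (1, 0) + (0, 1)" | "(a, b) = (0, 1) + (0, 1) + (1, 0)"
    by auto
  then show ?thesis
    using central_fiber_data.central_fiber_structure[OF central_fiber_data_2_1]
      central_fiber_data.central_fiber_structure[OF central_fiber_data_1_2] by cases
qed

end
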